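(* Let $K$ be a continuum (not necessarily metrizable). 1) If $K$ is separable and $\aleph_0$--ac then $K$ is an arc. 2) If $K$ is non-separable, then the following are equivalent: (i) $K$ is $\aleph_0$--ac; (ii) $K$ is the continuous injective image of a closed sub-interval of the long line; (iii) $K$ is (homeomorphic to) one of: the long circle, the long lollipop, the long dumbbell, the long figure eight, or the long theta-curve. 3) If $K$ is $\kappa$--ac for some cardinal $\kappa>\aleph_0$, then $K$ is an arc.
   Context: A continuum here is a compact connected Hausdorff space. An arc is a space homeomorphic to $[0,1]$. For a cardinal $\kappa$, a space is $\kappa$--ac if every subset of size no more than $\kappa$ is contained in an arc in the space (a subspace homeomorphic to $[0,1]$). The long ray $R$ is the lexicographic product of $\omega_1$ with $[0,1)$ with the order topology; $\omega_1$ is identified with $\omega_1\times\{0\}$. $R^-$ is $R$ with each point $x$ relabeled $-x$, and the long line $L$ is obtained by identifying $0$ in $R$ with $-0$ in $R^-$ (linearly ordered in the natural way, with $R^-$ below $R$). $\alpha R$ denotes the one point compactification of $R$, and $\gamma L$ the corresponding two point compactification of $L$, with added endpoints $-\infty$ and $+\infty$. The long circle is obtained from $\alpha R$ by identifying the point at infinity with $0$; the long lollipop is obtained from $\alpha R$ by identifying the point at infinity with a point of $R$ other than $0$. The long dumbbell is obtained from $\gamma L$ by identifying $-\infty$ with $-1$ and $+\infty$ with $+1$; the long figure eight by identifying both $-\infty$ and $+\infty$ with $0$; the long theta-curve by identifying $-\infty$ with $+1$ and $+\infty$ with $-1$. *)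

theory Defs
  imports "HOL-Analysis.Analysis" "HOL-Library.Extended"
begin

unbundle cardinal_syntax

section \<open>Arcs and \<open>\<kappa>\<close>-arc-connectedness\<close>

definition continuum_space :: "'a topology \<Rightarrow> bool" where
  "continuum_space X \<longleftrightarrow> compact_space X \<and> connected_space X \<and> Hausdorff_space X"

definition arc_space :: "'a topology \<Rightarrow> bool" where
  "arc_space X \<longleftrightarrow> X homeomorphic_space top_of_set {0..1::real}"

definition arc_in :: "'a topology \<Rightarrow> 'a set \<Rightarrow> bool" where
  "arc_in X A \<longleftrightarrow> A \<subseteq> topspace X \<and> arc_space (subtopology X A)"

text \<open>Cardinals are represented by cardinal orders \<open>\<kappa>\<close> (\<^term>\<open>Card_order \<kappa>\<close>), with
  \<^term>\<open>natLeq\<close> for aleph-zero.\<close>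

definition ac_space :: "'k rel \<Rightarrow> 'a topology \<Rightarrow> bool" where
  "ac_space \<kappa> X \<longleftrightarrow> (\<forall>S. S \<subseteq> topspace X \<and> |S| \<le>o \<kappa> \<longrightarrow> (\<exists>A. arc_in X A \<and> S \<subseteq> A))"

lemma countable_iff_ordLeq_natLeq: "countable A \<longleftrightarrow> |A| \<le>o natLeq"
proof -
  have "countable A \<longleftrightarrow> |A| \<le>o |UNIV :: nat set|"
    unfolding countable_def card_of_ordLeq[symmetric] by simp
  also have "\<dots> \<longleftrightarrow> |A| \<le>o natLeq"
    using card_of_nat ordIso_symmetric ordLeq_ordIso_trans by blast
  finally show ?thesis .
qed

lemma ac_space_natLeq_iff:
  "ac_space natLeq X \<longleftrightarrow> (\<forall>S. S \<subseteq> topspace X \<and> countable S \<longrightarrow> (\<exists>A. arc_in X A \<and> S \<subseteq> A))"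
  by (simp add: ac_space_def countable_iff_ordLeq_natLeq)


section \<open>The first uncountable ordinal\<close>

typedef omega1 = "Field (cardSuc natLeq)"
proof -
  have "infinite (Field (cardSuc natLeq))"
    using Cinfinite_cardSuc[OF natLeq_Cinfinite] by (simp add: cinfinite_def)
  then have "Field (cardSuc natLeq) \<noteq> {}" by (metis finite.emptyI)
  then show ?thesis by blast
qed

instantiation omega1 :: wellorder
begin

definition less_eq_omega1 :: "omega1 \<Rightarrow> omega1 \<Rightarrow> bool" where
  "(x::omega1) \<le> y \<longleftrightarrow> (Rep_omega1 x, Rep_omega1 y) \<in> cardSuc natLeq"

definition less_omega1 :: "omega1 \<Rightarrow> omega1 \<Rightarrow> bool" where
  "(x::omega1) < y \<longleftrightarrow> x \<le> y \<and> \<not> y \<le> x"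

instance
proof
  have wo: "Well_order (cardSuc natLeq)"
    using cardSuc_Card_order[OF natLeq_Card_order] by (rule Card_order_wo_rel[unfolded wo_rel_def])
  have lin: "Linear_order (cardSuc natLeq)"
    and wf: "wf (cardSuc natLeq - Id)"
    using wo by (auto simp: well_order_on_def)
  have refl: "(a, a) \<in> cardSuc natLeq" if "a \<in> Field (cardSuc natLeq)" for a
    using lin that by (auto simp: order_on_defs refl_on_def)
  have trans: "trans (cardSuc natLeq)" and antisym: "antisym (cardSuc natLeq)"
    and total: "total_on (Field (cardSuc natLeq)) (cardSuc natLeq)"
    using lin by (auto simp: order_on_defs)
  fix x y z :: omega1
  show "x < y \<longleftrightarrow> x \<le> y \<and> \<not> y \<le> x" by (rule less_omega1_def)
  show "x \<le> x" by (simp add: less_eq_omega1_def refl Rep_omega1)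
  show "x \<le> y \<Longrightarrow> y \<le> z \<Longrightarrow> x \<le> z"
    using trans by (auto simp: less_eq_omega1_def dest: transD)
  show "x \<le> y \<Longrightarrow> y \<le> x \<Longrightarrow> x = y"
    using antisym by (auto simp: less_eq_omega1_def Rep_omega1_inject dest: antisymD)
  show "x \<le> y \<or> y \<le> x"
    using total refl Rep_omega1[of x] Rep_omega1[of y]
    by (cases "Rep_omega1 x = Rep_omega1 y") (auto simp: less_eq_omega1_def total_on_def)
  fix P :: "omega1 \<Rightarrow> bool" and a :: omega1
  assume step: "\<And>x. (\<And>y. y < x \<Longrightarrow> P y) \<Longrightarrow> P x"
  have sub: "{(y, x). y < x} \<subseteq> inv_image (cardSuc natLeq - Id) Rep_omega1"
    by (auto simp: less_omega1_def less_eq_omega1_def)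
  have "wf {(y, x :: omega1). y < x}"
    using wf_subset[OF wf_inv_image[OF wf] sub] .
  then show "P a"
    by (induction a rule: wf_induct_rule) (auto intro: step)
qed

end

instantiation omega1 :: "{zero, one}"
begin
definition zero_omega1 :: omega1 where "(0::omega1) = (LEAST x. True)"
definition one_omega1 :: omega1 where "(1::omega1) = (LEAST x. 0 < x)"
instance ..
end

lemma omega1_zero_le [simp]: "0 \<le> (x :: omega1)"
  unfolding zero_omega1_def by (rule Least_le) simp

lemma uncountable_omega1: "uncountable (UNIV :: omega1 set)"
proof
  assume "countable (UNIV :: omega1 set)"
  then have "countable (Field (cardSuc natLeq))"
    using countable_image[of UNIV Rep_omega1] type_definition.Rep_range[OF type_definition_omega1]
    by simp
  then have "|Field (cardSuc natLeq)| \<le>o natLeq"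
    by (simp add: countable_iff_ordLeq_natLeq)
  then have "cardSuc natLeq \<le>o natLeq"
    using card_of_Field_ordIso[OF cardSuc_Card_order[OF natLeq_Card_order]]
    by (meson ordIso_ordLeq_trans ordIso_symmetric)
  then show False
    using cardSuc_greater[OF natLeq_Card_order] not_ordLess_ordLeq by blast
qed

lemma omega1_zero_less_one [simp]: "0 < (1 :: omega1)"
proof -
  have "(UNIV :: omega1 set) \<noteq> {0}"
    using uncountable_omega1 by (metis countable_empty countable_insert)
  then obtain x :: omega1 where "x \<noteq> 0" by blast
  then have "0 < x" using omega1_zero_le[of x] by (simp add: order.not_eq_order_implies_strict)
  then show ?thesis unfolding one_omega1_def by (rule LeastI)
qed


section \<open>The long ray\<close>

typedef long_ray = "(UNIV :: omega1 set) \<times> {0..<1::real}"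
  by (rule exI[of _ "(undefined, 0)"]) simp

instantiation long_ray :: linorder
begin

definition less_eq_long_ray :: "long_ray \<Rightarrow> long_ray \<Rightarrow> bool" where
  "(x::long_ray) \<le> y \<longleftrightarrow> fst (Rep_long_ray x) < fst (Rep_long_ray y) \<or>
     fst (Rep_long_ray x) = fst (Rep_long_ray y) \<and> snd (Rep_long_ray x) \<le> snd (Rep_long_ray y)"

definition less_long_ray :: "long_ray \<Rightarrow> long_ray \<Rightarrow> bool" where
  "(x::long_ray) < y \<longleftrightarrow> x \<le> y \<and> \<not> y \<le> x"

instance
proof
  fix x y z :: long_ray
  show "x \<le> y \<Longrightarrow> y \<le> x \<Longrightarrow> x = y"
    by (auto simp: less_eq_long_ray_def prod_eq_iff simp flip: Rep_long_ray_inject)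
qed (auto simp: less_eq_long_ray_def less_long_ray_def)

end

instantiation long_ray :: linorder_topology
begin

definition open_long_ray :: "long_ray set \<Rightarrow> bool" where
  "open_long_ray = generate_topology (range lessThan \<union> range greaterThan)"

instance
  by standard (rule open_long_ray_def)

end

instantiation long_ray :: "{zero, one}"
begin
definition zero_long_ray :: long_ray where "(0::long_ray) = Abs_long_ray (0, 0)"
definition one_long_ray :: long_ray where "(1::long_ray) = Abs_long_ray (1, 0)"
instance ..
end

lemma long_ray_zero_le [simp]: "0 \<le> (x :: long_ray)"
proof -
  have "0 \<le> snd (Rep_long_ray x)"
    using Rep_long_ray[of x] by (auto simp: mem_Times_iff)
  then show ?thesis
    using omega1_zero_le[of "fst (Rep_long_ray x)"]
    by (auto simp: less_eq_long_ray_def zero_long_ray_def Abs_long_ray_inverse le_less)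
qed

lemma long_ray_zero_less_one [simp]: "0 < (1 :: long_ray)"
  using omega1_zero_less_one
  by (auto simp del: omega1_zero_less_one simp: less_long_ray_def less_eq_long_ray_def zero_long_ray_def one_long_ray_def
      Abs_long_ray_inverse not_less)


section \<open>The long line\<close>

text \<open>A point \<open>Inr x\<close> stands for \<open>x \<in> R\<close> and \<open>Inl x\<close> for \<open>-x \<in> R\<^sup>-\<close>.  Identifying \<open>-0\<close> with \<open>0\<close>
  amounts to dropping \<open>Inl 0\<close>.\<close>

typedef long_line = "range Inr \<union> Inl ` (- {0}) :: (long_ray + long_ray) set"
  by blast

definition pos_ray :: "long_ray \<Rightarrow> long_line" where
  "pos_ray x = Abs_long_line (Inr x)"

definition neg_ray :: "long_ray \<Rightarrow> long_line" where
  "neg_ray x = (if x = 0 then pos_ray 0 else Abs_long_line (Inl x))"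

fun signed_le :: "long_ray + long_ray \<Rightarrow> long_ray + long_ray \<Rightarrow> bool" where
  "signed_le (Inl x) (Inl y) \<longleftrightarrow> y \<le> x"
| "signed_le (Inl x) (Inr y) \<longleftrightarrow> True"
| "signed_le (Inr x) (Inl y) \<longleftrightarrow> False"
| "signed_le (Inr x) (Inr y) \<longleftrightarrow> x \<le> y"

instantiation long_line :: linorder
begin

definition less_eq_long_line :: "long_line \<Rightarrow> long_line \<Rightarrow> bool" where
  "(x::long_line) \<le> y \<longleftrightarrow> signed_le (Rep_long_line x) (Rep_long_line y)"

definition less_long_line :: "long_line \<Rightarrow> long_line \<Rightarrow> bool" where
  "(x::long_line) < y \<longleftrightarrow> x \<le> y \<and> \<not> y \<le> x"

instance
proof
  fix x y z :: long_line
  show "x < y \<longleftrightarrow> x \<le> y \<and> \<not> y \<le> x" by (rule less_long_line_def)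
  show "x \<le> x"
    unfolding less_eq_long_line_def by (cases "Rep_long_line x") auto
  show "x \<le> y \<Longrightarrow> y \<le> z \<Longrightarrow> x \<le> z"
    unfolding less_eq_long_line_def
    by (cases "Rep_long_line x"; cases "Rep_long_line y"; cases "Rep_long_line z") auto
  show "x \<le> y \<Longrightarrow> y \<le> x \<Longrightarrow> x = y"
    unfolding less_eq_long_line_def Rep_long_line_inject[symmetric]
    by (cases "Rep_long_line x"; cases "Rep_long_line y") auto
  show "x \<le> y \<or> y \<le> x"
    unfolding less_eq_long_line_def
    by (cases "Rep_long_line x"; cases "Rep_long_line y") auto
qed

end

instantiation long_line :: linorder_topology
begin

definition open_long_line :: "long_line set \<Rightarrow> bool" where
  "open_long_line = generate_topology (range lessThan \<union> range greaterThan)"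

instance
  by standard (rule open_long_line_def)

end

instantiation long_line :: "{zero, one, uminus}"
begin
definition zero_long_line :: long_line where "(0::long_line) = pos_ray 0"
definition one_long_line :: long_line where "(1::long_line) = pos_ray 1"
definition uminus_long_line :: "long_line \<Rightarrow> long_line" where
  "- (x::long_line) = (case Rep_long_line x of Inl r \<Rightarrow> pos_ray r | Inr r \<Rightarrow> neg_ray r)"
instance ..
end

lemma Rep_pos_ray: "Rep_long_line (pos_ray x) = Inr x"
  by (simp add: pos_ray_def Abs_long_line_inverse)

lemma Rep_neg_ray: "Rep_long_line (neg_ray x) = (if x = 0 then Inr 0 else Inl x)"
  by (simp add: neg_ray_def Rep_pos_ray Abs_long_line_inverse)

lemma neg_ray_0: "neg_ray 0 = pos_ray 0"
  by (simp add: neg_ray_def)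

lemma long_line_cases: obtains r where "x = pos_ray r" | r where "x = neg_ray r"
proof (cases "Rep_long_line x")
  case (Inl r)
  with Rep_long_line[of x] have "r \<noteq> 0" by auto
  with Inl have "x = neg_ray r" by (simp add: Rep_neg_ray flip: Rep_long_line_inject)
  then show ?thesis by (rule that)
next
  case (Inr r)
  then have "x = pos_ray r" by (simp add: Rep_pos_ray flip: Rep_long_line_inject)
  then show ?thesis by (rule that)
qed

lemma long_line_order:
  "pos_ray r \<le> pos_ray s \<longleftrightarrow> r \<le> s"
  "neg_ray r \<le> neg_ray s \<longleftrightarrow> s \<le> r"
  "neg_ray r \<le> pos_ray s"
  "pos_ray r \<le> neg_ray s \<longleftrightarrow> r = 0 \<and> s = 0"
  using long_ray_zero_le[of r] long_ray_zero_le[of s]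
  by (simp_all add: less_eq_long_line_def Rep_pos_ray Rep_neg_ray antisym_conv)

lemma long_line_uminus:
  "- pos_ray r = neg_ray r"
  "- neg_ray r = pos_ray r"
  by (simp_all add: uminus_long_line_def Rep_pos_ray Rep_neg_ray neg_ray_0)

text \<open>A closed subinterval may be unbounded on either side.\<close>

definition closed_subinterval :: "'a::linorder_topology set \<Rightarrow> bool" where
  "closed_subinterval I \<longleftrightarrow> closed I \<and> I \<noteq> {} \<and> (\<forall>x\<in>I. \<forall>y\<in>I. {x..y} \<subseteq> I)"

definition continuous_injective_image :: "'a topology \<Rightarrow> 'b topology \<Rightarrow> bool" where
  "continuous_injective_image X Y \<longleftrightarrow>
     (\<exists>f. continuous_map X Y f \<and> inj_on f (topspace X) \<and> f ` topspace X = topspace Y)"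


section \<open>Compactifications\<close>

abbreviation alpha_long_ray :: "long_ray option topology" where
  "alpha_long_ray \<equiv> Alexandroff_compactification euclidean"

instantiation extended :: (linorder) linorder_topology
begin

definition open_extended :: "'a extended set \<Rightarrow> bool" where
  "open_extended = generate_topology (range lessThan \<union> range greaterThan)"

instance
  by standard (rule open_extended_def)

end

text \<open>The two-point compactification of the long line is its order completion by the end points
  \<^term>\<open>Minf\<close> and \<^term>\<open>Pinf\<close>.\<close>

abbreviation gamma_long_line :: "long_line extended topology" where
  "gamma_long_line \<equiv> euclidean"


section \<open>Identification spaces\<close>

definition quotient_topology :: "'a topology \<Rightarrow> 'a rel \<Rightarrow> 'a set topology" where
  "quotient_topology X r = topology (\<lambda>\<U>. \<U> \<subseteq> topspace X // r \<and> openin X (\<Union>\<U>))"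

lemma openin_quotient_topology:
  assumes "equiv (topspace X) r"
  shows "openin (quotient_topology X r) \<U> \<longleftrightarrow> \<U> \<subseteq> topspace X // r \<and> openin X (\<Union>\<U>)"
proof -
  have "\<Union>(\<U> \<inter> \<V>) = \<Union>\<U> \<inter> \<Union>\<V>"
    if "\<U> \<subseteq> topspace X // r" "\<V> \<subseteq> topspace X // r" for \<U> \<V>
    using that quotient_disj[OF assms] by blast
  moreover have "openin X (\<Union>(\<Union>\<K>))" if "\<forall>\<U>\<in>\<K>. openin X (\<Union>\<U>)" for \<K>
  proof -
    have "\<Union>(\<Union>\<K>) = \<Union>(Union ` \<K>)" by blast
    then show ?thesis using that by (auto intro: openin_Union)
  qed
  ultimately have "istopology (\<lambda>\<U>. \<U> \<subseteq> topspace X // r \<and> openin X (\<Union>\<U>))"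
    unfolding istopology_def by (auto simp: le_infI1)
  then show ?thesis by (simp add: quotient_topology_def)
qed

lemma topspace_quotient_topology:
  assumes "equiv (topspace X) r"
  shows "topspace (quotient_topology X r) = topspace X // r"
proof
  show "topspace (quotient_topology X r) \<subseteq> topspace X // r"
    using openin_quotient_topology[OF assms] openin_topspace by blast
  have "openin (quotient_topology X r) (topspace X // r)"
    by (simp add: openin_quotient_topology[OF assms] Union_quotient[OF assms])
  then show "topspace X // r \<subseteq> topspace (quotient_topology X r)"
    by (rule openin_subset)
qed

lemma quotient_map_quotient_topology:
  assumes "equiv (topspace X) r"
  shows "quotient_map X (quotient_topology X r) (\<lambda>x. r `` {x})"
proof -
  have "{x \<in> topspace X. r `` {x} \<in> \<U>} = \<Union>\<U>" if "\<U> \<subseteq> topspace X // r" for \<U>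
  proof -
    have "x \<in> topspace X \<and> r `` {x} \<in> \<U> \<longleftrightarrow> x \<in> \<Union>\<U>" for x
    proof
      assume "x \<in> topspace X \<and> r `` {x} \<in> \<U>"
      then show "x \<in> \<Union>\<U>" using equiv_class_self[OF assms] by blast
    next
      assume "x \<in> \<Union>\<U>"
      then obtain A where "A \<in> \<U>" "x \<in> A" by blast
      moreover from this that obtain y where "y \<in> topspace X" "A = r `` {y}"
        by (meson quotientE subsetD)
      moreover from \<open>x \<in> A\<close> \<open>A = r `` {y}\<close> have yx: "(y, x) \<in> r" by simp
      ultimately show "x \<in> topspace X \<and> r `` {x} \<in> \<U>"
        using equiv_class_eq[OF assms yx] equiv_type[OF assms] by auto
    qed
    then show ?thesis by blast
  qed
  moreover have "(\<lambda>x. r `` {x}) ` topspace X = topspace X // r"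
    by (auto simp: quotient_def)
  ultimately show ?thesis
    unfolding quotient_map_def
    by (simp add: topspace_quotient_topology[OF assms] openin_quotient_topology[OF assms])
qed

definition identification_rel :: "'a set \<Rightarrow> 'a rel \<Rightarrow> 'a rel" where
  "identification_rel A E = {(x, y). x \<in> A \<and> y \<in> A \<and> (x, y) \<in> (E \<union> E\<inverse>)\<^sup>*}"

lemma equiv_identification_rel: "equiv A (identification_rel A E)"
proof (rule equivI)
  have "sym ((E \<union> E\<inverse>)\<^sup>*)"
    by (rule sym_rtrancl) (rule sym_Un_converse)
  then show "sym (identification_rel A E)"
    by (auto simp: sym_def identification_rel_def)
  show "trans (identification_rel A E)"
    unfolding identification_rel_def by (rule transI) (auto intro: rtrancl_trans)
qed (auto simp: identification_rel_def refl_on_def)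

definition identify :: "'a topology \<Rightarrow> 'a rel \<Rightarrow> 'a set topology" where
  "identify X E = quotient_topology X (identification_rel (topspace X) E)"

definition long_circle :: "long_ray option set topology" where
  "long_circle = identify alpha_long_ray {(None, Some 0)}"

definition long_lollipop :: "long_ray \<Rightarrow> long_ray option set topology" where
  "long_lollipop p = identify alpha_long_ray {(None, Some p)}"

definition long_dumbbell :: "long_line extended set topology" where
  "long_dumbbell = identify gamma_long_line {(Minf, Fin (- 1)), (Pinf, Fin 1)}"

definition long_figure_eight :: "long_line extended set topology" where
  "long_figure_eight = identify gamma_long_line {(Minf, Fin 0), (Pinf, Fin 0)}"

definition long_theta_curve :: "long_line extended set topology" where
  "long_theta_curve = identify gamma_long_line {(Minf, Fin 1), (Pinf, Fin (- 1))}"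

end

theory Submission
  imports Defs
begin

text \<open>Fix \<open>a \<noteq> b\<close> in an \<open>\<aleph>\<^sub>0\<close>-ac continuum \<open>K\<close> and orient every arc through both points so
  that \<open>a\<close> precedes \<open>b\<close>. Arcs are separable and closed, so any two of them lie in a third, and
  an inclusion of oriented arcs is increasing; hence the orders of the arcs fit together to a
  linear order of \<open>K\<close> in which every interval is an arc and every countable set lies in an
  interval. If \<open>K\<close> is not separable, this order lacks a least or a greatest element. On an
  unbounded side a continuous strictly increasing \<open>\<omega>\<^sub>1\<close>-sequence is cofinal, because an arc
  contains no such sequence, so this side is a copy of the long ray. Thus \<open>K\<close> is a continuous
  injective image of the long ray or of the long line.

  Conversely, a continuous map \<open>f\<close> from the long ray to a compact Hausdorff space converges at
  infinity, as two closed unbounded sets always meet. If \<open>f\<close> is a bijection, its limit is \<open>f p\<close>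
  for some \<open>p\<close>, and the space is the compactification of the ray with the point at infinity
  glued to \<open>p\<close>; the long line is similar, and an order automorphism moves the two gluing
  points to the standard position.\<close>

section \<open>Order embeddings and continuity\<close>

text \<open>The order on \<open>K\<close> controls its topology only on intervals: an unbounded end
  must accumulate somewhere in the compact \<open>K\<close>, so the bijection from the ray or the
  line is continuous but never a homeomorphism. Continuity is therefore checked locally, inside a
  subarc, and the global topology is recovered only from the limits at the ends. Two facts keep the
  order arguments free of topology: an order embedding with convex image is continuous, and every
  initial segment of the ray is order isomorphic to a real interval. The class
  \<open>long_order\<close> collects what ray and line have in common. For uncountable \<kappa>, the
  obstruction is again separability: an arc in a long image is the closure of a countable set and
  hence lies in the image of a bounded interval, so it cannot contain the image of an unbounded set
  of size at most aleph_1. Likewise a bounded subinterval has a separable image, which leaves only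
  half-lines and the whole line in (ii) when \<open>K\<close> is not separable.\<close>

text \<open>It suffices to pull back open rays. If \<open>b\<close> is a value, its ray pulls back
  to a ray of \<open>A\<close> cut at the preimage of \<open>b\<close>; if it is not, convexity puts
  the whole image on one side of \<open>b\<close>, so the pullback is everything or nothing.\<close>

lemma continuous_on_order_embedding_or_reversing:
  fixes f :: "'a::linorder_topology \<Rightarrow> 'b::linorder_topology"
  assumes lt: "(\<forall>x\<in>A. \<forall>y\<in>A. f x < f y \<longleftrightarrow> x < y) \<or> (\<forall>x\<in>A. \<forall>y\<in>A. f x < f y \<longleftrightarrow> y < x)"
    and conv: "\<And>x y. x \<in> A \<Longrightarrow> y \<in> A \<Longrightarrow> {f x..f y} \<subseteq> f ` A"
  shows "continuous_on A f"
proof (rule continuous_on_generate_topology[OF open_generated_order], safe)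
  fix b :: 'b
  have out: "(\<forall>x\<in>A. f x < b) \<or> (\<forall>x\<in>A. b < f x)" if "b \<notin> f ` A"
  proof (rule ccontr)
    assume "\<not> ?thesis"
    then obtain x y where "x \<in> A" "y \<in> A" "b \<le> f x" "f y \<le> b" by (auto simp: not_less)
    then have "b \<in> {f y..f x}" by simp
    then show False using conv[OF \<open>y \<in> A\<close> \<open>x \<in> A\<close>] that by blast
  qed
  have halves: "(\<exists>C. open C \<and> C \<inter> A = {x \<in> A. f x < b}) \<and> (\<exists>C. open C \<and> C \<inter> A = {x \<in> A. b < f x})"
  proof (cases "b \<in> f ` A")
    case True
    then obtain c where c: "c \<in> A" "b = f c" by blast
    from lt show ?thesis
    proof
      assume *: "\<forall>x\<in>A. \<forall>y\<in>A. f x < f y \<longleftrightarrow> x < y"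
      have "f x < b \<longleftrightarrow> x < c" "b < f x \<longleftrightarrow> c < x" if "x \<in> A" for x
        unfolding c(2) using * c(1) that by blast+
      then have "{..<c} \<inter> A = {x \<in> A. f x < b}" "{c<..} \<inter> A = {x \<in> A. b < f x}" by auto
      then show ?thesis by (intro conjI exI[of _ "{..<c}"] exI[of _ "{c<..}"]) simp_all
    next
      assume *: "\<forall>x\<in>A. \<forall>y\<in>A. f x < f y \<longleftrightarrow> y < x"
      have "f x < b \<longleftrightarrow> c < x" "b < f x \<longleftrightarrow> x < c" if "x \<in> A" for x
        unfolding c(2) using * c(1) that by blast+
      then have "{c<..} \<inter> A = {x \<in> A. f x < b}" "{..<c} \<inter> A = {x \<in> A. b < f x}" by auto
      then show ?thesis by (intro conjI exI[of _ "{c<..}"] exI[of _ "{..<c}"]) simp_all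
    qed
  next
    case False
    from out[OF this] show ?thesis
    proof
      assume "\<forall>x\<in>A. f x < b"
      then have "UNIV \<inter> A = {x \<in> A. f x < b}" "{} \<inter> A = {x \<in> A. b < f x}" by (auto dest: less_asym)
      then show ?thesis by (intro conjI exI[of _ UNIV] exI[of _ "{}"]) simp_all
    next
      assume "\<forall>x\<in>A. b < f x"
      then have "{} \<inter> A = {x \<in> A. f x < b}" "UNIV \<inter> A = {x \<in> A. b < f x}" by (auto dest: less_asym)
      then show ?thesis by (intro conjI exI[of _ "{}"] exI[of _ UNIV]) simp_all
    qed
  qed
  have "f -` {..<b} \<inter> A = {x \<in> A. f x < b}" "f -` {b<..} \<inter> A = {x \<in> A. b < f x}" by auto
  with halves show "\<exists>C. open C \<and> C \<inter> A = f -` {..<b} \<inter> A" "\<exists>C. open C \<and> C \<inter> A = f -` {b<..} \<inter> A"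
    by simp_all
qed

lemma continuous_on_order_reversing:
  fixes f :: "'a::linorder_topology \<Rightarrow> 'b::linorder_topology"
  assumes ord: "\<And>x y. x \<in> A \<Longrightarrow> y \<in> A \<Longrightarrow> f x \<le> f y \<longleftrightarrow> y \<le> x"
    and conv: "\<And>x y. x \<in> A \<Longrightarrow> y \<in> A \<Longrightarrow> {f x..f y} \<subseteq> f ` A"
  shows "continuous_on A f"
proof (rule continuous_on_order_embedding_or_reversing[OF disjI2 conv])
  show "\<forall>x\<in>A. \<forall>y\<in>A. f x < f y \<longleftrightarrow> y < x"
  proof (intro ballI)
    fix x y assume "x \<in> A" "y \<in> A"
    then show "f x < f y \<longleftrightarrow> y < x" using ord[of y x] unfolding not_le[symmetric] by blast
  qed
qed

lemma continuous_on_order_embedding: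
  fixes f :: "'a::linorder_topology \<Rightarrow> 'b::linorder_topology"
  assumes ord: "\<And>x y. x \<in> A \<Longrightarrow> y \<in> A \<Longrightarrow> f x \<le> f y \<longleftrightarrow> x \<le> y"
    and conv: "\<And>x y. x \<in> A \<Longrightarrow> y \<in> A \<Longrightarrow> {f x..f y} \<subseteq> f ` A"
  shows "continuous_on A f"
proof (rule continuous_on_order_embedding_or_reversing[OF disjI1 conv])
  show "\<forall>x\<in>A. \<forall>y\<in>A. f x < f y \<longleftrightarrow> x < y"
  proof (intro ballI)
    fix x y assume "x \<in> A" "y \<in> A"
    then show "f x < f y \<longleftrightarrow> x < y" using ord[of y x] unfolding not_le[symmetric] by blast
  qed
qed

section \<open>Initial segments of the long ray\<close>

text \<open>A cardinal order is an initial ordinal, so its proper initial segments have smaller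
  cardinality, and smaller than the successor of aleph_0 means countable.\<close>

lemma countable_atMost_omega1: "countable {..x :: omega1}"
proof -
  let ?r = "cardSuc natLeq"
  have "Card_order ?r" by (rule cardSuc_Card_order[OF natLeq_Card_order])
  then have "|underS ?r (Rep_omega1 x)| <o ?r"
    by (rule card_of_underS) (rule Rep_omega1)
  then have "|underS ?r (Rep_omega1 x)| \<le>o natLeq"
    by (simp add: cardSuc_ordLeq_ordLess[OF natLeq_Card_order card_of_Card_order])
  then have "countable (underS ?r (Rep_omega1 x))"
    by (simp add: countable_iff_ordLeq_natLeq)
  moreover have "Rep_omega1 ` {..<x} \<subseteq> underS ?r (Rep_omega1 x)"
    by (auto simp: underS_def less_omega1_def less_eq_omega1_def)
  ultimately have "countable (Rep_omega1 ` {..<x})"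
    by (rule countable_subset[rotated])
  then have "countable {..<x}"
    by (rule countable_image_inj_on) (simp add: inj_on_def Rep_omega1_inject)
  moreover have "{..x} = insert x {..<x}" by auto
  ultimately show ?thesis by simp
qed

text \<open>Otherwise \<omega>_1 would be a countable union of countable initial segments.\<close>

lemma countable_omega1_bounded:
  assumes "countable (S :: omega1 set)"
  obtains b where "\<And>s. s \<in> S \<Longrightarrow> s < b"
proof (rule ccontr)
  assume "\<not> thesis"
  then have "\<forall>b. \<exists>s\<in>S. b \<le> s" using that by (meson not_le)
  then have "UNIV = (\<Union>s\<in>S. {..s})" by auto
  moreover have "countable (\<Union>s\<in>S. {..s})"
    using assms countable_atMost_omega1 by blast
  ultimately show False using uncountable_omega1 by simp
qed

lemma lessThan_zero_omega1: "{..<0::omega1} = {}"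
  using leD[OF omega1_zero_le] by auto

lemma lessThan_one_omega1: "{..<1::omega1} = {0}"
proof -
  have "x = 0" if "x < 1" for x :: omega1
    using not_less_Least[OF that[unfolded one_omega1_def]] omega1_zero_le[of x] by (metis order_le_less)
  then show ?thesis by auto
qed

text \<open>Lexicographic coordinates. They are meaningful only for 0 \<le> t < 1, the range of the
  representing set, which is why these bounds accompany the facts about \<open>lr\<close>.\<close>

definition lr :: "omega1 \<Rightarrow> real \<Rightarrow> long_ray" where
  "lr \<alpha> t = Abs_long_ray (\<alpha>, t)"

lemma lr_cases: obtains \<alpha> t where "x = lr \<alpha> t" "0 \<le> t" "t < 1"
proof -
  have "Rep_long_ray x \<in> UNIV \<times> {0..<1}" by (rule Rep_long_ray)
  then show ?thesis
    using that[of "fst (Rep_long_ray x)" "snd (Rep_long_ray x)"]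
    by (auto simp: lr_def mem_Times_iff Rep_long_ray_inverse)
qed

lemma Rep_lr: "0 \<le> t \<Longrightarrow> t < 1 \<Longrightarrow> Rep_long_ray (lr \<alpha> t) = (\<alpha>, t)"
  by (simp add: lr_def Abs_long_ray_inverse)

lemma lr_le_iff:
  "0 \<le> s \<Longrightarrow> s < 1 \<Longrightarrow> 0 \<le> t \<Longrightarrow> t < 1 \<Longrightarrow> lr \<alpha> s \<le> lr \<beta> t \<longleftrightarrow> \<alpha> < \<beta> \<or> \<alpha> = \<beta> \<and> s \<le> t"
  by (simp add: less_eq_long_ray_def Rep_lr)

lemma lr_less_iff:
  "0 \<le> s \<Longrightarrow> s < 1 \<Longrightarrow> 0 \<le> t \<Longrightarrow> t < 1 \<Longrightarrow> lr \<alpha> s < lr \<beta> t \<longleftrightarrow> \<alpha> < \<beta> \<or> \<alpha> = \<beta> \<and> s < t"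
  by (auto simp: not_le[symmetric] lr_le_iff)

lemma zero_long_ray_lr: "0 = lr 0 0" and one_long_ray_lr: "1 = lr 1 0"
  by (simp_all add: zero_long_ray_def one_long_ray_def lr_def)

lemma countable_long_ray_bounded:
  assumes "countable (S :: long_ray set)"
  obtains b where "\<And>s. s \<in> S \<Longrightarrow> s < b"
proof -
  have "countable ((\<lambda>x. fst (Rep_long_ray x)) ` S)" using assms by simp
  then obtain \<alpha> where \<alpha>: "\<And>s. s \<in> (\<lambda>x. fst (Rep_long_ray x)) ` S \<Longrightarrow> s < \<alpha>"
    using countable_omega1_bounded by blast
  have "s < lr \<alpha> 0" if "s \<in> S" for s
  proof (cases s rule: lr_cases)
    case (1 \<beta> t)
    then show ?thesis using \<alpha>[of \<beta>] that Rep_lr[of t \<beta>] by (force simp: lr_less_iff)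
  qed
  then show ?thesis by (rule that)
qed

text \<open>Giving the \<open>n\<close>-th ordinal in an enumeration of the countable set \<open>{..\<alpha>}\<close> the weight
  \<open>2\<^sup>-\<^sup>n\<close> turns the initial segment below \<open>\<alpha>\<close> into a bounded real interval: the point
  \<open>(\<beta>, t)\<close> is sent to the total weight of the ordinals below \<open>\<beta>\<close> plus \<open>t\<close> times the weight of \<open>\<beta>\<close>.\<close>

lemma long_ray_segment_real:
  fixes b :: long_ray
  obtains G :: "long_ray \<Rightarrow> real" where "G 0 = 0"
    "\<And>x y. x \<le> b \<Longrightarrow> y \<le> b \<Longrightarrow> G x \<le> G y \<longleftrightarrow> x \<le> y" "G ` {..b} = {0..G b}"
proof (cases b rule: lr_cases)
  case b: (1 \<alpha> t0)
  obtain e :: "omega1 \<Rightarrow> nat" where e: "inj_on e {..\<alpha>}"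
    using countable_atMost_omega1[of \<alpha>] unfolding countable_def by blast
  define w where "w \<beta> = (1/2::real) ^ e \<beta>" for \<beta>
  have w0: "w \<beta> > 0" for \<beta> by (simp add: w_def)
  have "(\<lambda>n. (1/2::real) ^ n) summable_on UNIV"
    by (rule norm_summable_imp_summable_on) (simp add: summable_geometric)
  then have "(\<lambda>n. (1/2::real) ^ n) summable_on e ` {..\<alpha>}"
    by (rule summable_on_subset_banach) simp
  then have "((\<lambda>n. (1/2::real) ^ n) \<circ> e) summable_on {..\<alpha>}"
    using summable_on_reindex[OF e] by blast
  then have sm\<alpha>: "w summable_on {..\<alpha>}" unfolding w_def o_def .
  have sm: "w summable_on A" if "A \<subseteq> {..\<alpha>}" for A
    using sm\<alpha> that by (rule summable_on_subset_banach)
  define L where "L \<beta> = infsum w {..<\<beta>}" for \<beta>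
  have step: "infsum w {..\<beta>} = L \<beta> + w \<beta>" if "\<beta> \<le> \<alpha>" for \<beta>
  proof -
    have "{..\<beta>} = insert \<beta> {..<\<beta>}" by auto
    moreover have "w summable_on {..<\<beta>}" using that by (intro sm) auto
    ultimately show ?thesis using infsum_insert[of w "{..<\<beta>}" \<beta>] by (simp add: L_def)
  qed
  have Lmono: "L \<beta> + w \<beta> \<le> L \<gamma>" if "\<beta> < \<gamma>" "\<gamma> \<le> \<alpha>" for \<beta> \<gamma>
  proof -
    have "infsum w {..\<beta>} \<le> infsum w {..<\<gamma>}"
      using that by (intro infsum_mono2 sm) (auto simp: less_imp_le w0)
    then show ?thesis using step[of \<beta>] that by (simp add: L_def)
  qed
  define G where "G x = L (fst (Rep_long_ray x)) + snd (Rep_long_ray x) * w (fst (Rep_long_ray x))" for x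
  have G: "G (lr \<beta> t) = L \<beta> + t * w \<beta>" if "0 \<le> t" "t < 1" for \<beta> t
    using that by (simp add: G_def Rep_lr)
  have L0: "L 0 = 0"
  proof -
    show ?thesis by (simp add: L_def lessThan_zero_omega1)
  qed
  have strict: "G x < G y" if "x < y" "y \<le> b" for x y
  proof -
    obtain \<beta> s \<gamma> t where x: "x = lr \<beta> s" "0 \<le> s" "s < 1" and y: "y = lr \<gamma> t" "0 \<le> t" "t < 1"
      using lr_cases by metis
    have "\<gamma> \<le> \<alpha>" using that(2) y b by (auto simp: lr_le_iff)
    have "\<beta> < \<gamma> \<or> \<beta> = \<gamma> \<and> s < t" using that(1) x y by (simp add: lr_less_iff)
    then show ?thesis
    proof
      assume "\<beta> < \<gamma>"
      have "s * w \<beta> < w \<beta>" using x w0[of \<beta>] by simp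
      also have "L \<beta> + w \<beta> \<le> L \<gamma>" by (rule Lmono) fact+
      also have "L \<gamma> \<le> L \<gamma> + t * w \<gamma>" using y w0[of \<gamma>] by simp
      finally show ?thesis using x y by (simp add: G)
    next
      assume "\<beta> = \<gamma> \<and> s < t"
      then show ?thesis using x y w0[of \<gamma>] by (simp add: G)
    qed
  qed
  have ord: "G x \<le> G y \<longleftrightarrow> x \<le> y" if "x \<le> b" "y \<le> b" for x y
    using strict[of x y] strict[of y x] that by (cases x y rule: linorder_cases) auto
  have G0: "G 0 = 0" by (simp add: zero_long_ray_lr G L0)
  have "y \<in> G ` {..b}" if y: "0 \<le> y" "y \<le> G b" for y
  proof -
    have Gb: "G b < L \<alpha> + w \<alpha>" using b w0[of \<alpha>] by (simp add: G)
    \<comment> \<open>The block that contains \<open>y\<close> is the first one ending beyond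
      \<open>y\<close>; the block of \<alpha> is a candidate because \<open>b\<close> lies in it. By
      minimality all earlier blocks end at or before \<open>y\<close>.\<close>
    define \<beta> where "\<beta> = (LEAST \<beta>. y < L \<beta> + w \<beta>)"
    have 1: "y < L \<beta> + w \<beta>" unfolding \<beta>_def by (rule LeastI[of _ \<alpha>]) (use Gb y in simp)
    have \<beta>\<alpha>: "\<beta> \<le> \<alpha>" unfolding \<beta>_def by (rule Least_le) (use Gb y in simp)
    have 2: "L \<gamma> + w \<gamma> \<le> y" if "\<gamma> < \<beta>" for \<gamma>
      using not_less_Least[OF that[unfolded \<beta>_def]] by simp
    \<comment> \<open>An infinite sum of positive weights is the supremum of its finite subsums, and
      a finite subset of \<open>{..<\<beta>}\<close> is contained in \<open>{..m}\<close> for its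
      maximum m < \<beta>. This treats limit and successor \<beta> alike.\<close>
    have "L \<beta> \<le> y" unfolding L_def
    proof (rule infsum_le_finite_sums)
      show "w summable_on {..<\<beta>}" using \<beta>\<alpha> by (intro sm) auto
      fix F assume F: "finite F" "F \<subseteq> {..<\<beta>}"
      show "sum w F \<le> y"
      proof (cases "F = {}")
        case False
        define m where "m = Max F"
        have m: "m < \<beta>" "m \<in> F" using F False Max_in[of F] by (auto simp: m_def)
        have "sum w F \<le> infsum w {..m}"
          using F m \<beta>\<alpha> by (intro finite_sum_le_infsum sm) (auto simp: m_def less_imp_le w0)
        also have "\<dots> \<le> y" using 2[OF m(1)] step[of m] m \<beta>\<alpha> by simp
        finally show ?thesis .
      qed (use y in simp)
    qed
    define t where "t = (y - L \<beta>) / w \<beta>"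
    have t: "0 \<le> t" "t < 1" using \<open>L \<beta> \<le> y\<close> 1 w0[of \<beta>] by (simp_all add: t_def field_simps)
    have Gy: "G (lr \<beta> t) = y" using t w0[of \<beta>] by (simp add: G) (simp add: t_def)
    \<comment> \<open>\<open>ord\<close> compares only points known to be at most \<open>b\<close>,
      so the values are compared directly: beyond \<open>b\<close>, but with \<beta> \<le> \<alpha>,
      the point would lie in the same block as \<open>b\<close> and further along it.\<close>
    moreover have "lr \<beta> t \<le> b"
    proof (rule ccontr)
      assume "\<not> ?thesis"
      then have "b < lr \<beta> t" by simp
      then have "\<beta> = \<alpha>" "t0 < t" using b t \<beta>\<alpha> by (auto simp: lr_less_iff)
      then have "G b < G (lr \<beta> t)" using b t w0[of \<alpha>] by (simp add: G)
      then show False using Gy y by simp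
    qed
    ultimately show ?thesis by blast
  qed
  moreover have "0 \<le> G x \<and> G x \<le> G b" if "x \<le> b" for x
    using ord[of x b] ord[of 0 x] that G0 by simp
  ultimately have "G ` {..b} = {0..G b}" by auto
  with G0 ord show ?thesis by (rule that)
qed

section \<open>Orders isomorphic to the long ray\<close>

text \<open>The characterisation of the long ray up to order isomorphism. A relation on a carrier
  set, instead of a class instance, lets the same theorem serve the arc order of a continuum, its
  reverse, and the half-lines of the long line in both directions.\<close>

locale ray_order =
  fixes X :: "'a set" and le :: "'a \<Rightarrow> 'a \<Rightarrow> bool" (infix "\<sqsubseteq>" 50) and a :: 'a
  assumes a: "a \<in> X"
    and least: "x \<in> X \<Longrightarrow> a \<sqsubseteq> x"
    and total: "x \<in> X \<Longrightarrow> y \<in> X \<Longrightarrow> x \<sqsubseteq> y \<or> y \<sqsubseteq> x"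
    and antisym: "x \<in> X \<Longrightarrow> y \<in> X \<Longrightarrow> x \<sqsubseteq> y \<Longrightarrow> y \<sqsubseteq> x \<Longrightarrow> x = y"
    and trans: "x \<in> X \<Longrightarrow> y \<in> X \<Longrightarrow> z \<in> X \<Longrightarrow> x \<sqsubseteq> y \<Longrightarrow> y \<sqsubseteq> z \<Longrightarrow> x \<sqsubseteq> z"
    and bounded: "S \<subseteq> X \<Longrightarrow> countable S \<Longrightarrow> \<exists>b\<in>X. \<forall>s\<in>S. s \<sqsubseteq> b \<and> s \<noteq> b"
    and segment: "b \<in> X \<Longrightarrow> b \<noteq> a \<Longrightarrow>
      \<exists>\<phi>::real \<Rightarrow> 'a. \<phi> 0 = a \<and> \<phi> ` {0..1} = {z \<in> X. z \<sqsubseteq> b} \<and>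
        (\<forall>s\<in>{0..1}. \<forall>t\<in>{0..1}. \<phi> s \<sqsubseteq> \<phi> t \<longleftrightarrow> s \<le> t)"
begin

lemma chart:
  assumes "S \<subseteq> X" "countable S"
  shows "\<exists>b\<in>X. \<exists>\<phi>::real \<Rightarrow> 'a. S \<subseteq> \<phi> ` {0..1} \<and> \<phi> 0 = a \<and> \<phi> ` {0..1} = {z \<in> X. z \<sqsubseteq> b} \<and>
    (\<forall>s\<in>{0..1}. \<forall>t\<in>{0..1}. \<phi> s \<sqsubseteq> \<phi> t \<longleftrightarrow> s \<le> t)"
proof -
  \<comment> \<open>Inserting \<open>a\<close> forces b \<noteq> a, the proviso of
    \<open>segment\<close>.\<close>
  obtain b where b: "b \<in> X" "\<forall>s\<in>insert a S. s \<sqsubseteq> b \<and> s \<noteq> b"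
    using bounded[of "insert a S"] assms a by auto
  then have "b \<noteq> a" by blast
  from segment[OF b(1) this] obtain \<phi> :: "real \<Rightarrow> 'a" where
    "\<phi> 0 = a \<and> \<phi> ` {0..1} = {z \<in> X. z \<sqsubseteq> b} \<and> (\<forall>s\<in>{0..1}. \<forall>t\<in>{0..1}. \<phi> s \<sqsubseteq> \<phi> t \<longleftrightarrow> s \<le> t)" ..
  then show ?thesis using b assms by (intro bexI[of _ b] exI[of _ \<phi>] conjI) auto
qed

lemma refl: "x \<in> X \<Longrightarrow> x \<sqsubseteq> x"
  using total by blast

text \<open>A countable set lies in one real chart, where suprema exist; a bound outside the chart
  lies above all of it. The equivalence is the universal property of the supremum.\<close>

lemma ex_lub:
  assumes "S \<subseteq> X" "countable S"
  shows "\<exists>u\<in>X. \<forall>v\<in>X. u \<sqsubseteq> v \<longleftrightarrow> (\<forall>s\<in>S. s \<sqsubseteq> v)"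
proof -
  obtain b and \<phi> :: "real \<Rightarrow> 'a" where \<phi>: "b \<in> X" "S \<subseteq> \<phi> ` {0..1}" "\<phi> 0 = a"
    "\<phi> ` {0..1} = {z \<in> X. z \<sqsubseteq> b}"
    and ord0: "\<forall>s\<in>{0..1}. \<forall>t\<in>{0..1}. \<phi> s \<sqsubseteq> \<phi> t \<longleftrightarrow> s \<le> t"
    using chart[OF assms] by blast
  have ord: "\<phi> s \<sqsubseteq> \<phi> t \<longleftrightarrow> s \<le> t" if "s \<in> {0..1}" "t \<in> {0..1}" for s t
    using ord0 that by blast
  \<comment> \<open>The 0 makes \<open>T\<close> nonempty, so that the supremum of the empty set is
    the least point \<open>a\<close>; it does not affect the other suprema.\<close>
  define T where "T = insert 0 {t \<in> {0..1}. \<phi> t \<in> S}"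
  have T: "T \<noteq> {}" "bdd_above T" "T \<subseteq> {0..1}" by (auto simp: T_def intro!: bdd_aboveI[of _ 1])
  have sup: "Sup T \<in> {0..1}"
    using T by (auto simp: T_def intro!: cSup_upper cSup_least)
  have inX: "\<phi> t \<in> X" if "t \<in> {0..1}" for t using \<phi>(4) that by blast
  have "\<phi> (Sup T) \<sqsubseteq> v \<longleftrightarrow> (\<forall>s\<in>S. s \<sqsubseteq> v)" if v: "v \<in> X" for v
  proof
    assume *: "\<phi> (Sup T) \<sqsubseteq> v"
    show "\<forall>s\<in>S. s \<sqsubseteq> v"
    proof
      fix s assume "s \<in> S"
      then obtain t where t: "t \<in> {0..1}" "s = \<phi> t" using \<phi>(2) by blast
      then have "t \<le> Sup T" using T \<open>s \<in> S\<close> by (intro cSup_upper) (auto simp: T_def)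
      then have "s \<sqsubseteq> \<phi> (Sup T)" using t sup ord by simp
      then show "s \<sqsubseteq> v" using * v inX sup t trans by metis
    qed
  next
    assume *: "\<forall>s\<in>S. s \<sqsubseteq> v"
    show "\<phi> (Sup T) \<sqsubseteq> v"
    proof (cases "v \<sqsubseteq> b")
      case True
      then obtain t where t: "t \<in> {0..1}" "v = \<phi> t" using v \<phi>(4) by blast
      have "Sup T \<le> t"
        using T * t ord by (intro cSup_least) (auto simp: T_def)
      then show ?thesis using t sup ord by simp
    next
      case False
      then have "b \<sqsubseteq> v" using total \<phi>(1) v by blast
      moreover have "\<phi> (Sup T) \<sqsubseteq> b" using sup \<phi>(4) by blast
      ultimately show ?thesis using trans inX sup \<phi>(1) v by metis
    qed
  qed
  then show ?thesis using inX sup by blast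
qed

text \<open>A bounded chain would lie in a single chart and yield a strictly increasing
  \<omega>_1-sequence of reals. Rationals picked from the gaps between consecutive terms would then
  embed \<omega>_1 into a countable set.\<close>

lemma no_bounded_omega1_chain:
  fixes x :: "omega1 \<Rightarrow> 'a"
  assumes "\<And>\<alpha>. x \<alpha> \<in> X" "\<And>\<alpha> \<beta>. \<alpha> < \<beta> \<Longrightarrow> x \<alpha> \<sqsubseteq> x \<beta> \<and> x \<alpha> \<noteq> x \<beta>" "y \<in> X"
  shows "\<exists>\<alpha>. \<not> x \<alpha> \<sqsubseteq> y"
proof (rule ccontr)
  assume "\<not> ?thesis"
  then have le: "x \<alpha> \<sqsubseteq> y" for \<alpha> by blast
  obtain b and \<phi> :: "real \<Rightarrow> 'a" where \<phi>: "b \<in> X" "{y} \<subseteq> \<phi> ` {0..1}" "\<phi> ` {0..1} = {z \<in> X. z \<sqsubseteq> b}"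
    and ord0: "\<forall>s\<in>{0..1}. \<forall>t\<in>{0..1}. \<phi> s \<sqsubseteq> \<phi> t \<longleftrightarrow> s \<le> t"
    using chart[of "{y}"] assms(3) by (simp only: countable_insert countable_empty insert_subset empty_subsetI simp_thms) blast
  have ord: "\<phi> s \<sqsubseteq> \<phi> t \<longleftrightarrow> s \<le> t" if "s \<in> {0..1}" "t \<in> {0..1}" for s t
    using ord0 that by blast
  have "x \<alpha> \<in> \<phi> ` {0..1}" for \<alpha>
    using \<phi> assms(1,3) le trans[OF assms(1) assms(3) \<phi>(1) le] by auto
  then have "\<forall>\<alpha>. \<exists>t. t \<in> {0..1} \<and> x \<alpha> = \<phi> t" by blast
  then obtain t where t: "\<And>\<alpha>. t \<alpha> \<in> {0..1}" "\<And>\<alpha>. x \<alpha> = \<phi> (t \<alpha>)" by metis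
  have mono: "t \<alpha> < t \<beta>" if "\<alpha> < \<beta>" for \<alpha> \<beta>
    using assms(2)[OF that] ord[OF t(1) t(1)] t(2) by (metis order_le_less)
  \<comment> \<open>The immediate successor, so that the gaps from \<open>t \<alpha>\<close> to
    \<open>t (nxt \<alpha>)\<close> are disjoint and the chosen rationals distinct.\<close>
  define nxt where "nxt \<alpha> = (LEAST \<beta>. \<alpha> < \<beta>)" for \<alpha> :: omega1
  have nxt: "\<alpha> < nxt \<alpha>" for \<alpha>
    unfolding nxt_def using countable_omega1_bounded[of "{\<alpha>}"] by (metis LeastI countable_empty countable_insert insertI1)
  have nxt_le: "nxt \<alpha> \<le> \<beta>" if "\<alpha> < \<beta>" for \<alpha> \<beta>
    unfolding nxt_def using that by (rule Least_le)
  have "\<forall>\<alpha>. \<exists>q::rat. t \<alpha> < of_rat q \<and> of_rat q < t (nxt \<alpha>)"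
    using mono[OF nxt] of_rat_dense by blast
  then obtain q :: "omega1 \<Rightarrow> rat" where q: "\<And>\<alpha>. t \<alpha> < of_rat (q \<alpha>)" "\<And>\<alpha>. of_rat (q \<alpha>) < t (nxt \<alpha>)"
    by metis
  have "q \<alpha> \<noteq> q \<beta>" if "\<alpha> < \<beta>" for \<alpha> \<beta>
  proof -
    have "t (nxt \<alpha>) \<le> t \<beta>" using nxt_le[OF that] mono by (metis order_le_less)
    then show ?thesis using q[of \<alpha>] q[of \<beta>] by auto
  qed
  then have "inj q" by (metis injI linorder_neq_iff)
  then have "countable (UNIV :: omega1 set)" by (metis countableI_type countable_image_inj_on)
  then show False using uncountable_omega1 by simp
qed

text \<open>Supplies the copies of [0, 1) that become the blocks of the long ray: a chart through
  both points, restricted to a half-open parameter interval and rescaled affinely.\<close>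

lemma half_open_chart:
  assumes "x \<in> X" "y \<in> X" "x \<sqsubseteq> y" "x \<noteq> y"
  shows "\<exists>\<psi>::real \<Rightarrow> 'a. \<psi> 0 = x \<and> \<psi> ` {0..<1} = {z \<in> X. x \<sqsubseteq> z \<and> z \<sqsubseteq> y \<and> z \<noteq> y} \<and>
    (\<forall>s\<in>{0..<1}. \<forall>t\<in>{0..<1}. \<psi> s \<sqsubseteq> \<psi> t \<longleftrightarrow> s \<le> t)"
proof -
  obtain b and \<phi> :: "real \<Rightarrow> 'a" where \<phi>: "b \<in> X" "{x, y} \<subseteq> \<phi> ` {0..1}" "\<phi> ` {0..1} = {z \<in> X. z \<sqsubseteq> b}"
    and ord0: "\<forall>s\<in>{0..1}. \<forall>t\<in>{0..1}. \<phi> s \<sqsubseteq> \<phi> t \<longleftrightarrow> s \<le> t"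
    using chart[of "{x, y}"] assms(1,2) by (simp only: countable_insert countable_empty insert_subset empty_subsetI simp_thms) blast
  have ord: "\<phi> s \<sqsubseteq> \<phi> t \<longleftrightarrow> s \<le> t" if "s \<in> {0..1}" "t \<in> {0..1}" for s t
    using ord0 that by blast
  from \<phi>(2) obtain u where u: "u \<in> {0..1}" "x = \<phi> u" by blast
  from \<phi>(2) obtain v where v: "v \<in> {0..1}" "y = \<phi> v" by blast
  note uv = u(1) v(1) u(2) v(2)
  have "u < v" using ord[OF v(1) u(1)] antisym[OF assms(1,2,3)] assms(4) uv(3,4) by (metis not_le)
  have eq: "\<phi> s = \<phi> t \<longleftrightarrow> s = t" if "s \<in> {0..1}" "t \<in> {0..1}" for s t
    using ord[of s t] ord[of t s] ord[of s s] that by (metis order_antisym order_refl)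
  define \<psi> where "\<psi> t = \<phi> (u + t * (v - u))" for t
  have aff: "(\<lambda>t. u + t * (v - u)) ` {0..<1} = {u..<v}"
  proof safe
    fix t :: real assume t: "t \<in> {0..<1}"
    define d where "d = v - u"
    have "t * d < 1 * d" using t \<open>u < v\<close> unfolding d_def by (intro mult_strict_right_mono) auto
    moreover have "0 \<le> t * d" using t \<open>u < v\<close> by (simp add: d_def)
    ultimately have "u \<le> u + t * d" "u + t * d < u + d" by simp_all
    then show "u + t * (v - u) \<in> {u..<v}" by (simp add: d_def)
  next
    fix w assume "w \<in> {u..<v}"
    then show "w \<in> (\<lambda>t. u + t * (v - u)) ` {0..<1}"
      using \<open>u < v\<close> by (intro image_eqI[of _ _ "(w - u) / (v - u)"]) (auto simp: field_simps)
  qed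
  have "\<psi> ` {0..<1} = \<phi> ` {u..<v}"
    unfolding \<psi>_def aff[symmetric] by (simp add: image_image)
  also have "\<dots> = {z \<in> X. x \<sqsubseteq> z \<and> z \<sqsubseteq> y \<and> z \<noteq> y}" (is "_ = ?R")
  proof (intro equalityI subsetI)
    fix z assume "z \<in> \<phi> ` {u..<v}"
    then obtain t where t: "t \<in> {u..<v}" "z = \<phi> t" by blast
    then have "t \<in> {0..1}" "u \<le> t" "t \<le> v" "t \<noteq> v" using uv by auto
    moreover from this(1) have "\<phi> t \<in> X" using \<phi>(3) by blast
    ultimately show "z \<in> ?R" using uv ord eq t(2) by simp
  next
    fix z assume "z \<in> ?R"
    then have z: "z \<in> X" "x \<sqsubseteq> z" "z \<sqsubseteq> y" "z \<noteq> y" by simp_all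
    have "y \<sqsubseteq> b" using \<phi> by auto
    then have "z \<sqsubseteq> b" using trans[of z y b] z assms \<phi>(1) by blast
    then obtain t where t: "t \<in> {0..1}" "z = \<phi> t" using \<phi>(3) z by blast
    then show "z \<in> \<phi> ` {u..<v}" using z uv ord by (intro image_eqI[of _ _ t]) (auto simp: order_le_less)
  qed
  finally have "\<psi> ` {0..<1} = ?R" .
  moreover have "\<psi> s \<sqsubseteq> \<psi> t \<longleftrightarrow> s \<le> t" if "s \<in> {0..<1}" "t \<in> {0..<1}" for s t
  proof -
    have "u + s * (v - u) \<in> {u..<v}" "u + t * (v - u) \<in> {u..<v}" using that aff by blast+
    then have "\<psi> s \<sqsubseteq> \<psi> t \<longleftrightarrow> u + s * (v - u) \<le> u + t * (v - u)"
      unfolding \<psi>_def using uv by (intro ord) auto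
    also have "\<dots> \<longleftrightarrow> s \<le> t" using \<open>u < v\<close> by simp
    finally show ?thesis .
  qed
  ultimately show ?thesis using uv by (intro exI[of _ \<psi>]) (simp add: \<psi>_def)
qed

text \<open>A continuous cofinal \<open>\<omega>\<^sub>1\<close>-sequence \<open>x\<close> cuts \<open>X\<close> into copies of \<open>[0, 1)\<close>; it is cofinal because an
  initial segment of \<open>X\<close>, being a real interval, contains no increasing \<open>\<omega>\<^sub>1\<close>-sequence.\<close>

theorem long_ray_iso:
  assumes c: "c \<in> X" "c \<noteq> a"
  obtains f :: "long_ray \<Rightarrow> 'a" where "range f = X" "\<And>r s. f r \<sqsubseteq> f s \<longleftrightarrow> r \<le> s" "f 0 = a" "f 1 = c"
proof -
  \<comment> \<open>Any strictly larger element would do as a next division point; the choice at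
    \<open>a\<close> is fixed in order to obtain \<open>f 1 = c\<close>.\<close>
  define sc where "sc y = (if y = a then c else SOME z. z \<in> X \<and> y \<sqsubseteq> z \<and> y \<noteq> z)" for y
  have sc: "sc y \<in> X \<and> y \<sqsubseteq> sc y \<and> y \<noteq> sc y" if "y \<in> X" for y
  proof (cases "y = a")
    case True
    then show ?thesis using c least by (auto simp: sc_def)
  next
    case False
    have "\<exists>z. z \<in> X \<and> y \<sqsubseteq> z \<and> y \<noteq> z" using bounded[of "{y}"] that by auto
    then show ?thesis using someI_ex[of "\<lambda>z. z \<in> X \<and> y \<sqsubseteq> z \<and> y \<noteq> z"] False by (simp add: sc_def)
  qed
  define is_lub where "is_lub S u \<longleftrightarrow> u \<in> X \<and> (\<forall>v\<in>X. u \<sqsubseteq> v \<longleftrightarrow> (\<forall>s\<in>S. s \<sqsubseteq> v))" for S u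
  define lub where "lub S = (SOME u. is_lub S u)" for S
  have lub: "is_lub S (lub S)" if "S \<subseteq> X" "countable S" for S
    unfolding lub_def using ex_lub[OF that] by (intro someI_ex[of "is_lub S"]) (auto simp: is_lub_def)
  have lt_countable: "countable {..<\<alpha>}" for \<alpha> :: omega1
    by (rule countable_subset[OF _ countable_atMost_omega1[of \<alpha>]]) auto
  \<comment> \<open>One clause covers zero, successors and limits: the supremum of nothing is
    \<open>a\<close>, at a successor the last \<open>sc\<close> value dominates, and at a limit the
    supremum makes the sequence continuous.\<close>
  define x where "x = wfrec {(\<alpha>, \<beta> :: omega1). \<alpha> < \<beta>} (\<lambda>g \<alpha>. lub (sc ` g ` {..<\<alpha>}))"
  have x: "x \<alpha> = lub (sc ` x ` {..<\<alpha>})" for \<alpha>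
  proof -
    have "x \<alpha> = lub (sc ` cut x {(\<alpha>, \<beta>). \<alpha> < \<beta>} \<alpha> ` {..<\<alpha>})"
      unfolding x_def by (subst wfrec[OF wellorder_class.wf]) simp
    also have "cut x {(\<alpha>, \<beta>). \<alpha> < \<beta>} \<alpha> ` {..<\<alpha>} = x ` {..<\<alpha>}"
      by (intro image_cong) (auto simp: cut_apply)
    finally show ?thesis .
  qed
  have xX: "x \<alpha> \<in> X" for \<alpha>
  proof (induction \<alpha> rule: less_induct)
    case (less \<alpha>)
    then have "is_lub (sc ` x ` {..<\<alpha>}) (x \<alpha>)"
      unfolding x[of \<alpha>] using sc lt_countable by (intro lub) auto
    then show ?case by (simp add: is_lub_def)
  qed
  have lubx: "is_lub (sc ` x ` {..<\<alpha>}) (x \<alpha>)" for \<alpha>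
    unfolding x[of \<alpha>] using sc lt_countable xX by (intro lub) auto
  have scle: "sc (x \<beta>) \<sqsubseteq> x \<alpha>" if "\<beta> < \<alpha>" for \<alpha> \<beta>
  proof -
    have "x \<alpha> \<sqsubseteq> x \<alpha>" using refl xX by blast
    then show ?thesis using lubx[of \<alpha>] xX that by (auto simp: is_lub_def)
  qed
  have xlt: "x \<beta> \<sqsubseteq> x \<alpha> \<and> x \<beta> \<noteq> x \<alpha>" if "\<beta> < \<alpha>" for \<alpha> \<beta>
    using scle[OF that] sc[OF xX[of \<beta>]] xX[of \<alpha>] xX[of \<beta>] trans antisym by metis
  have x0: "x 0 = a"
  proof -
    have "x 0 \<sqsubseteq> a" using lubx[of 0] a by (simp add: is_lub_def lessThan_zero_omega1)
    then show ?thesis using least[OF xX] antisym[OF xX a] by blast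
  qed
  have x1: "x 1 = c"
  proof -
    have "is_lub {c} (x 1)" using lubx[of 1] x0 by (simp add: sc_def lessThan_one_omega1)
    then have "x 1 \<sqsubseteq> c" "c \<sqsubseteq> x 1" using c xX refl by (auto simp: is_lub_def)
    then show ?thesis using antisym[OF xX c(1)] by blast
  qed
  define block where "block \<alpha> = {z \<in> X. x \<alpha> \<sqsubseteq> z \<and> z \<sqsubseteq> sc (x \<alpha>) \<and> z \<noteq> sc (x \<alpha>)}" for \<alpha>
  define chart_at where "chart_at \<alpha> \<psi> \<longleftrightarrow> \<psi> 0 = x \<alpha> \<and> \<psi> ` {0..<1} = block \<alpha> \<and>
    (\<forall>s\<in>{0..<1}. \<forall>t\<in>{0..<1}. \<psi> s \<sqsubseteq> \<psi> t \<longleftrightarrow> s \<le> t)" for \<alpha> and \<psi> :: "real \<Rightarrow> 'a"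
  have "\<exists>\<psi>. chart_at \<alpha> \<psi>" for \<alpha>
    unfolding chart_at_def block_def by (intro half_open_chart) (simp_all add: sc xX)
  then obtain \<psi> where "\<And>\<alpha>. chart_at \<alpha> (\<psi> \<alpha>)" by metis
  then have \<psi>: "\<psi> \<alpha> 0 = x \<alpha>" "\<psi> \<alpha> ` {0..<1} = block \<alpha>"
    and \<psi>_ord: "s\<in>{0..<1} \<Longrightarrow> t\<in>{0..<1} \<Longrightarrow> \<psi> \<alpha> s \<sqsubseteq> \<psi> \<alpha> t \<longleftrightarrow> s \<le> t" for \<alpha> s t
    by (simp_all only: chart_at_def)
  have cover: "\<exists>\<alpha>. z \<in> block \<alpha>" if z: "z \<in> X" for z
  proof -
    \<comment> \<open>At the first index whose term fails to be below \<open>z\<close>, the supremum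
      property yields an earlier \<beta> with \<open>sc (x \<beta>)\<close> not below
      \<open>z\<close>. Since \<open>x \<beta>\<close> is still below \<open>z\<close>, the block of
      \<beta> contains \<open>z\<close>.\<close>
    define \<gamma> where "\<gamma> = (LEAST \<alpha>. \<not> x \<alpha> \<sqsubseteq> z)"
    obtain \<alpha> where "\<not> x \<alpha> \<sqsubseteq> z" using no_bounded_omega1_chain[of x z, OF xX xlt z] by blast
    then have \<gamma>: "\<not> x \<gamma> \<sqsubseteq> z" unfolding \<gamma>_def by (rule LeastI)
    then obtain \<beta> where \<beta>: "\<beta> < \<gamma>" "\<not> sc (x \<beta>) \<sqsubseteq> z"
      using lubx[of \<gamma>] z by (auto simp: is_lub_def)
    have "x \<beta> \<sqsubseteq> z" using not_less_Least[OF \<beta>(1)[unfolded \<gamma>_def]] by blast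
    moreover have "z \<sqsubseteq> sc (x \<beta>)" "z \<noteq> sc (x \<beta>)" using \<beta>(2) total[of z "sc (x \<beta>)"] z sc[OF xX] refl by auto
    ultimately show ?thesis using z by (auto simp: block_def)
  qed
  define f where "f r = \<psi> (fst (Rep_long_ray r)) (snd (Rep_long_ray r))" for r
  have f: "f (lr \<alpha> t) = \<psi> \<alpha> t" if "0 \<le> t" "t < 1" for \<alpha> t using that by (simp add: f_def Rep_lr)
  have in_block: "\<psi> \<alpha> t \<in> block \<alpha>" if "0 \<le> t" "t < 1" for \<alpha> t
    using \<psi>(2)[of \<alpha>] that by auto
  have fX: "f r \<in> X" for r
    using in_block by (cases r rule: lr_cases) (auto simp: f block_def)
  have lt: "f r \<sqsubseteq> f s \<and> f r \<noteq> f s" if "r < s" for r s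
  proof -
    obtain \<alpha> u \<beta> v where r: "r = lr \<alpha> u" "0 \<le> u" "u < 1" and s: "s = lr \<beta> v" "0 \<le> v" "v < 1"
      using lr_cases by metis
    then have "\<alpha> < \<beta> \<or> \<alpha> = \<beta> \<and> u < v" using that by (simp add: lr_less_iff)
    then show ?thesis
    proof
      assume "\<alpha> < \<beta>"
      have 1: "f r \<in> block \<alpha>" "f s \<in> block \<beta>" using r s in_block by (auto simp: f)
      have S: "sc (x \<alpha>) \<in> X" using sc xX by blast
      have "f r \<sqsubseteq> x \<beta>"
        using trans[OF fX S xX, of r \<beta>] 1 scle[OF \<open>\<alpha> < \<beta>\<close>] by (auto simp: block_def)
      then have 2: "f r \<sqsubseteq> f s" using trans[OF fX xX fX, of r \<beta> s] 1 by (auto simp: block_def)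
      have "sc (x \<alpha>) \<sqsubseteq> f s"
        using trans[OF S xX fX, of \<beta> s] 1 scle[OF \<open>\<alpha> < \<beta>\<close>] by (auto simp: block_def)
      then have "f r \<noteq> f s" using antisym[OF fX S, of r] 1 by (auto simp: block_def)
      with 2 show ?thesis by blast
    next
      assume "\<alpha> = \<beta> \<and> u < v"
      then show ?thesis using \<psi>_ord[of u v \<alpha>] \<psi>_ord[of v u \<alpha>] r s by (auto simp: f)
    qed
  qed
  have "range f = X"
  proof safe
    fix z assume "z \<in> X"
    then obtain \<alpha> where "z \<in> \<psi> \<alpha> ` {0..<1}" using cover \<psi>(2) by blast
    then obtain t where "z = \<psi> \<alpha> t" "0 \<le> t" "t < 1" by auto
    then have "z = f (lr \<alpha> t)" by (simp add: f)
    then show "z \<in> range f" by blast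
  qed (rule fX)
  moreover have "f r \<sqsubseteq> f s \<longleftrightarrow> r \<le> s" for r s
    using lt[of r s] lt[of s r] refl[OF fX, of r] antisym[OF fX fX, of r s] by (cases r s rule: linorder_cases) auto
  moreover have "f 0 = a" "f 1 = c" by (simp_all add: zero_long_ray_lr one_long_ray_lr f \<psi>(1) x0 x1)
  ultimately show ?thesis by (rule that)
qed

end

section \<open>Charts of the long ray and the long line\<close>

text \<open>Only the order is mentioned; in an order topology continuity follows, because the image
  is convex.\<close>

definition order_chart :: "(real \<Rightarrow> 'a::linorder) \<Rightarrow> 'a \<Rightarrow> 'a \<Rightarrow> bool" where
  "order_chart \<phi> x y \<longleftrightarrow> \<phi> 0 = x \<and> \<phi> 1 = y \<and> \<phi> ` {0..1} = {x..y} \<and>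
    (\<forall>s\<in>{0..1}. \<forall>t\<in>{0..1}. \<phi> s \<le> \<phi> t \<longleftrightarrow> s \<le> t)"

lemma order_chartD:
  assumes "order_chart \<phi> x y"
  shows "\<phi> 0 = x" "\<phi> 1 = y" "\<phi> ` {0..1} = {x..y}"
    "s \<in> {0..1} \<Longrightarrow> t \<in> {0..1} \<Longrightarrow> \<phi> s \<le> \<phi> t \<longleftrightarrow> s \<le> t"
  using assms by (simp_all add: order_chart_def)

lemma inj_on_order_chart: "order_chart \<phi> x y \<Longrightarrow> inj_on \<phi> {0..1}"
  by (rule inj_onI) (metis order_chartD(4) order_antisym order_refl)

lemma continuous_on_order_chart:
  fixes \<phi> :: "real \<Rightarrow> 'a::linorder_topology"
  assumes "order_chart \<phi> x y"
  shows "continuous_on {0..1} \<phi>"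
proof (rule continuous_on_order_embedding)
  fix s t :: real assume st: "s \<in> {0..1}" "t \<in> {0..1}"
  then show "\<phi> s \<le> \<phi> t \<longleftrightarrow> s \<le> t" by (rule order_chartD(4)[OF assms])
  have "\<phi> s \<in> {x..y}" "\<phi> t \<in> {x..y}" using st order_chartD(3)[OF assms] by blast+
  then show "{\<phi> s..\<phi> t} \<subseteq> \<phi> ` {0..1}" unfolding order_chartD(3)[OF assms] by auto
qed

text \<open>The chart is the inverse of \<open>H\<close> after the affine map of [0, 1] onto the
  interval from \<open>H m\<close> to \<open>H x\<close>, which lies in the range of
  \<open>H\<close> since that range is an interval.\<close>

lemma order_chart_from_real:
  fixes H :: "'a::linorder \<Rightarrow> real"
  assumes ord: "\<And>x y. x \<in> {p..q} \<Longrightarrow> y \<in> {p..q} \<Longrightarrow> H x \<le> H y \<longleftrightarrow> x \<le> y"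
    and onto: "H ` {p..q} = {H p..H q}" and pq: "p \<le> m" "m < x" "x \<le> q"
  shows "\<exists>\<phi>. order_chart \<phi> m x"
proof -
  have inj: "inj_on H {p..q}"
    by (rule inj_onI) (metis ord order_antisym order_refl)
  have mx: "m \<in> {p..q}" "x \<in> {p..q}" "p \<in> {p..q}" "q \<in> {p..q}" using pq by auto
  have lt: "H m < H x" using ord[OF mx(2,1)] pq by auto
  define g where "g = inv_into {p..q} H"
  have g: "g (H z) = z" if "z \<in> {p..q}" for z
    unfolding g_def using inj that by (rule inv_into_f_f)
  have Hg: "H (g r) = r" "g r \<in> {p..q}" if "r \<in> {H m..H x}" for r
  proof -
    have "r \<in> H ` {p..q}" unfolding onto using that ord[OF mx(3,1)] ord[OF mx(2,4)] pq by auto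
    then show "H (g r) = r" "g r \<in> {p..q}"
      unfolding g_def by (rule f_inv_into_f, rule inv_into_into)
  qed
  define d where "d = H x - H m"
  have d: "0 < d" and Hx: "H x = H m + d" using lt by (simp_all add: d_def)
  define \<phi> where "\<phi> t = g (H m + t * d)" for t
  have rng: "H m + t * d \<in> {H m..H x}" if "t \<in> {0..1}" for t
  proof -
    have "t * d \<le> 1 * d" "0 \<le> t * d" using that d by (auto intro: mult_right_mono)
    then show ?thesis unfolding Hx by simp
  qed
  have ord\<phi>: "\<phi> s \<le> \<phi> t \<longleftrightarrow> s \<le> t" if "s \<in> {0..1}" "t \<in> {0..1}" for s t
  proof -
    have "\<phi> s \<le> \<phi> t \<longleftrightarrow> H (\<phi> s) \<le> H (\<phi> t)"
      unfolding \<phi>_def by (rule ord[symmetric]) (intro Hg(2) rng that)+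
    also have "\<dots> \<longleftrightarrow> H m + s * d \<le> H m + t * d"
      unfolding \<phi>_def by (simp only: Hg(1)[OF rng[OF that(1)]] Hg(1)[OF rng[OF that(2)]])
    also have "\<dots> \<longleftrightarrow> s \<le> t" using d by simp
    finally show ?thesis .
  qed
  have \<phi>01: "\<phi> 0 = m" "\<phi> 1 = x" using g mx by (simp_all add: \<phi>_def d_def)
  have "\<phi> ` {0..1} = {m..x}"
  proof (intro equalityI subsetI)
    fix z assume "z \<in> \<phi> ` {0..1}"
    then obtain t where "t \<in> {0..1}" "z = \<phi> t" by blast
    then show "z \<in> {m..x}" using ord\<phi>[of 0 t] ord\<phi>[of t 1] \<phi>01 by simp
  next
    fix z assume z: "z \<in> {m..x}"
    then have z': "z \<in> {p..q}" using pq by auto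
    define t where "t = (H z - H m) / d"
    have "H m \<le> H z" "H z \<le> H x" using ord mx z z' by auto
    then have "t \<in> {0..1}" using d by (simp add: t_def) (simp add: d_def)
    moreover have "\<phi> t = z" using d g[OF z'] by (simp add: \<phi>_def t_def)
    ultimately show "z \<in> \<phi> ` {0..1}" by blast
  qed
  then show ?thesis using \<phi>01 ord\<phi> by (intro exI[of _ \<phi>]) (simp add: order_chart_def)
qed

text \<open>The four axioms have separate tasks: charts turn bounded intervals into arcs, the second
  places every countable set in such an arc, local boundedness reduces continuity to one interval,
  and the last provides a set of size at most aleph_1 that no interval, hence no arc, can
  absorb.\<close>

class long_order = linorder_topology +
  assumes ex_chart: "x < y \<Longrightarrow> \<exists>\<phi>::real \<Rightarrow> 'a. \<phi> 0 = x \<and> \<phi> 1 = y \<and> \<phi> ` {0..1} = {x..y} \<and>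
      (\<forall>s\<in>{0..1}. \<forall>t\<in>{0..1}. \<phi> s \<le> \<phi> t \<longleftrightarrow> s \<le> t)"
    and countable_subset_interval: "countable S \<Longrightarrow> \<exists>x y. x < y \<and> S \<subseteq> {x..y}"
    and locally_bounded: "\<exists>U x y. open U \<and> z \<in> U \<and> U \<subseteq> {x..y}"
    and ex_small_unbounded: "\<exists>S. |S| \<le>o cardSuc natLeq \<and> (\<forall>x y. \<not> S \<subseteq> {x..y})"

lemma ex_order_chart: "x < y \<Longrightarrow> \<exists>\<phi>. order_chart \<phi> x (y :: 'a::long_order)"
  unfolding order_chart_def by (rule ex_chart)

lemma card_of_range_omega1: "|range (f :: omega1 \<Rightarrow> 'b)| \<le>o cardSuc natLeq"
proof -
  have "|range f| \<le>o |UNIV :: omega1 set|" by (rule card_of_image)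
  also have "|UNIV :: omega1 set| =o |Rep_omega1 ` UNIV|"
    by (rule card_of_ordIsoI[of Rep_omega1]) (simp add: bij_betw_def inj_def Rep_omega1_inject)
  also have "Rep_omega1 ` UNIV = Field (cardSuc natLeq)"
    by (rule type_definition.Rep_range[OF type_definition_omega1])
  also have "|Field (cardSuc natLeq)| =o cardSuc natLeq"
    by (rule card_of_Field_ordIso[OF cardSuc_Card_order[OF natLeq_Card_order]])
  finally show ?thesis .
qed

lemma lr_unbounded: "\<exists>\<alpha>. x < lr \<alpha> 0"
proof (cases x rule: lr_cases)
  case (1 \<beta> t)
  obtain \<alpha> where "\<beta> < \<alpha>" using countable_omega1_bounded[of "{\<beta>}"] by auto
  then show ?thesis using 1 by (auto simp: lr_less_iff)
qed

instance long_ray :: long_order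
proof
  show "\<exists>\<phi>. \<phi> 0 = x \<and> \<phi> 1 = y \<and> \<phi> ` {0..1::real} = {x..y} \<and>
      (\<forall>s\<in>{0..1}. \<forall>t\<in>{0..1}. \<phi> s \<le> \<phi> t \<longleftrightarrow> s \<le> t)" if "x < y" for x y :: long_ray
  proof -
    obtain G :: "long_ray \<Rightarrow> real" where G: "G 0 = 0"
      "\<And>x' y'. x' \<le> y \<Longrightarrow> y' \<le> y \<Longrightarrow> G x' \<le> G y' \<longleftrightarrow> x' \<le> y'" "G ` {..y} = {0..G y}"
      using long_ray_segment_real[of y] by blast
    have "{0..y} = {..y}" by auto
    then show ?thesis unfolding order_chart_def[symmetric] using G that by (intro order_chart_from_real[of 0 y G]) auto
  qed
  show "\<exists>x y. x < y \<and> S \<subseteq> {x..y}" if "countable S" for S :: "long_ray set"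
  proof -
    have "countable (insert 0 S)" using that by simp
    then obtain b where "\<And>s. s \<in> insert 0 S \<Longrightarrow> s < b" using countable_long_ray_bounded by blast
    then show ?thesis by (intro exI[of _ 0] exI[of _ b]) (auto simp: less_imp_le)
  qed
  show "\<exists>U x y. open U \<and> z \<in> U \<and> U \<subseteq> {x..y}" for z :: long_ray
  proof -
    obtain y where "z < y" using lr_unbounded by blast
    then show ?thesis by (intro exI[of _ "{..<y}"] exI[of _ 0] exI[of _ y]) (auto simp: less_imp_le)
  qed
  show "\<exists>S::long_ray set. |S| \<le>o cardSuc natLeq \<and> (\<forall>x y. \<not> S \<subseteq> {x..y})"
  proof (intro exI[of _ "range (\<lambda>\<alpha>. lr \<alpha> 0)"] conjI allI card_of_range_omega1 notI)
    fix x y assume *: "range (\<lambda>\<alpha>. lr \<alpha> 0) \<subseteq> {x..y}"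
    obtain \<alpha> where "y < lr \<alpha> 0" using lr_unbounded by blast
    with * show False by (auto simp: subset_iff not_le[symmetric])
  qed
qed

section \<open>The long line as a long order, its half-lines, and its order characterisation\<close>

text \<open>The absolute value. It transfers bounds for countable sets from the ray to the line, and
  on \<open>{0..}\<close> it is the inverse of \<open>pos_ray\<close>.\<close>

definition magnitude :: "long_line \<Rightarrow> long_ray" where
  "magnitude x = (case Rep_long_line x of Inl r \<Rightarrow> r | Inr r \<Rightarrow> r)"

lemma magnitude_rays [simp]: "magnitude (pos_ray r) = r" "magnitude (neg_ray r) = r"
  by (simp_all add: magnitude_def Rep_pos_ray Rep_neg_ray)

lemma pos_ray_0: "pos_ray 0 = 0" and neg_ray_zero: "neg_ray 0 = 0" and pos_ray_1: "pos_ray 1 = 1"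
  and neg_ray_1: "neg_ray 1 = - 1"
  by (simp_all add: zero_long_line_def one_long_line_def neg_ray_0 long_line_uminus)

lemma long_line_less:
  "pos_ray r < pos_ray s \<longleftrightarrow> r < s"
  "neg_ray r < neg_ray s \<longleftrightarrow> s < r"
  by (simp_all add: long_line_order not_le[symmetric])

lemma less_pos_ray: "magnitude x < b \<Longrightarrow> neg_ray b < x \<and> x < pos_ray b"
proof -
  assume b: "magnitude x < b"
  then have "b \<noteq> 0" using long_ray_zero_le[of "magnitude x"] by (metis leD)
  with b show ?thesis
    by (cases x rule: long_line_cases) (auto simp: long_line_order not_le[symmetric])
qed

lemma countable_long_line_bounded:
  assumes "countable (S :: long_line set)"
  obtains b where "\<And>s. s \<in> S \<Longrightarrow> neg_ray b < s \<and> s < pos_ray b"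
proof -
  have "countable (magnitude ` S)" using assms by simp
  then obtain b where "\<And>s. s \<in> magnitude ` S \<Longrightarrow> s < b" using countable_long_ray_bounded by blast
  then show ?thesis using less_pos_ray by (intro that[of b]) blast
qed

instance long_line :: long_order
proof
  show "\<exists>\<phi>. \<phi> 0 = x \<and> \<phi> 1 = y \<and> \<phi> ` {0..1::real} = {x..y} \<and>
      (\<forall>s\<in>{0..1}. \<forall>t\<in>{0..1}. \<phi> s \<le> \<phi> t \<longleftrightarrow> s \<le> t)" if "x < y" for x y :: long_line
  proof -
    have "countable {x, y}" by simp
    then obtain b where b: "\<And>s. s \<in> {x, y} \<Longrightarrow> neg_ray b < s \<and> s < pos_ray b"
      using countable_long_line_bounded by blast
    obtain G :: "long_ray \<Rightarrow> real" where G: "G 0 = 0"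
      "\<And>x' y'. x' \<le> b \<Longrightarrow> y' \<le> b \<Longrightarrow> G x' \<le> G y' \<longleftrightarrow> x' \<le> y'" "G ` {..b} = {0..G b}"
      using long_ray_segment_real[of b] by blast
    \<comment> \<open>The odd extension of \<open>G\<close> to a symmetric interval;
      \<open>G 0 = 0\<close> makes the two halves agree at the origin.\<close>
    define H where "H z = (case Rep_long_line z of Inr r \<Rightarrow> G r | Inl r \<Rightarrow> - G r)" for z
    have H: "H (pos_ray r) = G r" "H (neg_ray r) = - G r" for r
      using G(1) by (simp_all add: H_def Rep_pos_ray Rep_neg_ray)
    have G0: "0 \<le> G r" "G r = 0 \<longleftrightarrow> r = 0" if "r \<le> b" for r
      using G(2)[of 0 r] G(2)[of r 0] G(1) that long_ray_zero_le[of r] long_ray_zero_le[of b]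
      by (auto intro: order.antisym)
    have Hord: "H u \<le> H v \<longleftrightarrow> u \<le> v" if "u \<in> {neg_ray b..pos_ray b}" "v \<in> {neg_ray b..pos_ray b}" for u v
    proof -
      have bd: "r \<le> b" if "pos_ray r \<in> {neg_ray b..pos_ray b} \<or> neg_ray r \<in> {neg_ray b..pos_ray b}" for r
        using that by (auto simp: long_line_order)
      show ?thesis
      proof (cases u rule: long_line_cases)
        case u: (1 r)
        show ?thesis
        proof (cases v rule: long_line_cases)
          case (1 s)
          then show ?thesis using u bd[of r] bd[of s] that by (simp add: H long_line_order G(2))
        next
          case (2 s)
          then show ?thesis using u bd[of r] bd[of s] that G0[of r] G0[of s] by (auto simp: H long_line_order)
        qed
      next
        case u: (2 r)
        show ?thesis
        proof (cases v rule: long_line_cases)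
          case (1 s)
          then show ?thesis using u bd[of r] bd[of s] that G0[of r] G0[of s] by (auto simp: H long_line_order)
        next
          case (2 s)
          then show ?thesis using u bd[of r] bd[of s] that by (simp add: H long_line_order G(2))
        qed
      qed
    qed
    have nb: "neg_ray b \<le> pos_ray b" by (simp add: long_line_order)
    have "H ` {neg_ray b..pos_ray b} = {H (neg_ray b)..H (pos_ray b)}"
    proof (intro equalityI subsetI)
      fix w assume "w \<in> H ` {neg_ray b..pos_ray b}"
      then obtain u where "u \<in> {neg_ray b..pos_ray b}" "w = H u" by blast
      then show "w \<in> {H (neg_ray b)..H (pos_ray b)}" using Hord[of "neg_ray b" u] Hord[of u "pos_ray b"] nb by simp
    next
      fix w assume w: "w \<in> {H (neg_ray b)..H (pos_ray b)}"
      then have "\<bar>w\<bar> \<in> {0..G b}" by (auto simp: H)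
      then obtain r where r: "r \<le> b" "\<bar>w\<bar> = G r" using G(3) by (metis atMost_iff imageE)
      then have "w = H (pos_ray r) \<or> w = H (neg_ray r)" by (auto simp: H)
      moreover have "pos_ray r \<in> {neg_ray b..pos_ray b}" "neg_ray r \<in> {neg_ray b..pos_ray b}"
        using r by (auto simp: long_line_order)
      ultimately show "w \<in> H ` {neg_ray b..pos_ray b}" by blast
    qed
    then show ?thesis unfolding order_chart_def[symmetric] using Hord b[of x] b[of y] that
      by (intro order_chart_from_real[of "neg_ray b" "pos_ray b" H]) auto
  qed
  have ex_bd: "\<exists>x y. x < y \<and> S \<subseteq> {x<..<y}" if S: "countable S" for S :: "long_line set"
  proof -
    \<comment> \<open>The point 0 ensures that the two ends are distinct even when \<open>S\<close>
      is empty.\<close>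
    have "countable (insert 0 S)" using S by simp
    then obtain b where b: "\<And>s. s \<in> insert 0 S \<Longrightarrow> neg_ray b < s \<and> s < pos_ray b"
      using countable_long_line_bounded by blast
    then have "neg_ray b < pos_ray b" by (meson insertI1 less_trans)
    with b show ?thesis by (intro exI[of _ "neg_ray b"] exI[of _ "pos_ray b"]) auto
  qed
  show "\<exists>x y. x < y \<and> S \<subseteq> {x..y}" if "countable S" for S :: "long_line set"
  proof -
    obtain x y where "x < y" "S \<subseteq> {x<..<y}" using ex_bd[OF \<open>countable S\<close>] by blast
    moreover have "{x<..<y} \<subseteq> {x..y}" by auto
    ultimately show ?thesis by blast
  qed
  show "\<exists>U x y. open U \<and> z \<in> U \<and> U \<subseteq> {x..y}" for z :: long_line
  proof -
    obtain x y where "z \<in> {x<..<y}" using ex_bd[of "{z}"] by auto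
    then show ?thesis by (intro exI[of _ "{x<..<y}"] exI[of _ x] exI[of _ y]) (auto simp: less_imp_le)
  qed
  show "\<exists>S::long_line set. |S| \<le>o cardSuc natLeq \<and> (\<forall>x y. \<not> S \<subseteq> {x..y})"
  proof (intro exI[of _ "range (\<lambda>\<alpha>. pos_ray (lr \<alpha> 0))"] conjI allI card_of_range_omega1 notI)
    fix x y assume *: "range (\<lambda>\<alpha>. pos_ray (lr \<alpha> 0)) \<subseteq> {x..y}"
    obtain b where "y < pos_ray b" using countable_long_line_bounded[of "{y}"] by auto
    moreover obtain \<alpha> where "b < lr \<alpha> 0" using lr_unbounded by blast
    ultimately have "y < pos_ray (lr \<alpha> 0)" by (meson long_line_less(1) less_trans)
    moreover have "pos_ray (lr \<alpha> 0) \<in> {x..y}" using * by blast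
    ultimately show False by (meson leD atLeastAtMost_iff)
  qed
qed

text \<open>Every closed half-line is a long ray, whatever its end point. This allows the origin to
  be moved and half-unbounded subintervals to be replaced by the ray.\<close>

lemma ray_order_atLeast: "ray_order {m..} (\<le>) (m :: long_line)"
proof
  show "\<exists>b\<in>{m..}. \<forall>s\<in>S. s \<le> b \<and> s \<noteq> b" if "countable S" for S :: "long_line set"
  proof -
    obtain b where "\<And>s. s \<in> insert m S \<Longrightarrow> neg_ray b < s \<and> s < pos_ray b"
      using countable_long_line_bounded[of "insert m S"] \<open>countable S\<close> by auto
    then show ?thesis by (intro bexI[of _ "pos_ray b"]) (auto simp: less_le)
  qed
  show "\<exists>\<phi>::real \<Rightarrow> long_line. \<phi> 0 = m \<and> \<phi> ` {0..1} = {z \<in> {m..}. z \<le> b} \<and>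
    (\<forall>s\<in>{0..1}. \<forall>t\<in>{0..1}. \<phi> s \<le> \<phi> t \<longleftrightarrow> s \<le> t)" if "b \<in> {m..}" "b \<noteq> m" for b
  proof -
    have "m < b" using that by auto
    then obtain \<phi> where \<phi>: "order_chart \<phi> m b" using ex_order_chart by blast
    have "{z \<in> {m..}. z \<le> b} = {m..b}" by auto
    then show ?thesis using order_chartD[OF \<phi>] by (intro exI[of _ \<phi>]) simp
  qed
qed auto

lemma ray_order_atMost: "ray_order {..m} (\<ge>) (m :: long_line)"
proof
  show "\<exists>b\<in>{..m}. \<forall>s\<in>S. b \<le> s \<and> s \<noteq> b" if "countable S" for S :: "long_line set"
  proof -
    obtain b where "\<And>s. s \<in> insert m S \<Longrightarrow> neg_ray b < s \<and> s < pos_ray b"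
      using countable_long_line_bounded[of "insert m S"] \<open>countable S\<close> by auto
    then show ?thesis by (intro bexI[of _ "neg_ray b"]) (auto simp: less_le)
  qed
  show "\<exists>\<phi>::real \<Rightarrow> long_line. \<phi> 0 = m \<and> \<phi> ` {0..1} = {z \<in> {..m}. b \<le> z} \<and>
    (\<forall>s\<in>{0..1}. \<forall>t\<in>{0..1}. \<phi> t \<le> \<phi> s \<longleftrightarrow> s \<le> t)" if "b \<in> {..m}" "b \<noteq> m" for b
  proof -
    have "b < m" using that by auto
    then obtain \<phi> where \<phi>: "order_chart \<phi> b m" using ex_order_chart by blast
    have *: "{z \<in> {..m}. b \<le> z} = {b..m}" by auto
    \<comment> \<open>For the reversed order an initial segment starts at \<open>m\<close>, so the
      chart is traversed backwards.\<close>
    have "(\<lambda>t. \<phi> (1 - t)) ` {0..1} = \<phi> ` {0..1}"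
      using image_image[of \<phi> "\<lambda>t. 1 - t" "{0..1}"] by simp
    then show ?thesis unfolding * using order_chartD[OF \<phi>]
      by (intro exI[of _ "\<lambda>t. \<phi> (1 - t)"]) simp
  qed
qed auto

text \<open>Two long rays glued at their common origin \<open>m\<close>, the lower one with its
  order reversed. The images of 1 and -1 can be prescribed because those points later serve as
  gluing points.\<close>

lemma long_line_iso:
  assumes tot: "\<And>x y. x \<in> X \<Longrightarrow> y \<in> X \<Longrightarrow> le x y \<or> le y x"
    and anti: "\<And>x y. x \<in> X \<Longrightarrow> y \<in> X \<Longrightarrow> le x y \<Longrightarrow> le y x \<Longrightarrow> x = y"
    and tra: "\<And>x y z. x \<in> X \<Longrightarrow> y \<in> X \<Longrightarrow> z \<in> X \<Longrightarrow> le x y \<Longrightarrow> le y z \<Longrightarrow> le x z"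
    and up: "ray_order {x \<in> X. le m x} le m"
    and lo: "ray_order {x \<in> X. le x m} (\<lambda>x y. le y x) m"
    and c: "c \<in> X" "le m c" "c \<noteq> m" and d: "d \<in> X" "le d m" "d \<noteq> m"
  obtains f :: "long_line \<Rightarrow> 'a" where "range f = X" "\<And>x y. le (f x) (f y) \<longleftrightarrow> x \<le> y"
    "f 0 = m" "f 1 = c" "f (- 1) = d"
proof -
  have cU: "c \<in> {x \<in> X. le m x}" and dL: "d \<in> {x \<in> X. le x m}" using c d by auto
  have mX: "m \<in> X" using ray_order.a[OF up] by simp
  obtain u :: "long_ray \<Rightarrow> 'a" where u: "range u = {x \<in> X. le m x}" "\<And>r s. le (u r) (u s) \<longleftrightarrow> r \<le> s" "u 0 = m" "u 1 = c"
    by (rule ray_order.long_ray_iso[OF up cU c(3)]) (rule that)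
  obtain l :: "long_ray \<Rightarrow> 'a" where l: "range l = {x \<in> X. le x m}" "\<And>r s. le (l s) (l r) \<longleftrightarrow> r \<le> s" "l 0 = m" "l 1 = d"
    by (rule ray_order.long_ray_iso[OF lo dL d(3)]) (rule that)
  have uX: "u r \<in> X" "le m (u r)" for r using u(1) by blast+
  have lX: "l r \<in> X" "le (l r) m" for r using l(1) by blast+
  have um: "u r = m \<longleftrightarrow> r = 0" for r
    using u(2)[of r 0] u(3) long_ray_zero_le[of r] tot[OF mX mX] by (metis order_antisym)
  have lm: "l r = m \<longleftrightarrow> r = 0" for r
    using l(2)[of 0 r] l(3) long_ray_zero_le[of r] tot[OF mX mX] by (metis order_antisym)
  define f where "f x = (case Rep_long_line x of Inr r \<Rightarrow> u r | Inl r \<Rightarrow> l r)" for x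
  have f: "f (pos_ray r) = u r" "f (neg_ray r) = l r" for r
    using u(3) l(3) by (simp_all add: f_def Rep_pos_ray Rep_neg_ray)
  have lu: "le (l r) (u s)" for r s using tra[OF lX(1) mX uX(1) lX(2) uX(2)] .
  have ul: "le (u r) (l s) \<longleftrightarrow> r = 0 \<and> s = 0" for r s
  proof
    assume *: "le (u r) (l s)"
    have "le (u r) m" using tra[OF uX(1) lX(1) mX * lX(2)] .
    then have "u r = m" using anti[OF uX(1) mX] uX(2) by blast
    moreover have "le m (l s)" using tra[OF mX uX(1) lX(1) uX(2) *] .
    then have "l s = m" using anti[OF lX(1) mX] lX(2) by blast
    ultimately show "r = 0 \<and> s = 0" using um lm by simp
  qed (use tot[OF mX mX] u(3) l(3) in auto)
  have "le (f x) (f y) \<longleftrightarrow> x \<le> y" for x y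
    by (cases x rule: long_line_cases; cases y rule: long_line_cases)
      (simp_all add: f long_line_order u(2) l(2) lu ul)
  moreover have "range f = X"
  proof (intro equalityI subsetI)
    fix z assume "z \<in> range f"
    then obtain x where "z = f x" by blast
    then show "z \<in> X" using uX lX by (cases x rule: long_line_cases) (simp_all add: f)
  next
    fix z assume "z \<in> X"
    then have "z \<in> range u \<or> z \<in> range l" using tot mX u(1) l(1) by auto
    then show "z \<in> range f" using f by (metis rangeE rangeI)
  qed
  moreover have "f 0 = m" "f 1 = c" "f (- 1) = d"
    using f(1)[of 0] f(1)[of 1] f(2)[of 1] u l by (simp_all add: pos_ray_0 pos_ray_1 neg_ray_1)
  ultimately show ?thesis by (intro that) 
qed

section \<open>Arcs and long images\<close>

definition arc_map :: "'a topology \<Rightarrow> (real \<Rightarrow> 'a) \<Rightarrow> bool" where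
  "arc_map K h \<longleftrightarrow> continuous_map (top_of_set {0..1}) K h \<and> inj_on h {0..1}"

text \<open>A continuous map from a compact space to a Hausdorff space is closed, so an injective
  one is a homeomorphism onto its image.\<close>

lemma arc_map_arc_in:
  assumes "Hausdorff_space K" "arc_map K h"
  shows "arc_in K (h ` {0..1})"
proof -
  let ?A = "h ` {0..1}"
  have h: "continuous_map (top_of_set {0..1}) K h" "inj_on h {0..1}"
    using assms(2) by (simp_all add: arc_map_def)
  have sub: "?A \<subseteq> topspace K" using continuous_map_image_subset_topspace[OF h(1)] by simp
  have c: "continuous_map (top_of_set {0..1}) (subtopology K ?A) h"
    using h(1) by (intro continuous_map_into_subtopology) auto
  have "closed_map (top_of_set {0..1}) (subtopology K ?A) h"
    using assms(1) c
    by (intro continuous_imp_closed_map_gen kc_space_subtopology Hausdorff_imp_kc_space)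
      (simp_all add: compact_space_subtopology)
  then have "homeomorphic_map (top_of_set {0..1}) (subtopology K ?A) h"
    using c h(2) sub by (intro bijective_closed_imp_homeomorphic_map) auto
  then have "subtopology K ?A homeomorphic_space top_of_set {0..1::real}"
    using homeomorphic_map_imp_homeomorphic_space homeomorphic_space_sym by blast
  then show ?thesis using sub by (simp add: arc_in_def arc_space_def)
qed

lemma arc_in_obtains_map:
  assumes "arc_in K A"
  obtains h where "arc_map K h" "h ` {0..1} = A"
proof -
  have A: "A \<subseteq> topspace K" "top_of_set {0..1::real} homeomorphic_space subtopology K A"
    using assms homeomorphic_space_sym unfolding arc_in_def arc_space_def by blast+
  then obtain h where h: "homeomorphic_map (top_of_set {0..1::real}) (subtopology K A) h"
    unfolding homeomorphic_space by blast
  have "continuous_map (top_of_set {0..1}) K h"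
    using homeomorphic_imp_continuous_map[OF h] continuous_map_into_fulltopology by blast
  moreover have "inj_on h {0..1}" using homeomorphic_imp_injective_map[OF h] by simp
  moreover have "h ` {0..1} = A"
    using homeomorphic_imp_surjective_map[OF h] A(1) by (simp add: inf.absorb2)
  ultimately show ?thesis by (intro that[of h]) (simp_all add: arc_map_def)
qed

lemma closedin_continuous_interval:
  assumes "Hausdorff_space K" "continuous_map (top_of_set {0..1::real}) K h" "compact C" "C \<subseteq> {0..1}"
  shows "closedin K (h ` C)"
proof -
  have "compactin (top_of_set {0..1}) C" using assms(3,4) by (simp add: compactin_subtopology)
  then have "compactin K (h ` C)" using assms(2) by (rule image_compactin)
  then show ?thesis using assms(1) by (simp add: compactin_imp_closedin)
qed

section \<open>Separability of arcs and its consequences for long images\<close>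

text \<open>Separability of an arc, phrased for its later use: a closed set, such as another arc,
  that contains \<open>D\<close> already contains the whole arc.\<close>

lemma continuous_interval_countable_dense:
  assumes "continuous_map (top_of_set {0..1::real}) K h"
  obtains D where "countable D" "D \<subseteq> h ` {0..1}" "\<And>C. closedin K C \<Longrightarrow> D \<subseteq> C \<Longrightarrow> h ` {0..1} \<subseteq> C"
proof -
  obtain T :: "real set" where T: "countable T" "T \<subseteq> {0..1}" "{0..1} \<subseteq> closure T"
    using separable[of "{0..1::real}"] by metis
  have "top_of_set {0..1} closure_of T = {0..1}"
    using T by (auto simp: closure_of_subtopology Int_absorb1)
  then have "h ` {0..1} \<subseteq> K closure_of h ` T"
    using continuous_map_image_closure_subset[OF assms, of T] by simp
  moreover have "K closure_of h ` T \<subseteq> C" if "closedin K C" "h ` T \<subseteq> C" for C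
    using that by (intro closure_of_minimal)
  ultimately show ?thesis using T by (intro that[of "h ` T"]) auto
qed

text \<open>An arc through a countable dense set is closed and therefore the whole space.\<close>

lemma separable_ac_space_imp_arc_space:
  assumes "Hausdorff_space K" "separable_space K" "ac_space natLeq K"
  shows "arc_space K"
proof -
  obtain C where C: "countable C" "C \<subseteq> topspace K" "K closure_of C = topspace K"
    using assms(2) by (auto simp: separable_space_def)
  then obtain A where A: "arc_in K A" "C \<subseteq> A" using assms(3) unfolding ac_space_natLeq_iff by blast
  then obtain h where h: "arc_map K h" "h ` {0..1} = A" using arc_in_obtains_map by blast
  have "closedin K A"
    using closedin_continuous_interval[OF assms(1), of h "{0..1}"] h by (simp add: arc_map_def)
  then have "topspace K \<subseteq> A" using closure_of_minimal[OF A(2), of K] C(3) by blast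
  then have "A = topspace K" using A(1) by (auto simp: arc_in_def)
  then show ?thesis using A(1) by (simp add: arc_in_def)
qed

lemma closedin_interval_image:
  fixes f :: "'b::long_order \<Rightarrow> 'a"
  assumes "Hausdorff_space K" "continuous_map euclidean K f" "x < y"
  shows "closedin K (f ` {x..y})"
proof -
  obtain \<phi> where \<phi>: "order_chart \<phi> x y" using ex_order_chart[OF assms(3)] by blast
  have "continuous_map (top_of_set {0..1}) K (f \<circ> \<phi>)"
    using continuous_on_order_chart[OF \<phi>] by (intro continuous_map_compose[OF _ assms(2)]) simp
  then have "closedin K ((f \<circ> \<phi>) ` {0..1})"
    using assms(1) by (intro closedin_continuous_interval) auto
  then show ?thesis unfolding image_comp[symmetric] order_chartD(3)[OF \<phi>] .
qed

lemma arc_in_interval_image: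
  fixes f :: "'b::long_order \<Rightarrow> 'a"
  assumes "Hausdorff_space K" "continuous_map euclidean K f" "inj f" "x < y"
  shows "arc_in K (f ` {x..y})"
proof -
  obtain \<phi> where \<phi>: "order_chart \<phi> x y" using ex_order_chart[OF assms(4)] by blast
  have "continuous_map (top_of_set {0..1}) K (f \<circ> \<phi>)"
    using continuous_on_order_chart[OF \<phi>] by (intro continuous_map_compose[OF _ assms(2)]) simp
  moreover have "inj_on (f \<circ> \<phi>) {0..1}"
    using inj_on_order_chart[OF \<phi>] assms(3) by (intro comp_inj_on) (auto intro: inj_on_subset)
  ultimately have "arc_in K ((f \<circ> \<phi>) ` {0..1})"
    using assms(1) by (intro arc_map_arc_in) (auto simp: arc_map_def)
  then show ?thesis unfolding image_comp[symmetric] order_chartD(3)[OF \<phi>] .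
qed

text \<open>The hub of the equivalences: for a nonseparable continuum, (i), (ii) and (iii) are each
  shown equivalent to being a long image of the ray or of the line. The type argument selects which
  of the two.\<close>

definition long_image :: "'b::long_order itself \<Rightarrow> 'a topology \<Rightarrow> bool" where
  "long_image _ K \<longleftrightarrow> (\<exists>f :: 'b \<Rightarrow> 'a. continuous_map euclidean K f \<and> inj f \<and> range f = topspace K)"

lemma countable_subset_interval_image:
  fixes f :: "'b::long_order \<Rightarrow> 'a"
  assumes "range f = topspace K" "countable S" "S \<subseteq> topspace K"
  obtains x y where "x < y" "S \<subseteq> f ` {x..y}"
proof -
  have "countable (inv f ` S)" using assms(2) by (rule countable_image)
  from countable_subset_interval[OF this] obtain x y where xy: "x < y" "inv f ` S \<subseteq> {x..y}" by blast
  have "S \<subseteq> f ` {x..y}"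
  proof
    fix s assume "s \<in> S"
    then have "f (inv f s) = s" using assms by (intro f_inv_into_f) auto
    moreover have "inv f s \<in> {x..y}" using \<open>s \<in> S\<close> xy(2) by blast
    ultimately show "s \<in> f ` {x..y}" by (metis imageI)
  qed
  with xy(1) show ?thesis by (rule that)
qed

lemma long_image_imp_ac_space:
  assumes "Hausdorff_space K" "long_image TYPE('b::long_order) K"
  shows "ac_space natLeq K"
  unfolding ac_space_natLeq_iff
proof (intro allI impI)
  obtain f :: "'b \<Rightarrow> 'a" where f: "continuous_map euclidean K f" "inj f" "range f = topspace K"
    using assms(2) by (auto simp: long_image_def)
  fix S assume "S \<subseteq> topspace K \<and> countable S"
  then obtain x y where "x < y" "S \<subseteq> f ` {x..y}"
    using countable_subset_interval_image[OF f(3)] by blast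
  then show "\<exists>A. arc_in K A \<and> S \<subseteq> A" using arc_in_interval_image[OF assms(1) f(1,2)] by blast
qed

text \<open>A countable dense subset of an arc lies in the closed image of a bounded interval, hence
  so does the arc. It cannot contain the image of an unbounded set, and there is one of size at most
  aleph_1 \<le> \<kappa>.\<close>

lemma long_image_imp_not_ac_space:
  assumes "Hausdorff_space K" "long_image TYPE('b::long_order) K"
    and \<kappa>: "Card_order \<kappa>" "natLeq <o \<kappa>"
  shows "\<not> ac_space \<kappa> K"
proof
  obtain f :: "'b \<Rightarrow> 'a" where f: "continuous_map euclidean K f" "inj f" "range f = topspace K"
    using assms(2) by (auto simp: long_image_def)
  obtain S :: "'b set" where S: "|S| \<le>o cardSuc natLeq" "\<And>x y. \<not> S \<subseteq> {x..y}"
    using ex_small_unbounded by blast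
  have "cardSuc natLeq \<le>o \<kappa>" using cardSuc_least[OF natLeq_Card_order \<kappa>] .
  then have "|f ` S| \<le>o \<kappa>"
    using card_of_image[of f S] S(1) by (meson ordLeq_transitive)
  moreover assume "ac_space \<kappa> K"
  moreover have "f ` S \<subseteq> topspace K" using f(3) by blast
  ultimately obtain A where A: "arc_in K A" "f ` S \<subseteq> A" by (auto simp: ac_space_def)
  obtain h where h: "arc_map K h" "h ` {0..1} = A" using arc_in_obtains_map[OF A(1)] by blast
  have "continuous_map (top_of_set {0..1}) K h" using h(1) by (simp add: arc_map_def)
  then obtain D where D: "countable D" "D \<subseteq> A" "\<And>C. closedin K C \<Longrightarrow> D \<subseteq> C \<Longrightarrow> A \<subseteq> C"
    by (rule continuous_interval_countable_dense) (use h(2) in auto)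
  have "D \<subseteq> topspace K" using D(2) A(1) by (auto simp: arc_in_def)
  then obtain x y where xy: "x < y" "D \<subseteq> f ` {x..y}"
    using countable_subset_interval_image[OF f(3) D(1)] by blast
  have "A \<subseteq> f ` {x..y}" using D(3) closedin_interval_image[OF assms(1) f(1) xy(1)] xy(2) by blast
  then have "S \<subseteq> {x..y}" using A(2) f(2) by (meson inj_image_subset_iff subset_trans)
  then show False using S(2) by blast
qed

section \<open>Limits at infinity on the long ray\<close>

lemma compact_interval:
  fixes x y :: "'b::long_order"
  shows "compact {x..y}"
proof (cases "x < y")
  case True
  then obtain \<phi> where \<phi>: "order_chart \<phi> x y" using ex_order_chart by blast
  have "compact (\<phi> ` {0..1})"
    by (rule compact_continuous_image[OF continuous_on_order_chart[OF \<phi>]]) simp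
  then show ?thesis by (simp only: order_chartD(3)[OF \<phi>])
next
  case False
  then have "{x..y} \<subseteq> {x}" by auto
  then show ?thesis by (metis compact_empty compact_sing subset_singletonD)
qed

text \<open>Increasing sequences chosen alternately from the two sets have a common limit, since
  countably many points lie in one interval, a copy of [0, 1].\<close>

lemma closed_unbounded_Int:
  fixes C1 C2 :: "long_ray set"
  assumes "closed C1" "closed C2" "\<And>x. \<exists>y\<in>C1. x \<le> y" "\<And>x. \<exists>y\<in>C2. x \<le> y"
  shows "C1 \<inter> C2 \<noteq> {}"
proof -
  obtain p where p: "\<And>x. p x \<in> C1" "\<And>x. x \<le> p x" using assms(3) by metis
  obtain q where q: "\<And>x. q x \<in> C2" "\<And>x. x \<le> q x" using assms(4) by metis
  define u where "u n = rec_nat (p 0) (\<lambda>_ x. p (q x)) n" for n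
  have u: "u 0 = p 0" "u (Suc n) = p (q (u n))" for n by (simp_all add: u_def)
  have uC: "u n \<in> C1" for n using p(1) u by (cases n) auto
  have step: "u n \<le> q (u n)" "q (u n) \<le> u (Suc n)" for n using p(2) q(2) u by auto
  have "countable (range u \<union> range (\<lambda>n. q (u n)))" by simp
  from countable_subset_interval[OF this] obtain x y where xy: "x < y" "range u \<union> range (\<lambda>n. q (u n)) \<subseteq> {x..y}" by blast
  obtain \<phi> where \<phi>: "order_chart \<phi> x y" using ex_order_chart[OF xy(1)] by blast
  \<comment> \<open>In chart parameters the interleaved sequences are bounded and monotone reals, so
    one converges and the sandwich rule gives the other the same limit.\<close>
  define s where "s n = inv_into {0..1} \<phi> (u n)" for n
  define t where "t n = inv_into {0..1} \<phi> (q (u n))" for n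
  have in_rng: "u n \<in> \<phi> ` {0..1}" "q (u n) \<in> \<phi> ` {0..1}" for n
    unfolding order_chartD(3)[OF \<phi>] using xy(2) by blast+
  have s: "s n \<in> {0..1}" "\<phi> (s n) = u n" and t: "t n \<in> {0..1}" "\<phi> (t n) = q (u n)" for n
    unfolding s_def t_def by (rule inv_into_into f_inv_into_f, rule in_rng)+
  have st: "s n \<le> t n" "t n \<le> s (Suc n)" for n
    using order_chartD(4)[OF \<phi> s(1) t(1), of n n] order_chartD(4)[OF \<phi> t(1) s(1), of n "Suc n"] step[of n]
    by (simp_all add: s t)
  have "incseq s" using st by (intro incseq_SucI) (meson order_trans)
  then obtain r where r: "s \<longlonglongrightarrow> r"
    using incseq_convergent[of s 1] s(1) by (metis atLeastAtMost_iff)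
  have "t \<longlonglongrightarrow> r"
    using r LIMSEQ_Suc[OF r] st by (intro tendsto_sandwich[of s t sequentially "\<lambda>n. s (Suc n)"]) auto
  have "r \<in> {0..1}"
    by (rule closed_sequentially[of "{0..1}" s]) (use s r in auto)
  have cont: "(\<lambda>n. \<phi> (w n)) \<longlonglongrightarrow> \<phi> r" if "w \<longlonglongrightarrow> r" "\<And>n. w n \<in> {0..1}" for w
    using continuous_on_order_chart[OF \<phi>] that \<open>r \<in> {0..1}\<close>
    unfolding continuous_on_sequentially by (auto simp: o_def)
  have "u \<longlonglongrightarrow> \<phi> r" using cont[OF r s(1)] by (simp add: s)
  then have r1: "\<phi> r \<in> C1" using closed_sequentially[of C1 u] assms(1) uC by blast
  have "(\<lambda>n. q (u n)) \<longlonglongrightarrow> \<phi> r" using cont[OF \<open>t \<longlonglongrightarrow> r\<close> t(1)] by (simp add: t)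
  then have "\<phi> r \<in> C2" using closed_sequentially[of C2 "\<lambda>n. q (u n)"] assms(2) q(1) by blast
  with r1 show ?thesis by blast
qed

text \<open>By compactness the closures of the tails have a common point \<open>k\<close>. By
  regularity a neighbourhood \<open>V\<close> of \<open>k\<close> contains a closed neighbourhood
  \<open>C\<close>. The preimages of \<open>C\<close> and of the complement of \<open>V\<close> are
  disjoint and closed, and the first is unbounded, so the second is bounded.\<close>

lemma ex_limit_at_infinity:
  fixes f :: "long_ray \<Rightarrow> 'a"
  assumes "compact_space K" "Hausdorff_space K" and f: "continuous_map euclidean K f"
  obtains k where "limitin K f k at_top"
proof -
  define \<U> where "\<U> = range (\<lambda>x. K closure_of f ` {x..})"
  have fK: "f x \<in> topspace K" for x using continuous_map_image_subset_topspace[OF f] by auto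
  have "\<Inter>\<U> \<noteq> {}"
  proof -
    have "\<Inter>\<F> \<noteq> {}" if \<F>: "finite \<F>" "\<F> \<subseteq> \<U>" for \<F>
    proof -
      obtain X where X: "finite X" "\<F> = (\<lambda>x. K closure_of f ` {x..}) ` X"
        using finite_subset_image[OF \<F>[unfolded \<U>_def]] by blast
      have "countable X" using X(1) by (rule countable_finite)
      then obtain b where b: "\<And>x. x \<in> X \<Longrightarrow> x < b" using countable_long_ray_bounded by blast
      have "f b \<in> K closure_of f ` {x..}" if "x \<in> X" for x
      proof -
        have "f ` {x..} \<subseteq> K closure_of f ` {x..}" using fK by (intro closure_of_subset) auto
        then show ?thesis using b[OF that] by (auto simp: less_imp_le)
      qed
      then show ?thesis unfolding X(2) by blast
    qed
    then have fip: "\<forall>\<F>. finite \<F> \<and> \<F> \<subseteq> \<U> \<longrightarrow> \<Inter>\<F> \<noteq> {}" by simp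
    have "\<forall>C\<in>\<U>. closedin K C" by (auto simp: \<U>_def)
    with fip show ?thesis
      by (intro compact_space_fip[THEN iffD1, OF assms(1), THEN spec, THEN mp] conjI)
  qed
  then obtain k where "k \<in> \<Inter>\<U>" by (meson ex_in_conv)
  then have k: "k \<in> K closure_of f ` {x..}" for x unfolding \<U>_def by (rule INT_D) simp
  have kK: "k \<in> topspace K" by (rule subsetD[OF closure_of_subset_topspace k[of 0]])
  have "eventually (\<lambda>x. f x \<in> V) at_top" if V: "openin K V" "k \<in> V" for V
  proof -
    have "neighbourhood_base_of (closedin K) K"
      using compact_Hausdorff_imp_regular_space[OF assms(1,2)] by (simp add: neighbourhood_base_of_closedin)
    then obtain W C where W: "openin K W" "closedin K C" "k \<in> W" "W \<subseteq> C" "C \<subseteq> V"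
      using V unfolding neighbourhood_base_of by metis
    define C1 where "C1 = {x. f x \<in> C}"
    define C2 where "C2 = {x. f x \<in> topspace K - V}"
    have "closedin euclidean {x \<in> topspace euclidean. f x \<in> C}"
      by (rule closedin_continuous_map_preimage[OF f W(2)])
    then have "closed C1" by (simp add: C1_def)
    moreover have "closedin euclidean {x \<in> topspace euclidean. f x \<in> topspace K - V}"
      by (rule closedin_continuous_map_preimage[OF f]) (use V in blast)
    then have "closed C2" by (simp add: C2_def)
    moreover have "\<exists>y\<in>C1. x \<le> y" for x
    proof -
      obtain w where "w \<in> f ` {x..}" "w \<in> W"
        using k[of x] W(1,3) unfolding in_closure_of by blast
      then show ?thesis using W(4) by (auto simp: C1_def)
    qed
    moreover have "C1 \<inter> C2 = {}" using W(5) by (auto simp: C1_def C2_def)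
    ultimately obtain x where x: "\<And>y. y \<in> C2 \<Longrightarrow> \<not> x \<le> y" using closed_unbounded_Int by metis
    have "f y \<in> V" if "x \<le> y" for y using x[of y] that fK by (auto simp: C2_def)
    then show ?thesis by (auto simp: eventually_at_top_linorder)
  qed
  with kK show ?thesis by (intro that[of k]) (simp add: limitin_def)
qed

section \<open>The order determined by the arcs of an \<open>\<aleph>\<^sub>0\<close>-arc-connected continuum\<close>

lemma continuous_inj_increasing:
  fixes m :: "real \<Rightarrow> real"
  assumes cont: "continuous_on {0..1} m" and inj: "inj_on m {0..1}" and m: "m 0 < m 1"
    and xy: "0 \<le> x" "x < y" "y \<le> 1"
  shows "m x < m y"
proof -
  \<comment> \<open>\<open>continuous_inj_imp_mono\<close> only places the value at an interior
    point strictly between the values at the ends. Used on [0, 1] it gives this comparison with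
    \<open>m 0\<close>; used on [0, y] it then compares \<open>m x\<close> with
    \<open>m y\<close>.\<close>
  have 1: "m 0 < m z" if "0 < z" "z \<le> 1" for z
    using continuous_inj_imp_mono[OF that(1) _ cont inj] that m by (cases "z = 1") force+
  show ?thesis
  proof (cases "x = 0")
    case False
    have "(m 0 < m x \<and> m x < m y) \<or> (m y < m x \<and> m x < m 0)"
      using xy False by (intro continuous_inj_imp_mono continuous_on_subset[OF cont] inj_on_subset[OF inj]) auto
    then show ?thesis using 1[of x] xy False by auto
  qed (use 1 xy in simp)
qed

text \<open>A single increasing pair \<open>s\<close>, \<open>t\<close> decides the direction: a
  decreasing \<open>m\<close> would make \<open>- m\<close> increasing and contradict that
  pair.\<close>

lemma continuous_inj_order_embedding:
  fixes m :: "real \<Rightarrow> real"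
  assumes cont: "continuous_on {0..1} m" and inj: "inj_on m {0..1}"
    and st: "s \<in> {0..1}" "t \<in> {0..1}" "s < t" "m s < m t"
    and xy: "x \<in> {0..1}" "y \<in> {0..1}"
  shows "m x \<le> m y \<longleftrightarrow> x \<le> y"
proof -
  have "m 0 \<noteq> m 1" using inj_onD[OF inj, of 0 1] by auto
  moreover have "\<not> m 1 < m 0"
  proof
    assume "m 1 < m 0"
    have "continuous_on {0..1} (\<lambda>x. - m x)" by (rule continuous_on_minus[OF cont])
    moreover have "inj_on (\<lambda>x. - m x) {0..1}" using inj by (simp add: inj_on_def)
    ultimately have "- m s < - m t"
      by (rule continuous_inj_increasing) (use \<open>m 1 < m 0\<close> st in auto)
    then show False using st by simp
  qed
  ultimately have "m 0 < m 1" by simp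
  then have lt: "m x < m y" if "x < y" "x \<in> {0..1}" "y \<in> {0..1}" for x y
    by (rule continuous_inj_increasing[OF cont inj]) (use that in auto)
  show ?thesis using lt[OF _ xy] lt[OF _ xy(2,1)] by (cases x y rule: linorder_cases) auto
qed

definition oriented_arc :: "'a topology \<Rightarrow> 'a \<Rightarrow> 'a \<Rightarrow> (real \<Rightarrow> 'a) \<Rightarrow> bool" where
  "oriented_arc K a b h \<longleftrightarrow> arc_map K h \<and> (\<exists>s\<in>{0..1}. \<exists>t\<in>{0..1}. s < t \<and> h s = a \<and> h t = b)"

text \<open>Existential over arcs; in an \<open>ac_continuum\<close> the choice of the arc is
  immaterial, by \<open>le_oarc_iff\<close>.\<close>

definition arc_order :: "'a topology \<Rightarrow> 'a \<Rightarrow> 'a \<Rightarrow> 'a \<Rightarrow> 'a \<Rightarrow> bool" where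
  "arc_order K a b x y \<longleftrightarrow>
    (\<exists>h u v. oriented_arc K a b h \<and> u \<in> {0..1} \<and> v \<in> {0..1} \<and> h u = x \<and> h v = y \<and> u \<le> v)"

lemma arc_map_reverse:
  assumes "arc_map K h"
  shows "arc_map K (\<lambda>t. h (1 - t))"
proof -
  have "continuous_map (top_of_set {0..1}) (top_of_set {0..1}) (\<lambda>t::real. 1 - t)"
    by (auto intro!: continuous_intros simp: continuous_map_in_subtopology)
  then have "continuous_map (top_of_set {0..1}) K (h \<circ> (\<lambda>t. 1 - t))"
    using assms by (intro continuous_map_compose) (auto simp: arc_map_def)
  moreover have "inj_on (\<lambda>t. h (1 - t)) {0..1}"
  proof (rule inj_onI)
    fix s t :: real assume st: "s \<in> {0..1}" "t \<in> {0..1}" "h (1 - s) = h (1 - t)"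
    have "inj_on h {0..1}" using assms by (simp add: arc_map_def)
    from inj_onD[OF this st(3)] st(1,2) show "s = t" by simp
  qed
  ultimately show ?thesis by (simp add: arc_map_def o_def)
qed

lemma oriented_arc_reverse:
  assumes "oriented_arc K a b h"
  shows "oriented_arc K b a (\<lambda>t. h (1 - t))"
proof -
  obtain s t where "s \<in> {0..1}" "t \<in> {0..1}" "s < t" "h s = a" "h t = b"
    using assms unfolding oriented_arc_def by blast
  then show ?thesis using assms arc_map_reverse unfolding oriented_arc_def
    by (intro conjI bexI[of _ "1 - t"] bexI[of _ "1 - s"]) auto
qed

text \<open>Exchanging the two base points reverses the order, so statements about the upper end of
  \<open>K\<close> also yield those about the lower end.\<close>

lemma arc_order_swap: "arc_order K b a y x \<longleftrightarrow> arc_order K a b x y"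
proof -
  have "arc_order K b a y x" if xy: "arc_order K a b x y" for a b x y
  proof -
    obtain h u v where h: "oriented_arc K a b h" "u \<in> {0..1}" "v \<in> {0..1}" "h u = x" "h v = y" "u \<le> v"
      using xy unfolding arc_order_def by blast
    show ?thesis unfolding arc_order_def
      using oriented_arc_reverse[OF h(1)] h(2-)
      by (intro exI[of _ "\<lambda>t. h (1 - t)"] exI[of _ "1 - v"] exI[of _ "1 - u"]) simp
  qed
  then show ?thesis by blast
qed

locale ac_continuum =
  fixes K :: "'a topology" and a b :: 'a
  assumes compact: "compact_space K" and Hausdorff: "Hausdorff_space K" and ac: "ac_space natLeq K"
    and a: "a \<in> topspace K" and b: "b \<in> topspace K" and ab: "a \<noteq> b"
begin

abbreviation "oarc \<equiv> oriented_arc K a b"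
abbreviation le (infix "\<sqsubseteq>" 50) where "x \<sqsubseteq> y \<equiv> arc_order K a b x y"

lemma swap: "ac_continuum K b a"
  using compact Hausdorff ac a b ab by unfold_locales auto

lemma oarcD:
  assumes "oarc h"
  shows "continuous_map (top_of_set {0..1}) K h" "inj_on h {0..1}" "t \<in> {0..1} \<Longrightarrow> h t \<in> topspace K"
proof -
  show 1: "continuous_map (top_of_set {0..1}) K h" "inj_on h {0..1}"
    using assms by (simp_all add: oriented_arc_def arc_map_def)
  show "t \<in> {0..1} \<Longrightarrow> h t \<in> topspace K"
    using continuous_map_image_subset_topspace[OF 1(1)] by auto
qed

lemma ex_oarc:
  assumes "countable S" "S \<subseteq> topspace K"
  obtains h where "oarc h" "S \<subseteq> h ` {0..1}"
proof -
  have "countable (insert a (insert b S))" "insert a (insert b S) \<subseteq> topspace K"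
    using assms a b by auto
  then obtain A where A: "arc_in K A" "insert a (insert b S) \<subseteq> A"
    using ac unfolding ac_space_natLeq_iff by blast
  obtain h where h: "arc_map K h" "h ` {0..1} = A" using arc_in_obtains_map[OF A(1)] by blast
  from A(2) h(2) obtain s where s: "s \<in> {0..1}" "h s = a" by blast
  from A(2) h(2) obtain t where t: "t \<in> {0..1}" "h t = b" by blast
  have "s \<noteq> t" using s t ab by auto
  then consider "s < t" | "t < s" by linarith
  then show ?thesis
  proof cases
    case 1
    have "oarc h" unfolding oriented_arc_def using h(1) s t 1 by blast
    then show ?thesis using A(2) h(2) by (intro that[of h]) auto
  next
    case 2
    have "oriented_arc K b a h" unfolding oriented_arc_def using h(1) s t 2 by blast
    then have "oarc (\<lambda>t. h (1 - t))" by (rule oriented_arc_reverse)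
    moreover have "(\<lambda>t. h (1 - t)) ` {0..1} = h ` {0..1}"
      using image_image[of h "\<lambda>t. 1 - t" "{0..1}"] by simp
    ultimately show ?thesis using A(2) h(2) by (intro that[of "\<lambda>t. h (1 - t)"]) auto
  qed
qed

lemma closedin_oarc: "oarc h \<Longrightarrow> compact C \<Longrightarrow> C \<subseteq> {0..1} \<Longrightarrow> closedin K (h ` C)"
  using closedin_continuous_interval[OF Hausdorff oarcD(1)] by blast

text \<open>It is enough for an arc to pass through countable dense subsets of both arcs: being
  closed, it then contains them. \<open>S\<close> leaves room for further points.\<close>

lemma oarc_extend:
  assumes "oarc h" "oarc h'" "countable S" "S \<subseteq> topspace K"
  obtains g where "oarc g" "h ` {0..1} \<subseteq> g ` {0..1}" "h' ` {0..1} \<subseteq> g ` {0..1}" "S \<subseteq> g ` {0..1}"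
proof -
  obtain D where D: "countable D" "D \<subseteq> h ` {0..1}" "\<And>C. closedin K C \<Longrightarrow> D \<subseteq> C \<Longrightarrow> h ` {0..1} \<subseteq> C"
    using continuous_interval_countable_dense[OF oarcD(1)[OF assms(1)]] by blast
  obtain D' where D': "countable D'" "D' \<subseteq> h' ` {0..1}" "\<And>C. closedin K C \<Longrightarrow> D' \<subseteq> C \<Longrightarrow> h' ` {0..1} \<subseteq> C"
    using continuous_interval_countable_dense[OF oarcD(1)[OF assms(2)]] by blast
  have "countable (D \<union> D' \<union> S)" using D(1) D'(1) assms(3) by simp
  moreover have "D \<union> D' \<union> S \<subseteq> topspace K"
    using D(2) D'(2) oarcD(3)[OF assms(1)] oarcD(3)[OF assms(2)] assms(4) by blast
  ultimately obtain g where g: "oarc g" "D \<union> D' \<union> S \<subseteq> g ` {0..1}" using ex_oarc by blast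
  have "closedin K (g ` {0..1})" using closedin_oarc[OF g(1)] by simp
  then show ?thesis using g D(3) D'(3) by (intro that[of g]) auto
qed

text \<open>An inclusion of oriented arcs is an increasing change of parameter, because a continuous
  injection between intervals is monotone and the parameters of \<open>a\<close> and \<open>b\<close> fix its direction.\<close>

lemma oarc_reparametrise:
  assumes "oarc h" "oarc g" "h ` {0..1} \<subseteq> g ` {0..1}"
  obtains m where "continuous_on {0..1} m" "m ` {0..1} \<subseteq> {0..1}"
    "\<And>s t. s \<in> {0..1} \<Longrightarrow> t \<in> {0..1} \<Longrightarrow> m s \<le> m t \<longleftrightarrow> s \<le> t"
    "\<And>t. t \<in> {0..1} \<Longrightarrow> h t = g (m t)"
proof -
  define m where "m t = inv_into {0..1} g (h t)" for t
  have m: "m t \<in> {0..1}" "g (m t) = h t" if "t \<in> {0..1}" for t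
  proof -
    have "h t \<in> g ` {0..1}" using assms(3) that by blast
    then show "m t \<in> {0..1}" "g (m t) = h t"
      unfolding m_def by (rule inv_into_into, rule f_inv_into_f)
  qed
  have g_inj: "x = y" if "g x = g y" "x \<in> {0..1}" "y \<in> {0..1}" for x y
    using inj_onD[OF oarcD(2)[OF assms(2)]] that by blast
  have cont: "continuous_on {0..1} m"
    unfolding continuous_on_closed_invariant
  proof (intro allI impI)
    fix B :: "real set" assume "closed B"
    then have "compact (B \<inter> {0..1})" by (simp add: closed_Int_compact)
    then have cl: "closedin K (g ` (B \<inter> {0..1}))" by (intro closedin_oarc[OF assms(2)]) auto
    define A where "A = {t \<in> {0..1}. h t \<in> g ` (B \<inter> {0..1})}"
    have "closedin (top_of_set {0..1}) A"
      using closedin_continuous_map_preimage[OF oarcD(1)[OF assms(1)] cl] by (simp add: A_def)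
    then have "closed A" using closedin_closed_trans by blast
    moreover have "A \<inter> {0..1} = m -` B \<inter> {0..1}"
    proof -
      have "h t \<in> g ` (B \<inter> {0..1}) \<longleftrightarrow> m t \<in> B" if t: "t \<in> {0..1}" for t
      proof
        assume "h t \<in> g ` (B \<inter> {0..1})"
        then obtain x where x: "x \<in> B" "x \<in> {0..1}" "h t = g x" by blast
        then have "x = m t" using m[OF t] by (intro g_inj) simp_all
        then show "m t \<in> B" using x by simp
      next
        assume "m t \<in> B"
        then show "h t \<in> g ` (B \<inter> {0..1})" using m[OF t] by (intro image_eqI[of _ _ "m t"]) auto
      qed
      then show ?thesis unfolding A_def by blast
    qed
    ultimately show "\<exists>A. closed A \<and> A \<inter> {0..1} = m -` B \<inter> {0..1}" by blast
  qed
  have inj: "inj_on m {0..1}"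
  proof (rule inj_onI)
    fix s t assume st: "s \<in> {0..1}" "t \<in> {0..1}" "m s = m t"
    then have "h s = h t" using m by metis
    then show "s = t" using inj_onD[OF oarcD(2)[OF assms(1)]] st by blast
  qed
  obtain s t where st: "s \<in> {0..1}" "t \<in> {0..1}" "s < t" "h s = a" "h t = b"
    using assms(1) unfolding oriented_arc_def by blast
  obtain s' t' where st': "s' \<in> {0..1}" "t' \<in> {0..1}" "s' < t'" "g s' = a" "g t' = b"
    using assms(2) unfolding oriented_arc_def by blast
  have "m s = s'" "m t = t'" using st st' m by (auto intro: g_inj)
  then have "m s < m t" using st' by simp
  note mono = continuous_inj_order_embedding[OF cont inj st(1-3) this]
  show ?thesis
  proof (rule that[of m])
    show "m ` {0..1} \<subseteq> {0..1}" using m(1) by blast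
    show "h t = g (m t)" if "t \<in> {0..1}" for t using m(2)[OF that] by simp
  qed (fact cont mono)+
qed

text \<open>An arc witnessing the order may differ from \<open>h\<close>, but both sit in a common
  oriented arc, and the changes of parameter into it are increasing.\<close>

lemma le_oarc_iff:
  assumes h: "oarc h" and u: "u \<in> {0..1}" and v: "v \<in> {0..1}"
  shows "h u \<sqsubseteq> h v \<longleftrightarrow> u \<le> v"
proof
  assume "u \<le> v"
  then show "h u \<sqsubseteq> h v"
    unfolding arc_order_def by (intro exI[of _ h] exI[of _ u] exI[of _ v] conjI refl assms)
next
  assume "h u \<sqsubseteq> h v"
  then obtain h' u' v' where h': "oarc h'" "u' \<in> {0..1}" "v' \<in> {0..1}" "h' u' = h u" "h' v' = h v" "u' \<le> v'"
    unfolding arc_order_def by blast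
  obtain g where g: "oarc g" "h ` {0..1} \<subseteq> g ` {0..1}" "h' ` {0..1} \<subseteq> g ` {0..1}"
    using oarc_extend[OF h h'(1), of "{}"] by auto
  obtain m where m: "m ` {0..1} \<subseteq> {0..1}" "\<And>s t. s \<in> {0..1} \<Longrightarrow> t \<in> {0..1} \<Longrightarrow> m s \<le> m t \<longleftrightarrow> s \<le> t"
    "\<And>t. t \<in> {0..1} \<Longrightarrow> h t = g (m t)"
    by (rule oarc_reparametrise[OF h g(1,2)]) (rule that)
  obtain m' where m': "m' ` {0..1} \<subseteq> {0..1}" "\<And>s t. s \<in> {0..1} \<Longrightarrow> t \<in> {0..1} \<Longrightarrow> m' s \<le> m' t \<longleftrightarrow> s \<le> t"
    "\<And>t. t \<in> {0..1} \<Longrightarrow> h' t = g (m' t)"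
    by (rule oarc_reparametrise[OF h'(1) g(1,3)]) (rule that)
  have "m u \<in> {0..1}" "m v \<in> {0..1}" using m(1) u v by blast+
  moreover have "m' u' \<in> {0..1}" "m' v' \<in> {0..1}" using m'(1) h'(2,3) by blast+
  moreover have "g (m u) = g (m' u')" "g (m v) = g (m' v')"
    using m(3)[OF u] m(3)[OF v] m'(3)[OF h'(2)] m'(3)[OF h'(3)] h'(4,5) by simp_all
  ultimately have "m u = m' u'" "m v = m' v'"
    using inj_onD[OF oarcD(2)[OF g(1)]] by blast+
  moreover have "m' u' \<le> m' v'" using m'(2)[OF h'(2,3)] h'(6) by blast
  ultimately have "m u \<le> m v" by simp
  then show "u \<le> v" using m(2)[OF u v] by blast
qed

lemma ex_oarc3:
  assumes "x \<in> topspace K" "y \<in> topspace K" "z \<in> topspace K"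
  shows "\<exists>h. oarc h \<and> x \<in> h ` {0..1} \<and> y \<in> h ` {0..1} \<and> z \<in> h ` {0..1}"
proof -
  have "countable {x, y, z}" "{x, y, z} \<subseteq> topspace K" using assms by auto
  then obtain h where "oarc h" "{x, y, z} \<subseteq> h ` {0..1}" by (rule ex_oarc)
  then show ?thesis by (intro exI[of _ h]) simp
qed

lemma total: "x \<in> topspace K \<Longrightarrow> y \<in> topspace K \<Longrightarrow> x \<sqsubseteq> y \<or> y \<sqsubseteq> x"
proof -
  assume "x \<in> topspace K" "y \<in> topspace K"
  then obtain h where h: "oarc h" "x \<in> h ` {0..1}" "y \<in> h ` {0..1}" using ex_oarc3 by blast
  from h(2) obtain u where u: "u \<in> {0..1}" "x = h u" by blast
  from h(3) obtain v where v: "v \<in> {0..1}" "y = h v" by blast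
  show ?thesis unfolding u(2) v(2) le_oarc_iff[OF h(1) u(1) v(1)] le_oarc_iff[OF h(1) v(1) u(1)] by (rule linear)
qed

lemma antisym:
  assumes "x \<in> topspace K" "y \<in> topspace K" "x \<sqsubseteq> y" "y \<sqsubseteq> x"
  shows "x = y"
proof -
  obtain h where h: "oarc h" "x \<in> h ` {0..1}" "y \<in> h ` {0..1}" using ex_oarc3 assms by blast
  from h(2) obtain u where u: "u \<in> {0..1}" "x = h u" by blast
  from h(3) obtain v where v: "v \<in> {0..1}" "y = h v" by blast
  from assms(3,4) have "u = v"
    unfolding u(2) v(2) le_oarc_iff[OF h(1) u(1) v(1)] le_oarc_iff[OF h(1) v(1) u(1)] by simp
  then show ?thesis using u v by simp
qed

lemma trans:
  assumes "x \<in> topspace K" "y \<in> topspace K" "z \<in> topspace K" "x \<sqsubseteq> y" "y \<sqsubseteq> z"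
  shows "x \<sqsubseteq> z"
proof -
  obtain h where h: "oarc h" "x \<in> h ` {0..1}" "y \<in> h ` {0..1}" "z \<in> h ` {0..1}" using ex_oarc3 assms by blast
  from h(2) obtain u where u: "u \<in> {0..1}" "x = h u" by blast
  from h(3) obtain v where v: "v \<in> {0..1}" "y = h v" by blast
  from h(4) obtain w where w: "w \<in> {0..1}" "z = h w" by blast
  from assms(4,5) have "u \<le> w"
    unfolding u(2) v(2) w(2) le_oarc_iff[OF h(1) u(1) v(1)] le_oarc_iff[OF h(1) v(1) w(1)] by simp
  then show ?thesis unfolding u(2) w(2) le_oarc_iff[OF h(1) u(1) w(1)] .
qed

text \<open>A point \<open>z\<close> between two points of \<open>h\<close> might a priori lie off
  \<open>h\<close>. In a larger arc through \<open>z\<close>, however, \<open>h\<close> runs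
  continuously from one parameter to the other and by the intermediate value theorem passes through
  \<open>z\<close>.\<close>

lemma oarc_interval:
  assumes h: "oarc h" and u: "u \<in> {0..1}" and v: "v \<in> {0..1}"
  shows "{z \<in> topspace K. h u \<sqsubseteq> z \<and> z \<sqsubseteq> h v} = h ` {u..v}"
proof (intro equalityI subsetI)
  fix z assume "z \<in> h ` {u..v}"
  then obtain t where t: "t \<in> {u..v}" "z = h t" by blast
  then have t': "t \<in> {0..1}" using u v by auto
  show "z \<in> {z \<in> topspace K. h u \<sqsubseteq> z \<and> z \<sqsubseteq> h v}"
    using t oarcD(3)[OF h t'] le_oarc_iff[OF h u t'] le_oarc_iff[OF h t' v] by simp
next
  fix z assume "z \<in> {z \<in> topspace K. h u \<sqsubseteq> z \<and> z \<sqsubseteq> h v}"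
  then have z: "z \<in> topspace K" "h u \<sqsubseteq> z" "z \<sqsubseteq> h v" by simp_all
  then have "h u \<sqsubseteq> h v" using trans oarcD(3)[OF h] u v by blast
  then have uv: "u \<le> v" using le_oarc_iff[OF h u v] by simp
  obtain g where g: "oarc g" "h ` {0..1} \<subseteq> g ` {0..1}" "{z} \<subseteq> g ` {0..1}"
    using oarc_extend[OF h h, of "{z}"] z(1) by auto
  obtain m where m: "continuous_on {0..1} m" "m ` {0..1} \<subseteq> {0..1}"
    "\<And>t. t \<in> {0..1} \<Longrightarrow> h t = g (m t)"
    by (rule oarc_reparametrise[OF h g(1,2)]) (rule that)
  from g(3) obtain w where w: "w \<in> {0..1}" "z = g w" by blast
  have mu: "m u \<in> {0..1}" "m v \<in> {0..1}" using m(2) u v by blast+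
  have "m u \<le> w" "w \<le> m v"
    using z(2,3) unfolding w(2) m(3)[OF u] m(3)[OF v]
    by (simp_all only: le_oarc_iff[OF g(1) mu(1) w(1)] le_oarc_iff[OF g(1) w(1) mu(2)])
  moreover have "continuous_on {u..v} m" using u v by (intro continuous_on_subset[OF m(1)]) auto
  ultimately obtain t where t: "u \<le> t" "t \<le> v" "m t = w" using IVT'[of m u w v] uv by blast
  then have "h t = z" using m(3)[of t] u v w by simp
  then show "z \<in> h ` {u..v}" using t by auto
qed

section \<open>From the arc order to a continuous injection of the ray or the line\<close>

text \<open>A countable set lies on one arc \<open>h\<close>, and any point not below
  \<open>h 1\<close> is strictly above the whole arc; initial segments are subarcs by
  \<open>oarc_interval\<close>.\<close>

lemma ray_order_upper:
  assumes m: "m \<in> topspace K" and no_max: "\<And>x. x \<in> topspace K \<Longrightarrow> \<exists>y\<in>topspace K. \<not> y \<sqsubseteq> x"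
  shows "ray_order {x \<in> topspace K. m \<sqsubseteq> x} (\<sqsubseteq>) m"
proof
  let ?X = "{x \<in> topspace K. m \<sqsubseteq> x}"
  show "m \<in> ?X" using total[OF m m] m by simp
  show "\<exists>b\<in>?X. \<forall>s\<in>S. s \<sqsubseteq> b \<and> s \<noteq> b" if S: "S \<subseteq> ?X" "countable S" for S
  proof -
    have "countable (insert m S)" "insert m S \<subseteq> topspace K" using S m by auto
    then obtain h where h: "oarc h" "insert m S \<subseteq> h ` {0..1}" using ex_oarc by blast
    have h1: "h 1 \<in> topspace K" using oarcD(3)[OF h(1)] by simp
    then obtain y where y: "y \<in> topspace K" "\<not> y \<sqsubseteq> h 1" using no_max by blast
    then have hy: "h 1 \<sqsubseteq> y" using total h1 by blast
    have "s \<sqsubseteq> y \<and> s \<noteq> y" if "s \<in> insert m S" for s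
    proof -
      have "s \<in> h ` {0..1}" using h(2) that by (rule subsetD)
      then obtain t where t: "t \<in> {0..1}" "s = h t" by blast
      have "s \<sqsubseteq> h 1" unfolding t(2) using le_oarc_iff[OF h(1) t(1), of 1] t(1) by simp
      moreover have "s \<in> topspace K" using t oarcD(3)[OF h(1)] by simp
      ultimately show ?thesis using trans[OF _ h1 y(1)] hy y(2) by blast
    qed
    then show ?thesis using y by (intro bexI[of _ y]) auto
  qed
  show "\<exists>\<phi>::real \<Rightarrow> 'a. \<phi> 0 = m \<and> \<phi> ` {0..1} = {z \<in> ?X. z \<sqsubseteq> b} \<and>
    (\<forall>s\<in>{0..1}. \<forall>t\<in>{0..1}. \<phi> s \<sqsubseteq> \<phi> t \<longleftrightarrow> s \<le> t)" if b: "b \<in> ?X" "b \<noteq> m" for b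
  proof -
    obtain h where h: "oarc h" "m \<in> h ` {0..1}" "b \<in> h ` {0..1}" using ex_oarc3 m b(1) by blast
    from h(2) obtain u where u: "u \<in> {0..1}" "m = h u" by blast
    from h(3) obtain v where v: "v \<in> {0..1}" "b = h v" by blast
    have "u \<le> v" using b(1) le_oarc_iff[OF h(1) u(1) v(1)] u(2) v(2) by simp
    moreover have "u \<noteq> v" using u v b(2) by auto
    ultimately have "u < v" by simp
    \<comment> \<open>Applied to the identity, \<open>order_chart_from_real\<close> gives an
      increasing parametrisation of [u, v] by [0, 1].\<close>
    then obtain \<psi> :: "real \<Rightarrow> real" where \<psi>: "order_chart \<psi> u v"
      using order_chart_from_real[of u v "\<lambda>x. x" u v] by auto
    have \<psi>01: "\<psi> t \<in> {0..1}" if "t \<in> {0..1}" for t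
    proof -
      have "\<psi> t \<in> {u..v}" using order_chartD(3)[OF \<psi>] that by blast
      then show ?thesis using u v by auto
    qed
    have "(h \<circ> \<psi>) ` {0..1} = {z \<in> topspace K. h u \<sqsubseteq> z \<and> z \<sqsubseteq> h v}"
      unfolding oarc_interval[OF h(1) u(1) v(1)] image_comp[symmetric] order_chartD(3)[OF \<psi>] ..
    also have "\<dots> = {z \<in> ?X. z \<sqsubseteq> b}" unfolding u(2) v(2) by blast
    finally show ?thesis
      using order_chartD(1,4)[OF \<psi>] le_oarc_iff[OF h(1) \<psi>01 \<psi>01] u(2)
      by (intro exI[of _ "h \<circ> \<psi>"]) simp
  qed
  fix x assume "x \<in> ?X" then show "m \<sqsubseteq> x" by simp
next
  fix x y assume "x \<in> {x \<in> topspace K. m \<sqsubseteq> x}" "y \<in> {x \<in> topspace K. m \<sqsubseteq> x}"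
  then have xy: "x \<in> topspace K" "y \<in> topspace K" by simp_all
  show "x \<sqsubseteq> y \<or> y \<sqsubseteq> x" using total xy .
  show "x = y" if "x \<sqsubseteq> y" "y \<sqsubseteq> x" using antisym xy that .
  fix z assume "z \<in> {x \<in> topspace K. m \<sqsubseteq> x}"
  then have z: "z \<in> topspace K" by simp
  show "x \<sqsubseteq> z" if "x \<sqsubseteq> y" "y \<sqsubseteq> z" using trans xy z that .
qed

text \<open>Near a point, \<open>f\<close> stays in an interval whose image is a subarc of some
  \<open>h\<close>. There \<open>f\<close> is \<open>h\<close> after the parameter change
  \<open>c\<close>, an order embedding with convex image and hence continuous.\<close>

lemma continuous_map_order_iso:
  fixes f :: "'b::long_order \<Rightarrow> 'a"
  assumes rng: "range f = topspace K" and ord: "\<And>x y. f x \<sqsubseteq> f y \<longleftrightarrow> x \<le> y"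
  shows "continuous_map euclidean K f"
proof -
  have fK: "f x \<in> topspace K" for x using rng by blast
  have "open {w. f w \<in> V}" if V: "openin K V" for V
  proof (subst open_subopen, intro ballI)
    fix z assume "z \<in> {w. f w \<in> V}"
    then have zV: "f z \<in> V" by simp
    obtain U x y where U: "open U" "z \<in> U" "U \<subseteq> {x..y}" using locally_bounded[of z] by blast
    obtain h where h: "oarc h" "f x \<in> h ` {0..1}" "f y \<in> h ` {0..1}" using ex_oarc3 fK by blast
    from h(2) obtain u where u: "u \<in> {0..1}" "f x = h u" by blast
    from h(3) obtain v where v: "v \<in> {0..1}" "f y = h v" by blast
    have img: "f ` {x..y} = h ` {u..v}"
    proof -
      have "f ` {x..y} = {z \<in> topspace K. f x \<sqsubseteq> z \<and> z \<sqsubseteq> f y}"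
        unfolding rng[symmetric] using ord by auto
      then show ?thesis unfolding u(2) v(2) oarc_interval[OF h(1) u(1) v(1)] .
    qed
    define c where "c w = inv_into {u..v} h (f w)" for w
    have c: "c w \<in> {u..v}" "h (c w) = f w" if "w \<in> {x..y}" for w
    proof -
      have "f w \<in> h ` {u..v}" using img that by blast
      then show "c w \<in> {u..v}" "h (c w) = f w" unfolding c_def by (rule inv_into_into, rule f_inv_into_f)
    qed
    have uv01: "{u..v} \<subseteq> {0..1}" using u v by auto
    have c01: "c w \<in> {0..1}" if "w \<in> {x..y}" for w using c(1)[OF that] uv01 by blast
    have "continuous_on {x..y} c"
    proof (rule continuous_on_order_embedding)
      fix s t assume st: "s \<in> {x..y}" "t \<in> {x..y}"
      show "c s \<le> c t \<longleftrightarrow> s \<le> t"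
        using le_oarc_iff[OF h(1) c01[OF st(1)] c01[OF st(2)]] ord c(2) st by simp
      show "{c s..c t} \<subseteq> c ` {x..y}"
      proof
        fix r assume "r \<in> {c s..c t}"
        then have r: "r \<in> {u..v}" using c(1)[OF st(1)] c(1)[OF st(2)] by auto
        then obtain w where w: "w \<in> {x..y}" "f w = h r" using img by (metis imageE imageI)
        have "h (c w) = h r" using c(2)[OF w(1)] w(2) by simp
        then have "c w = r" using inj_onD[OF oarcD(2)[OF h(1)]] c01[OF w(1)] r uv01 by blast
        then show "r \<in> c ` {x..y}" using w(1) by blast
      qed
    qed
    moreover obtain W where W: "open W" "{t \<in> {0..1}. h t \<in> V} = {0..1} \<inter> W"
    proof -
      have "openin (top_of_set {0..1}) {t \<in> topspace (top_of_set {0..1}). h t \<in> V}"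
        using openin_continuous_map_preimage[OF oarcD(1)[OF h(1)] V] .
      then show ?thesis using that by (auto simp: openin_open)
    qed
    ultimately obtain Q where Q: "open Q" "Q \<inter> {x..y} = c -` W \<inter> {x..y}"
      unfolding continuous_on_open_invariant by blast
    have iff: "w \<in> Q \<longleftrightarrow> f w \<in> V" if "w \<in> {x..y}" for w
    proof -
      have "w \<in> Q \<longleftrightarrow> c w \<in> W" using Q(2) that by blast
      also have "\<dots> \<longleftrightarrow> h (c w) \<in> V" using W(2) c01[OF that] by blast
      finally show ?thesis using c(2)[OF that] by simp
    qed
    have "z \<in> U \<inter> Q" using iff U zV by blast
    moreover have "U \<inter> Q \<subseteq> {w. f w \<in> V}" using iff U by blast
    ultimately show "\<exists>T. open T \<and> z \<in> T \<and> T \<subseteq> {w. f w \<in> V}"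
      using U(1) Q(1) by (intro exI[of _ "U \<inter> Q"]) auto
  qed
  then show ?thesis using rng by (simp add: continuous_map)
qed

lemma order_iso_imp_long_image:
  fixes f :: "'b::long_order \<Rightarrow> 'a"
  assumes rng: "range f = topspace K" and ord: "\<And>x y. f x \<sqsubseteq> f y \<longleftrightarrow> x \<le> y"
  shows "long_image TYPE('b) K"
proof -
  have "inj f"
  proof (rule injI)
    fix x y assume "f x = f y"
    then show "x = y" using ord[of x y] ord[of y x] ord[of x x] by (simp add: order.antisym)
  qed
  then show ?thesis unfolding long_image_def using continuous_map_order_iso[OF assms] rng by blast
qed

text \<open>With both a least and a greatest element, \<open>K\<close> is contained in a single
  arc.\<close>

lemma separable_if_bounded:
  assumes p: "p \<in> topspace K" "\<And>x. x \<in> topspace K \<Longrightarrow> p \<sqsubseteq> x"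
    and q: "q \<in> topspace K" "\<And>x. x \<in> topspace K \<Longrightarrow> x \<sqsubseteq> q"
  shows "separable_space K"
proof -
  obtain h where h: "oarc h" "p \<in> h ` {0..1}" "q \<in> h ` {0..1}" using ex_oarc3 p(1) q(1) by blast
  from h(2) obtain u where u: "u \<in> {0..1}" "p = h u" by blast
  from h(3) obtain v where v: "v \<in> {0..1}" "q = h v" by blast
  have "topspace K \<subseteq> h ` {u..v}"
    using oarc_interval[OF h(1) u(1) v(1)] p(2) q(2) unfolding u(2) v(2) by blast
  moreover have "{u..v} \<subseteq> {0..1}" using u v by auto
  ultimately have top: "topspace K \<subseteq> h ` {0..1}" by blast
  obtain D where D: "countable D" "D \<subseteq> h ` {0..1}" "\<And>C. closedin K C \<Longrightarrow> D \<subseteq> C \<Longrightarrow> h ` {0..1} \<subseteq> C"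
    using continuous_interval_countable_dense[OF oarcD(1)[OF h(1)]] by blast
  have DK: "D \<subseteq> topspace K" using D(2) oarcD(3)[OF h(1)] by blast
  have "topspace K \<subseteq> K closure_of D"
    using D(3)[OF closedin_closure_of closure_of_subset[OF DK]] by (rule subset_trans[OF top])
  then have "K closure_of D = topspace K" by (rule equalityI[OF closure_of_subset_topspace])
  then show ?thesis unfolding separable_space_def using D(1) DK by blast
qed

lemma long_ray_if_least:
  assumes p: "p \<in> topspace K" "\<And>x. x \<in> topspace K \<Longrightarrow> p \<sqsubseteq> x"
    and no_max: "\<And>x. x \<in> topspace K \<Longrightarrow> \<exists>y\<in>topspace K. \<not> y \<sqsubseteq> x"
  shows "long_image TYPE(long_ray) K"
proof -
  have "{x \<in> topspace K. p \<sqsubseteq> x} = topspace K" using p(2) by blast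
  then have ro: "ray_order (topspace K) (\<sqsubseteq>) p" using ray_order_upper[OF p(1) no_max] by simp
  obtain c where c: "c \<in> topspace K" "\<not> c \<sqsubseteq> p" using no_max p(1) by blast
  then have "c \<noteq> p" using total[OF p(1) p(1)] by blast
  obtain f :: "long_ray \<Rightarrow> 'a" where "range f = topspace K" "\<And>r s. f r \<sqsubseteq> f s \<longleftrightarrow> r \<le> s"
    by (rule ray_order.long_ray_iso[OF ro c(1) \<open>c \<noteq> p\<close>]) (rule that)
  then show ?thesis by (rule order_iso_imp_long_image)
qed

end

lemma ac_space_imp_long_image:
  assumes "compact_space K" "Hausdorff_space K" "ac_space natLeq K" "\<not> separable_space K"
  shows "long_image TYPE(long_ray) K \<or> long_image TYPE(long_line) K"
proof -
  \<comment> \<open>Nonseparability also provides the two distinct base points on which the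
    orientation depends.\<close>
  have "\<not> countable (topspace K)"
  proof
    assume "countable (topspace K)"
    then have "separable_space K"
      unfolding separable_space_def by (intro exI[of _ "topspace K"]) (simp add: closure_of_topspace)
    with assms(4) show False ..
  qed
  moreover have "countable (topspace K)" if "topspace K \<subseteq> {a}" for a
    using that by (rule countable_subset) simp
  ultimately have "\<not> (\<exists>a. topspace K \<subseteq> {a})" by blast
  then obtain a b where ab: "a \<in> topspace K" "b \<in> topspace K" "a \<noteq> b" by blast
  interpret ac_continuum K a b using assms ab by unfold_locales
  interpret rev: ac_continuum K b a by (rule swap)
  note rev_le = arc_order_swap[of K b a]
  show ?thesis
  proof (cases "\<exists>q\<in>topspace K. \<forall>x\<in>topspace K. arc_order K a b x q")
    case True
    then obtain q where q: "q \<in> topspace K" "\<And>x. x \<in> topspace K \<Longrightarrow> arc_order K a b x q" by blast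
    \<comment> \<open>A greatest element excludes a least one, and after exchanging \<open>a\<close>
      and \<open>b\<close> it is itself the least element of an order without a greatest
      one.\<close>
    have "\<not> (\<exists>p\<in>topspace K. \<forall>x\<in>topspace K. arc_order K a b p x)" using separable_if_bounded[OF _ _ q] assms(4) by blast
    then have "\<exists>y\<in>topspace K. \<not> arc_order K b a y x" if "x \<in> topspace K" for x
      using that unfolding rev_le by blast
    moreover have "arc_order K b a q x" if "x \<in> topspace K" for x unfolding rev_le using q(2)[OF that] .
    ultimately show ?thesis using rev.long_ray_if_least[OF q(1)] by blast
  next
    case no_max: False
    then have ub: "\<exists>y\<in>topspace K. \<not> arc_order K a b y x" if "x \<in> topspace K" for x using that by blast
    show ?thesis
    proof (cases "\<exists>p\<in>topspace K. \<forall>x\<in>topspace K. arc_order K a b p x")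
      case True
      then show ?thesis using long_ray_if_least ub by blast
    next
      case False
      then have lb: "\<exists>y\<in>topspace K. \<not> arc_order K a b x y" if "x \<in> topspace K" for x using that by blast
      \<comment> \<open>With neither end present, \<open>a\<close> serves as origin. The ray below
        it is the upper ray of the reversed order.\<close>
      have up: "ray_order {x \<in> topspace K. arc_order K a b a x} (arc_order K a b) a" by (rule ray_order_upper[OF a ub])
      have "ray_order {x \<in> topspace K. arc_order K b a a x} (arc_order K b a) a"
        by (rule rev.ray_order_upper[OF a]) (unfold rev_le, rule lb)
      then have lo: "ray_order {x \<in> topspace K. arc_order K a b x a} (\<lambda>x y. arc_order K a b y x) a"
        unfolding rev_le by (simp only: rev_le[abs_def])
      obtain c where c: "c \<in> topspace K" "\<not> arc_order K a b c a" using ub[OF a] by blast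
      then have c': "arc_order K a b a c" "c \<noteq> a" using total[OF a c(1)] total[OF a a] by auto
      obtain d where d: "d \<in> topspace K" "\<not> arc_order K a b a d" using lb[OF a] by blast
      then have d': "arc_order K a b d a" "d \<noteq> a" using total[OF a d(1)] total[OF a a] by auto
      have "long_image TYPE(long_line) K"
      proof (rule long_line_iso[of "topspace K" "arc_order K a b" a c d])
        fix f :: "long_line \<Rightarrow> 'a"
        assume "range f = topspace K" "\<And>x y. arc_order K a b (f x) (f y) \<longleftrightarrow> x \<le> y"
        then show "long_image TYPE(long_line) K" by (rule order_iso_imp_long_image)
      qed (fact total antisym trans up lo c(1) c' d(1) d')+
      then show ?thesis ..
    qed
  qed
qed

section \<open>Identification spaces\<close>

lemma quotient_maps_homeomorphic_space:
  assumes f: "quotient_map X Y f" and g: "quotient_map X Z g"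
    and ker: "\<And>x y. x \<in> topspace X \<Longrightarrow> y \<in> topspace X \<Longrightarrow> f x = f y \<longleftrightarrow> g x = g y"
  shows "Y homeomorphic_space Z"
proof -
  have ker_fg: "g x = g y" if "x \<in> topspace X" "y \<in> topspace X" "f x = f y" for x y
    using ker that by blast
  have ker_gf: "f x = f y" if "x \<in> topspace X" "y \<in> topspace X" "g x = g y" for x y
    using ker that by blast
  obtain u where u: "continuous_map Y Z u" "\<And>x. x \<in> topspace X \<Longrightarrow> u (f x) = g x"
    by (rule quotient_map_lift_exists[OF f quotient_imp_continuous_map[OF g]]) (erule (2) ker_fg, rule that)
  obtain v where v: "continuous_map Z Y v" "\<And>x. x \<in> topspace X \<Longrightarrow> v (g x) = f x"
    by (rule quotient_map_lift_exists[OF g quotient_imp_continuous_map[OF f]]) (erule (2) ker_gf, rule that)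
  have top: "topspace Y = f ` topspace X" "topspace Z = g ` topspace X"
    using quotient_imp_surjective_map[OF f] quotient_imp_surjective_map[OF g] by auto
  have "homeomorphic_maps Y Z u v"
    unfolding homeomorphic_maps_def using u v by (auto simp: top)
  then show ?thesis by (auto simp: homeomorphic_space_def)
qed

text \<open>\<open>\<rho>\<close> retracts \<open>X\<close> onto a copy \<open>i\<close> of the space \<open>'t\<close>, which meets every class of the
  identification in exactly one point.\<close>

locale identification =
  fixes X :: "'x topology" and E :: "'x rel" and \<rho> :: "'x \<Rightarrow> 'x" and i :: "'t::long_order \<Rightarrow> 'x"
  assumes i_cont: "continuous_map euclidean X i" and i_inj: "inj i" and i_range: "range i = \<rho> ` topspace X"
    and retract: "\<rho> (i t) = i t" and related: "x \<in> topspace X \<Longrightarrow> x = \<rho> x \<or> (x, \<rho> x) \<in> E"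
    and respects: "(x, y) \<in> E \<Longrightarrow> \<rho> x = \<rho> y"
begin

text \<open>\<rho> is constant along the steps of \<open>E\<close>, and every point is at most one
  step away from its image under \<rho>, so the generated equivalence is the kernel of
  \<rho>.\<close>

lemma identification_rel_iff:
  assumes "x \<in> topspace X" "y \<in> topspace X"
  shows "(x, y) \<in> identification_rel (topspace X) E \<longleftrightarrow> \<rho> x = \<rho> y"
proof
  assume "(x, y) \<in> identification_rel (topspace X) E"
  then have "(x, y) \<in> (E \<union> E\<inverse>)\<^sup>*" by (simp add: identification_rel_def)
  then show "\<rho> x = \<rho> y"
    by (induction rule: rtrancl_induct) (auto dest: respects)
next
  assume eq: "\<rho> x = \<rho> y"
  have "(x, \<rho> x) \<in> (E \<union> E\<inverse>)\<^sup>*" using related[OF assms(1)] by auto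
  moreover have "(\<rho> y, y) \<in> (E \<union> E\<inverse>)\<^sup>*" using related[OF assms(2)] by auto
  ultimately have "(x, y) \<in> (E \<union> E\<inverse>)\<^sup>*" using eq by (metis rtrancl_trans)
  then show "(x, y) \<in> identification_rel (topspace X) E" using assms by (simp add: identification_rel_def)
qed

definition proj :: "'x \<Rightarrow> 'x set" where
  "proj x = identification_rel (topspace X) E `` {x}"

lemma quotient_map_proj: "quotient_map X (identify X E) proj"
  unfolding identify_def proj_def[abs_def]
  by (rule quotient_map_quotient_topology[OF equiv_identification_rel])

lemma proj_eq_iff:
  assumes "x \<in> topspace X" "y \<in> topspace X"
  shows "proj x = proj y \<longleftrightarrow> \<rho> x = \<rho> y"
  unfolding proj_def using eq_equiv_class_iff[OF equiv_identification_rel assms] identification_rel_iff[OF assms]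
  by simp

lemma i_topspace: "i t \<in> topspace X"
  using continuous_map_image_subset_topspace[OF i_cont] by auto

lemma i_eq_iff: "i s = i t \<longleftrightarrow> s = t"
  using i_inj by (auto dest: injD)

lemma long_image_identify: "long_image TYPE('t) (identify X E)"
  unfolding long_image_def
proof (intro exI conjI)
  show "continuous_map euclidean (identify X E) (proj \<circ> i)"
    by (rule continuous_map_compose[OF i_cont quotient_imp_continuous_map[OF quotient_map_proj]])
  show "inj (proj \<circ> i)"
    by (rule injI) (simp add: proj_eq_iff i_topspace retract i_eq_iff)
  have "range (proj \<circ> i) = proj ` topspace X"
  proof (intro equalityI subsetI)
    fix z assume "z \<in> range (proj \<circ> i)"
    then show "z \<in> proj ` topspace X" using i_topspace by auto
  next
    fix z assume "z \<in> proj ` topspace X"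
    then obtain x where x: "x \<in> topspace X" "z = proj x" by blast
    then have "\<rho> x \<in> range i" using i_range by blast
    then obtain t where "\<rho> x = i t" by blast
    then have "proj x = proj (i t)" using proj_eq_iff[OF x(1) i_topspace[of t]] retract by simp
    then show "z \<in> range (proj \<circ> i)" using x(2) by auto
  qed
  then show "range (proj \<circ> i) = topspace (identify X E)"
    using quotient_imp_surjective_map[OF quotient_map_proj] by simp
qed

text \<open>From a compact space onto a Hausdorff space, \<open>F\<close> is closed and thus a
  quotient map. Its fibres are those of \<rho>, because \<open>F\<close> factors through \<rho> and
  is injective on the copy \<open>i\<close>; so it has the same quotient as
  \<open>proj\<close>.\<close>

lemma homeomorphic_identify:
  assumes X: "compact_space X" and K: "Hausdorff_space K" and F: "continuous_map X K F"
    and inj: "inj (\<lambda>t. F (i t))" and rng: "range (\<lambda>t. F (i t)) = topspace K"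
    and F\<rho>: "\<And>x. x \<in> topspace X \<Longrightarrow> F x = F (\<rho> x)"
  shows "K homeomorphic_space identify X E"
proof (rule quotient_maps_homeomorphic_space[OF _ quotient_map_proj])
  have "F ` topspace X = topspace K"
  proof
    show "F ` topspace X \<subseteq> topspace K" by (rule continuous_map_image_subset_topspace[OF F])
    show "topspace K \<subseteq> F ` topspace X" unfolding rng[symmetric] using i_topspace by auto
  qed
  moreover have "closed_map X K F"
    by (rule continuous_imp_closed_map_gen[OF X Hausdorff_imp_kc_space[OF K] F])
  ultimately show "quotient_map X K F" using F by (intro continuous_closed_imp_quotient_map)
  fix x y assume xy: "x \<in> topspace X" "y \<in> topspace X"
  then have "\<rho> x \<in> range i" "\<rho> y \<in> range i" unfolding i_range by blast+
  then obtain s t where st: "\<rho> x = i s" "\<rho> y = i t" by blast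
  have "F x = F y \<longleftrightarrow> F (i s) = F (i t)" using F\<rho>[OF xy(1)] F\<rho>[OF xy(2)] st by simp
  also have "\<dots> \<longleftrightarrow> s = t" using injD[OF inj, of s t] by auto
  also have "\<dots> \<longleftrightarrow> proj x = proj y" unfolding proj_eq_iff[OF xy] st i_eq_iff ..
  finally show "F x = F y \<longleftrightarrow> proj x = proj y" .
qed

end

lemma long_image_homeomorphic_space:
  assumes "K homeomorphic_space Y" "long_image TYPE('b::long_order) Y"
  shows "long_image TYPE('b) K"
proof -
  obtain g where g: "homeomorphic_map Y K g"
    using assms(1) homeomorphic_space homeomorphic_space_sym by blast
  obtain f :: "'b \<Rightarrow> _" where f: "continuous_map euclidean Y f" "inj f" "range f = topspace Y"
    using assms(2) by (auto simp: long_image_def)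
  have "inj (g \<circ> f)"
    using f(2,3) homeomorphic_imp_injective_map[OF g] by (simp add: comp_inj_on)
  moreover have "range (g \<circ> f) = topspace K"
    unfolding image_comp[symmetric] f(3) by (rule homeomorphic_imp_surjective_map[OF g])
  ultimately show ?thesis unfolding long_image_def
    using continuous_map_compose[OF f(1) homeomorphic_imp_continuous_map[OF g]] by blast
qed

section \<open>The one-point compactification of the long ray\<close>

lemma identification_alpha:
  "identification alpha_long_ray {(None, Some p)} (case_option (Some p) Some) Some"
proof
  show "continuous_map euclidean alpha_long_ray Some" by (rule continuous_map_Some)
  show "range Some = case_option (Some p) Some ` topspace alpha_long_ray"
    by (auto simp: image_iff)
qed (auto split: option.splits)

text \<open>The limit of \<open>f\<close> at infinity is a value \<open>f p\<close> since
  \<open>f\<close> is onto. Extending \<open>f\<close> by this limit gives a continuous map of the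
  compactification whose only coincidence is that of infinity with \<open>p\<close>.\<close>

lemma long_ray_image_homeomorphic:
  assumes "compact_space K" "Hausdorff_space K" "long_image TYPE(long_ray) K"
  shows "\<exists>p. K homeomorphic_space identify alpha_long_ray {(None, Some p)}"
proof -
  obtain f :: "long_ray \<Rightarrow> 'a" where f: "continuous_map euclidean K f" "inj f" "range f = topspace K"
    using assms(3) by (auto simp: long_image_def)
  obtain k where k: "limitin K f k at_top" using ex_limit_at_infinity[OF assms(1,2) f(1)] .
  have "k \<in> range f" unfolding f(3) by (rule limitin_topspace[OF k])
  then obtain p where p: "k = f p" by blast
  have fK: "f x \<in> topspace K" for x using f(3) by blast
  define F where "F = case_option k f"
  have "openin alpha_long_ray {x \<in> topspace alpha_long_ray. F x \<in> V}" if V: "openin K V" for V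
  proof -
    have "openin euclidean {x \<in> topspace euclidean. f x \<in> V}"
      by (rule openin_continuous_map_preimage[OF f(1) V])
    then have op: "open {x. f x \<in> V}" by simp
    show ?thesis
    proof (cases "k \<in> V")
      case False
      then have "{x \<in> topspace alpha_long_ray. F x \<in> V} = Some ` {x. f x \<in> V}"
        by (auto simp: F_def split: option.splits)
      then show ?thesis using op by simp
    next
      case True
      obtain N where N: "\<And>x. N \<le> x \<Longrightarrow> f x \<in> V"
        using limitinD[OF k V True] by (auto simp: eventually_at_top_linorder)
      \<comment> \<open>A neighbourhood of the point at infinity is the complement of a closed
        compact set. This one is compact because the limit confines it to
        \<open>{0..N}\<close>.\<close>
      define C where "C = {x. f x \<notin> V}"
      have "closed C" unfolding C_def using op by (simp add: closed_def Compl_eq)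
      moreover have "x \<in> {0..N}" if "x \<in> C" for x
        using N[of x] linear[of x N] that by (auto simp: C_def)
      then have "C = {0..N} \<inter> C" by blast
      ultimately have "compact C" using compact_interval compact_Int_closed by metis
      moreover have "{x \<in> topspace alpha_long_ray. F x \<in> V} = insert None (Some ` (topspace euclidean - C))"
      proof (intro set_eqI)
        fix x
        show "x \<in> {x \<in> topspace alpha_long_ray. F x \<in> V} \<longleftrightarrow> x \<in> insert None (Some ` (topspace euclidean - C))"
          using True by (cases x) (auto simp: F_def C_def)
      qed
      ultimately show ?thesis
        unfolding openin_Alexandroff_compactification using \<open>closed C\<close> by auto
    qed
  qed
  moreover have "F ` topspace alpha_long_ray \<subseteq> topspace K"
    using fK p by (auto simp: F_def)
  ultimately have cont: "continuous_map alpha_long_ray K F" by (simp add: continuous_map)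
  have "K homeomorphic_space identify alpha_long_ray {(None, Some p)}"
    using f(2,3) p
    by (intro identification.homeomorphic_identify[OF identification_alpha _ assms(2) cont])
      (auto simp: F_def split: option.splits)
  then show ?thesis ..
qed

section \<open>The two-point compactification of the long line\<close>

lemma continuous_Fin: "continuous_on UNIV (Fin :: long_line \<Rightarrow> long_line extended)"
proof (rule continuous_on_order_embedding)
  show "{Fin x..Fin y} \<subseteq> range Fin" for x y :: long_line
  proof
    fix z assume "z \<in> {Fin x..Fin y}"
    then show "z \<in> range Fin" by (cases z) auto
  qed
qed simp

lemma open_Fin:
  assumes "open (U :: long_line set)"
  shows "open (Fin ` U)"
proof -
  define g where "g z = (case z of Fin x \<Rightarrow> x | _ \<Rightarrow> 0)" for z :: "long_line extended"
  have A: "{Minf<..<Pinf} = range (Fin :: long_line \<Rightarrow> _)"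
  proof (intro equalityI subsetI)
    fix z :: "long_line extended" assume "z \<in> {Minf<..<Pinf}"
    then show "z \<in> range Fin" by (cases z) auto
  qed auto
  have g: "g (Fin x) = x" for x by (simp add: g_def)
  have "continuous_on {Minf<..<Pinf} g"
  proof (rule continuous_on_order_embedding)
    show "g x \<le> g y \<longleftrightarrow> x \<le> y" if "x \<in> {Minf<..<Pinf}" "y \<in> {Minf<..<Pinf}" for x y
      using that unfolding A by (auto simp: g)
    have "x \<in> g ` range Fin" for x using g[of x] by (metis rangeI imageI)
    then show "{g x..g y} \<subseteq> g ` {Minf<..<Pinf}" for x y unfolding A by blast
  qed
  then have "open (g -` U \<inter> {Minf<..<Pinf})"
    using continuous_on_open_vimage[OF open_greaterThanLessThan] assms by blast
  moreover have "g -` U \<inter> {Minf<..<Pinf} = Fin ` U"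
    unfolding A by (auto simp: g)
  ultimately show ?thesis by simp
qed

lemma extended_nhds_Pinf:
  assumes "open (V :: long_line extended set)" "Pinf \<in> V"
  obtains N where "\<And>x. N < x \<Longrightarrow> Fin x \<in> V"
proof -
  obtain b where b: "b < Pinf" "{b<..Pinf} \<subseteq> V" using open_left[OF assms, of "Minf"] by auto
  show ?thesis
  proof (cases b)
    case (Fin N)
    then show ?thesis using b(2) by (intro that[of N]) auto
  next
    \<comment> \<open>The bound may be the opposite end; then \<open>V\<close> contains every finite
      point and any \<open>N\<close> will do.\<close>
    case Minf
    then show ?thesis using b(2) by (intro that[of 0]) auto
  qed (use b in simp)
qed

lemma extended_nhds_Minf:
  assumes "open (V :: long_line extended set)" "Minf \<in> V"
  obtains N where "\<And>x. x < N \<Longrightarrow> Fin x \<in> V"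
proof -
  obtain b where b: "Minf < b" "{Minf..<b} \<subseteq> V" using open_right[OF assms, of "Pinf"] by auto
  show ?thesis
  proof (cases b)
    case (Fin N)
    then show ?thesis using b(2) by (intro that[of N]) auto
  next
    case Pinf
    then show ?thesis using b(2) by (intro that[of 0]) auto
  qed (use b in simp)
qed

text \<open>Two members of a cover that contain the ends leave at most a closed interval of finite
  points, which is compact.\<close>

lemma compact_gamma_long_line: "compact_space gamma_long_line"
proof -
  have "compact (UNIV :: long_line extended set)"
  proof (rule compactI)
    fix \<C> :: "long_line extended set set"
    assume op: "\<forall>V\<in>\<C>. open V" and cov: "UNIV \<subseteq> \<Union>\<C>"
    have "Pinf \<in> \<Union>\<C>" "Minf \<in> \<Union>\<C>" by (rule subsetD[OF cov UNIV_I])+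
    then obtain V W where VW: "V \<in> \<C>" "Pinf \<in> V" "W \<in> \<C>" "Minf \<in> W" by (elim UnionE) (rule that)
    have opV: "open V" and opW: "open W" using op VW by simp_all
    obtain M where M: "\<And>x. M < x \<Longrightarrow> Fin x \<in> V" by (rule extended_nhds_Pinf[OF opV VW(2)]) (rule that)
    obtain N where N: "\<And>x. x < N \<Longrightarrow> Fin x \<in> W" by (rule extended_nhds_Minf[OF opW VW(4)]) (rule that)
    have cpt: "compact (Fin ` {N..M})"
      by (rule compact_continuous_image[OF continuous_on_subset[OF continuous_Fin] compact_interval]) simp
    have sub: "Fin ` {N..M} \<subseteq> \<Union>\<C>" by (rule subset_trans[OF subset_UNIV cov])
    have opn: "open B" if "B \<in> \<C>" for B using op that by simp
    obtain \<D> where \<D>: "\<D> \<subseteq> \<C>" "finite \<D>" "Fin ` {N..M} \<subseteq> \<Union>\<D>"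
      by (rule compactE[OF cpt sub]) (erule opn, rule that)
    have "z \<in> \<Union>(insert V (insert W \<D>))" for z
    proof (cases z)
      case (Fin x)
      consider "M < x" | "x < N" | "x \<in> {N..M}" by (metis atLeastAtMost_iff leI)
      then show ?thesis
      proof cases
        case 3
        then have "Fin x \<in> \<Union>\<D>" using \<D>(3) by blast
        then show ?thesis using Fin by simp
      qed (use M N Fin in simp_all)
    qed (use VW in auto)
    then show "\<exists>\<D>\<subseteq>\<C>. finite \<D> \<and> UNIV \<subseteq> \<Union>\<D>"
      using \<D>(1,2) VW by (intro exI[of _ "insert V (insert W \<D>)"]) auto
  qed
  then show ?thesis by (simp add: compact_space_def)
qed

lemma identification_gamma:
  "identification gamma_long_line {(Minf, Fin p), (Pinf, Fin q)} (case_extended Fin (Fin q) (Fin p)) Fin"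
proof
  show "continuous_map euclidean gamma_long_line Fin" using continuous_Fin by simp
  show "range Fin = case_extended Fin (Fin q) (Fin p) ` topspace gamma_long_line"
  proof (intro equalityI subsetI)
    fix z assume "z \<in> case_extended Fin (Fin q) (Fin p) ` topspace gamma_long_line"
    then obtain x where "z = case_extended Fin (Fin q) (Fin p) x" by blast
    then show "z \<in> range Fin" by (cases x) auto
  next
    fix z :: "long_line extended" assume "z \<in> range Fin"
    then obtain x where "z = Fin x" by blast
    then show "z \<in> case_extended Fin (Fin q) (Fin p) ` topspace gamma_long_line"
      by (intro image_eqI[of _ _ "Fin x"]) simp_all
  qed
qed (auto simp: inj_def split: extended.splits)

lemma long_line_homeomorphic_identify:
  fixes f :: "long_line \<Rightarrow> 'a"
  assumes K: "Hausdorff_space K" and f: "continuous_map euclidean K f" "inj f" "range f = topspace K"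
    and bot: "limitin K f (f p) at_bot" and top: "limitin K f (f q) at_top"
  shows "K homeomorphic_space identify gamma_long_line {(Minf, Fin p), (Pinf, Fin q)}"
proof -
  have fK: "f x \<in> topspace K" for x using f(3) by blast
  define F where "F = case_extended f (f q) (f p)"
  have F: "F (Fin x) = f x" "F Pinf = f q" "F Minf = f p" for x by (simp_all add: F_def)
  have "open {z. F z \<in> V}" if V: "openin K V" for V
  proof (subst open_subopen, intro ballI)
    fix z assume "z \<in> {z. F z \<in> V}"
    then have z: "F z \<in> V" by simp
    have "openin euclidean {x \<in> topspace euclidean. f x \<in> V}"
      by (rule openin_continuous_map_preimage[OF f(1) V])
    then have op: "open {x. f x \<in> V}" by simp
    show "\<exists>T. open T \<and> z \<in> T \<and> T \<subseteq> {z. F z \<in> V}"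
    proof (cases z)
      case (Fin x)
      then show ?thesis using z open_Fin[OF op]
        by (intro exI[of _ "Fin ` {x. f x \<in> V}"]) (auto simp: F)
    next
      case Pinf
      then obtain N where N: "\<And>x. N \<le> x \<Longrightarrow> f x \<in> V"
        using limitinD[OF top V] z by (auto simp: eventually_at_top_linorder F)
      have "F w \<in> V" if "w \<in> {Fin N<..}" for w
        using that N z Pinf by (cases w) (auto simp: F less_imp_le)
      then show ?thesis using Pinf by (intro exI[of _ "{Fin N<..}"]) auto
    next
      case Minf
      then obtain N where N: "\<And>x. x \<le> N \<Longrightarrow> f x \<in> V"
        using limitinD[OF bot V] z by (auto simp: eventually_at_bot_linorder F)
      have "F w \<in> V" if "w \<in> {..<Fin N}" for w
        using that N z Minf by (cases w) (auto simp: F less_imp_le)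
      then show ?thesis using Minf by (intro exI[of _ "{..<Fin N}"]) auto
    qed
  qed
  moreover have "F z \<in> topspace K" for z using fK by (cases z) (auto simp: F)
  ultimately have cont: "continuous_map gamma_long_line K F" by (simp add: continuous_map image_subset_iff)
  have "F z = F (case_extended Fin (Fin q) (Fin p) z)" for z by (cases z) (auto simp: F)
  then show ?thesis
    using f(2,3)
    by (intro identification.homeomorphic_identify[OF identification_gamma compact_gamma_long_line K cont])
      (simp_all add: F)
qed

text \<open>Each end is reached along one of the two embedded rays, where limits at infinity
  exist.\<close>

lemma ex_limits_long_line:
  fixes f :: "long_line \<Rightarrow> 'a"
  assumes "compact_space K" "Hausdorff_space K" and f: "continuous_map euclidean K f"
  obtains k l where "limitin K f k at_bot" "limitin K f l at_top"
proof -
  have "continuous_on UNIV pos_ray"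
  proof (rule continuous_on_order_embedding)
    show "{pos_ray r..pos_ray s} \<subseteq> range pos_ray" for r s
    proof
      fix z assume z: "z \<in> {pos_ray r..pos_ray s}"
      show "z \<in> range pos_ray"
      proof (cases z rule: long_line_cases)
        case (2 t)
        then have "z = pos_ray 0" using z by (auto simp: long_line_order neg_ray_0)
        then show ?thesis by blast
      qed auto
    qed
  qed (rule long_line_order)
  then have "continuous_map euclidean K (f \<circ> pos_ray)" by (intro continuous_map_compose[OF _ f]) simp
  then obtain l where l: "limitin K (f \<circ> pos_ray) l at_top" using ex_limit_at_infinity[OF assms(1,2)] by blast
  have "continuous_on UNIV neg_ray"
  proof (rule continuous_on_order_reversing)
    show "{neg_ray r..neg_ray s} \<subseteq> range neg_ray" for r s
    proof
      fix z assume z: "z \<in> {neg_ray r..neg_ray s}"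
      show "z \<in> range neg_ray"
      proof (cases z rule: long_line_cases)
        case (1 t)
        then have "z = neg_ray 0" using z by (auto simp: long_line_order neg_ray_0)
        then show ?thesis by blast
      qed auto
    qed
  qed (rule long_line_order)
  then have "continuous_map euclidean K (f \<circ> neg_ray)" by (intro continuous_map_compose[OF _ f]) simp
  then obtain k where k: "limitin K (f \<circ> neg_ray) k at_top" using ex_limit_at_infinity[OF assms(1,2)] by blast
  have "limitin K f l at_top"
    unfolding limitin_def
  proof (intro conjI allI impI)
    show "l \<in> topspace K" by (rule limitin_topspace[OF l])
    fix V assume "openin K V \<and> l \<in> V"
    then obtain N where N: "\<And>r. N \<le> r \<Longrightarrow> f (pos_ray r) \<in> V"
      using limitinD[OF l, of V] by (auto simp: eventually_at_top_linorder)
    \<comment> \<open>\<open>max N 1\<close> is positive, so no \<open>neg_ray r\<close> lies above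
      its image; with \<open>N = 0\<close> the point \<open>neg_ray 0\<close> would.\<close>
    have "f x \<in> V" if "pos_ray (max N 1) \<le> x" for x
    proof (cases x rule: long_line_cases)
      case (2 r)
      then have "max N 1 = 0" using that by (simp add: long_line_order)
      then show ?thesis using long_ray_zero_less_one by (metis leD max.cobounded2)
    qed (use that N in \<open>auto simp: long_line_order\<close>)
    then show "eventually (\<lambda>x. f x \<in> V) at_top" by (auto simp: eventually_at_top_linorder)
  qed
  moreover have "limitin K f k at_bot"
    unfolding limitin_def
  proof (intro conjI allI impI)
    show "k \<in> topspace K" by (rule limitin_topspace[OF k])
    fix V assume "openin K V \<and> k \<in> V"
    then obtain N where N: "\<And>r. N \<le> r \<Longrightarrow> f (neg_ray r) \<in> V"
      using limitinD[OF k, of V] by (auto simp: eventually_at_top_linorder)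
    have "f x \<in> V" if "x \<le> neg_ray (max N 1)" for x
    proof (cases x rule: long_line_cases)
      case (1 r)
      then have "max N 1 = 0" using that by (simp add: long_line_order)
      then show ?thesis using long_ray_zero_less_one by (metis leD max.cobounded2)
    qed (use that N in \<open>auto simp: long_line_order\<close>)
    then show "eventually (\<lambda>x. f x \<in> V) at_bot" by (auto simp: eventually_at_bot_linorder)
  qed
  ultimately show ?thesis by (intro that)
qed

section \<open>Gluing points in standard position\<close>

text \<open>The two half-lines at \<open>m\<close> are long rays in which the image of 1 can be
  prescribed, and \<open>long_line_iso\<close> joins them.\<close>

lemma long_line_automorphism:
  assumes "d < m" "m < (c :: long_line)"
  obtains g :: "long_line \<Rightarrow> long_line" where "range g = UNIV" "\<And>x y. g x \<le> g y \<longleftrightarrow> x \<le> y"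
    "g 0 = m" "g 1 = c" "g (- 1) = d"
proof (rule long_line_iso[of UNIV "(\<le>)" m c d])
  have "{x \<in> UNIV. m \<le> x} = {m..}" "{x \<in> UNIV. x \<le> m} = {..m}" by auto
  then show "ray_order {x \<in> UNIV. m \<le> x} (\<le>) m" "ray_order {x \<in> UNIV. x \<le> m} (\<lambda>x y. y \<le> x) m"
    using ray_order_atLeast ray_order_atMost by simp_all
qed (use assms that in auto)

lemma long_line_reparametrise:
  fixes f :: "long_line \<Rightarrow> 'a" and g :: "long_line \<Rightarrow> long_line"
  assumes f: "continuous_map euclidean K f" "inj f" "range f = topspace K"
    and lim: "limitin K f k at_bot" "limitin K f l at_top"
    and g: "range g = UNIV" "\<And>x y. g x \<le> g y \<longleftrightarrow> x \<le> y"
  shows "continuous_map euclidean K (f \<circ> g)" "inj (f \<circ> g)" "range (f \<circ> g) = topspace K"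
    "limitin K (f \<circ> g) k at_bot" "limitin K (f \<circ> g) l at_top"
proof -
  have "continuous_on UNIV g" by (rule continuous_on_order_embedding) (use g in auto)
  then show "continuous_map euclidean K (f \<circ> g)" by (intro continuous_map_compose[OF _ f(1)]) simp
  have "inj g" by (rule injI) (metis g(2) order.antisym order.refl)
  with f(2) show "inj (f \<circ> g)" by (rule inj_compose)
  show "range (f \<circ> g) = topspace K" unfolding image_comp[symmetric] g(1) by (rule f(3))
  have ex: "\<exists>M. g M = N" for N using g(1) by (metis UNIV_I imageE)
  show "limitin K (f \<circ> g) k at_bot"
    unfolding limitin_def
  proof (intro conjI allI impI)
    show "k \<in> topspace K" by (rule limitin_topspace[OF lim(1)])
    fix V assume "openin K V \<and> k \<in> V"
    then obtain N where N: "\<And>x. x \<le> N \<Longrightarrow> f x \<in> V"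
      using limitinD[OF lim(1), of V] by (auto simp: eventually_at_bot_linorder)
    obtain M where "g M = N" using ex by blast
    then have "(f \<circ> g) x \<in> V" if "x \<le> M" for x using N[of "g x"] g(2)[of x M] that by simp
    then show "eventually (\<lambda>x. (f \<circ> g) x \<in> V) at_bot" unfolding eventually_at_bot_linorder by blast
  qed
  show "limitin K (f \<circ> g) l at_top"
    unfolding limitin_def
  proof (intro conjI allI impI)
    show "l \<in> topspace K" by (rule limitin_topspace[OF lim(2)])
    fix V assume "openin K V \<and> l \<in> V"
    then obtain N where N: "\<And>x. N \<le> x \<Longrightarrow> f x \<in> V"
      using limitinD[OF lim(2), of V] by (auto simp: eventually_at_top_linorder)
    obtain M where "g M = N" using ex by blast
    then have "(f \<circ> g) x \<in> V" if "M \<le> x" for x using N[of "g x"] g(2)[of M x] that by simp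
    then show "eventually (\<lambda>x. (f \<circ> g) x \<in> V) at_top" unfolding eventually_at_top_linorder by blast
  qed
qed

text \<open>Let \<open>f p\<close> be the limit at the lower end and \<open>f q\<close> that at the
  upper end. For p < q each end loops back on its own side and gives the dumbbell, p = q gives the
  figure eight, and for q < p the loops overlap and give the theta-curve.\<close>

lemma long_line_image_homeomorphic:
  assumes K: "compact_space K" "Hausdorff_space K" and "long_image TYPE(long_line) K"
  shows "K homeomorphic_space long_dumbbell \<or> K homeomorphic_space long_figure_eight \<or>
    K homeomorphic_space long_theta_curve"
proof -
  obtain f :: "long_line \<Rightarrow> 'a" where f: "continuous_map euclidean K f" "inj f" "range f = topspace K"
    using assms(3) by (auto simp: long_image_def)
  obtain k l where lim: "limitin K f k at_bot" "limitin K f l at_top"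
    using ex_limits_long_line[OF K f(1)] by blast
  have "k \<in> range f" "l \<in> range f" unfolding f(3) by (rule limitin_topspace[OF lim(1)] limitin_topspace[OF lim(2)])+
  then obtain p q where pq: "k = f p" "l = f q" by blast
  have between: "\<exists>m. x < m \<and> m < y" if xy: "x < y" for x y :: long_line
  proof -
    obtain \<phi> where \<phi>: "order_chart \<phi> x y" using ex_order_chart[OF xy] by blast
    have "x < \<phi> (1/2)" "\<phi> (1/2) < y"
      using order_chartD(4)[OF \<phi>, of "1/2" 0] order_chartD(4)[OF \<phi>, of 1 "1/2"] order_chartD(1,2)[OF \<phi>]
      by (simp_all add: not_le[symmetric])
    then show ?thesis by blast
  qed
  show ?thesis
  proof (cases p q rule: linorder_cases)
    case less
    \<comment> \<open>Any intermediate point can be the image of 0; the automorphism then moves -1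
      to \<open>p\<close> and 1 to \<open>q\<close>.\<close>
    then obtain m where m: "p < m" "m < q" using between by blast
    show ?thesis
    proof (rule long_line_automorphism[OF m])
      fix g :: "long_line \<Rightarrow> long_line"
      assume g: "range g = UNIV" "\<And>x y. g x \<le> g y \<longleftrightarrow> x \<le> y" "g 0 = m" "g 1 = q" "g (- 1) = p"
      note fg = long_line_reparametrise[OF f lim g(1,2)]
      have "K homeomorphic_space identify gamma_long_line {(Minf, Fin (- 1)), (Pinf, Fin 1)}"
        using fg(4,5) pq g(4,5) by (intro long_line_homeomorphic_identify[OF K(2) fg(1-3)]) simp_all
      then show ?thesis by (simp add: long_dumbbell_def)
    qed
  next
    case equal
    \<comment> \<open>Only the image of 0 matters here; these are arbitrary points on the two sides
      of \<open>p\<close> to be the images of -1 and 1.\<close>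
    obtain b where b: "neg_ray b < p" "p < pos_ray b"
      using countable_long_line_bounded[of "{p}"] by auto
    show ?thesis
    proof (rule long_line_automorphism[OF b])
      fix g :: "long_line \<Rightarrow> long_line"
      assume g: "range g = UNIV" "\<And>x y. g x \<le> g y \<longleftrightarrow> x \<le> y" "g 0 = p"
      note fg = long_line_reparametrise[OF f lim g(1,2)]
      have "K homeomorphic_space identify gamma_long_line {(Minf, Fin 0), (Pinf, Fin 0)}"
        using fg(4,5) pq g(3) equal by (intro long_line_homeomorphic_identify[OF K(2) fg(1-3)]) simp_all
      then show ?thesis by (simp add: long_figure_eight_def)
    qed
  next
    case greater
    then obtain m where m: "q < m" "m < p" using between by blast
    show ?thesis
    proof (rule long_line_automorphism[OF m])
      fix g :: "long_line \<Rightarrow> long_line"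
      assume g: "range g = UNIV" "\<And>x y. g x \<le> g y \<longleftrightarrow> x \<le> y" "g 0 = m" "g 1 = p" "g (- 1) = q"
      note fg = long_line_reparametrise[OF f lim g(1,2)]
      have "K homeomorphic_space identify gamma_long_line {(Minf, Fin 1), (Pinf, Fin (- 1))}"
        using fg(4,5) pq g(4,5) by (intro long_line_homeomorphic_identify[OF K(2) fg(1-3)]) simp_all
      then show ?thesis by (simp add: long_theta_curve_def)
    qed
  qed
qed

section \<open>Images of closed intervals of the long line\<close>

lemma long_image_compose:
  fixes g :: "'t::long_order \<Rightarrow> 'b::topological_space"
  assumes f: "continuous_map (top_of_set I) K f" "inj_on f I" "f ` I = topspace K"
    and g: "continuous_on UNIV g" "inj g" "range g = I"
  shows "long_image TYPE('t) K"
proof -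
  have "continuous_map euclidean (top_of_set I) g"
    using g(1,3) by (intro continuous_map_into_subtopology) auto
  then have "continuous_map euclidean K (f \<circ> g)" using f(1) by (rule continuous_map_compose)
  moreover have "inj (f \<circ> g)" using g(2,3) f(2) by (simp add: comp_inj_on)
  moreover have "range (f \<circ> g) = topspace K" unfolding image_comp[symmetric] g(3) by (rule f(3))
  ultimately show ?thesis unfolding long_image_def by blast
qed

text \<open>A chart pulls \<open>I\<close> back to a set of reals, and every set of reals has a
  countable dense subset of its own.\<close>

lemma separable_bounded_image:
  fixes I :: "'b::long_order set"
  assumes f: "continuous_map (top_of_set I) K f" "f ` I = topspace K" and I: "I \<subseteq> {x..y}"
  shows "separable_space K"
proof -
  \<comment> \<open>The bounds are not assumed to satisfy x < y, so they are first enclosed in a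
    nondegenerate interval that has a chart.\<close>
  have "countable {x, y}" by simp
  from countable_subset_interval[OF this] obtain u v where uv: "u < v" "{x, y} \<subseteq> {u..v}" by blast
  have "{x..y} \<subseteq> {u..v}" using uv(2) by auto
  then have Iuv: "I \<subseteq> {u..v}" using I by blast
  obtain \<phi> where \<phi>: "order_chart \<phi> u v" using ex_order_chart[OF uv(1)] by blast
  define J where "J = {t \<in> {0..1}. \<phi> t \<in> I}"
  have \<phi>J: "\<phi> ` J = I"
  proof (intro equalityI subsetI)
    fix z assume z: "z \<in> I"
    then have "z \<in> \<phi> ` {0..1}" unfolding order_chartD(3)[OF \<phi>] using Iuv by blast
    then obtain t where "t \<in> {0..1}" "z = \<phi> t" by blast
    then show "z \<in> \<phi> ` J" using z by (auto simp: J_def)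
  qed (auto simp: J_def)
  have "continuous_on J \<phi>"
    by (rule continuous_on_subset[OF continuous_on_order_chart[OF \<phi>]]) (auto simp: J_def)
  then have "continuous_map (top_of_set J) (top_of_set I) \<phi>"
    using \<phi>J by (intro continuous_map_into_subtopology) auto
  then have cont: "continuous_map (top_of_set J) K (f \<circ> \<phi>)" using f(1) by (rule continuous_map_compose)
  obtain T :: "real set" where T: "countable T" "T \<subseteq> J" "J \<subseteq> closure T"
    using separable[of J] by metis
  have "top_of_set J closure_of T = J"
    using T by (auto simp: closure_of_subtopology Int_absorb1)
  then have "separable_space (top_of_set J)"
    unfolding separable_space_def using T by (intro exI[of _ T]) simp
  then show ?thesis
  proof (rule separable_space_continuous_map_image[OF _ cont])
    show "(f \<circ> \<phi>) ` topspace (top_of_set J) = topspace K"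
      unfolding topspace_euclidean_subtopology image_comp[symmetric] \<phi>J by (rule f(2))
  qed
qed

lemma long_line_unbounded: "\<exists>y. (x :: long_line) < y" "\<exists>y. y < (x :: long_line)"
  using countable_long_line_bounded[of "{x}"] by auto

text \<open>The part of \<open>I\<close> below one of its points is compact and so has a minimum
  \<open>m\<close>; convexity and unboundedness above fill in everything beyond
  \<open>m\<close>.\<close>

lemma closed_subinterval_atLeast:
  fixes I :: "long_line set"
  assumes I: "closed_subinterval I" and bd: "I \<subseteq> {x..}" and unbd: "\<And>y. \<not> I \<subseteq> {..y}"
  shows "\<exists>m. I = {m..}"
proof -
  obtain w where w: "w \<in> I" using I by (auto simp: closed_subinterval_def)
  have *: "I \<inter> {..w} = {x..w} \<inter> I" using bd by auto
  have "closed I" using I by (simp add: closed_subinterval_def)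
  then have "compact (I \<inter> {..w})" unfolding * by (rule compact_Int_closed[OF compact_interval])
  moreover have "I \<inter> {..w} \<noteq> {}" using w by blast
  ultimately obtain m where m: "m \<in> I \<inter> {..w}" "\<And>t. t \<in> I \<inter> {..w} \<Longrightarrow> m \<le> t"
    using compact_attains_inf by metis
  have least: "m \<le> t" if "t \<in> I" for t
  proof (cases "t \<le> w")
    case True
    then show ?thesis using m(2)[of t] that by blast
  next
    case False
    then have "w \<le> t" by (simp add: not_le less_imp_le)
    moreover have "m \<le> w" using m(1) by simp
    ultimately show ?thesis by (rule order_trans[rotated])
  qed
  have "z \<in> I" if "m \<le> z" for z
  proof -
    obtain y where y: "y \<in> I" "\<not> y \<le> z" using unbd[of z] by blast
    then have "{m..y} \<subseteq> I" using I m(1) by (auto simp: closed_subinterval_def)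
    moreover have "z \<in> {m..y}" using that y(2) by (simp add: not_le less_imp_le)
    ultimately show ?thesis by blast
  qed
  with least have "I = {m..}" by auto
  then show ?thesis ..
qed

lemma closed_subinterval_atMost:
  fixes I :: "long_line set"
  assumes I: "closed_subinterval I" and bd: "I \<subseteq> {..x}" and unbd: "\<And>y. \<not> I \<subseteq> {y..}"
  shows "\<exists>m. I = {..m}"
proof -
  obtain w where w: "w \<in> I" using I by (auto simp: closed_subinterval_def)
  have *: "I \<inter> {w..} = {w..x} \<inter> I" using bd by auto
  have "closed I" using I by (simp add: closed_subinterval_def)
  then have "compact (I \<inter> {w..})" unfolding * by (rule compact_Int_closed[OF compact_interval])
  moreover have "I \<inter> {w..} \<noteq> {}" using w by blast
  ultimately obtain m where m: "m \<in> I \<inter> {w..}" "\<And>t. t \<in> I \<inter> {w..} \<Longrightarrow> t \<le> m"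
    using compact_attains_sup by metis
  have greatest: "t \<le> m" if "t \<in> I" for t
  proof (cases "w \<le> t")
    case True
    then show ?thesis using m(2)[of t] that by blast
  next
    case False
    then have "t \<le> w" by (simp add: not_le less_imp_le)
    moreover have "w \<le> m" using m(1) by simp
    ultimately show ?thesis by (rule order_trans)
  qed
  have "z \<in> I" if "z \<le> m" for z
  proof -
    obtain y where y: "y \<in> I" "\<not> z \<le> y" using unbd[of z] by blast
    then have "{y..m} \<subseteq> I" using I m(1) by (auto simp: closed_subinterval_def)
    moreover have "z \<in> {y..m}" using that y(2) by (simp add: not_le less_imp_le)
    ultimately show ?thesis by blast
  qed
  with greatest have "I = {..m}" by auto
  then show ?thesis ..
qed

text \<open>Bounded intervals have separable images. Those remaining are the whole line and the two
  kinds of half-line, each a long ray; for the one unbounded below, the parametrisation reverses the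
  order.\<close>

lemma closed_subinterval_imp_long_image:
  fixes I :: "long_line set"
  assumes nonsep: "\<not> separable_space K" and I: "closed_subinterval I"
    and "continuous_injective_image (top_of_set I) K"
  shows "long_image TYPE(long_ray) K \<or> long_image TYPE(long_line) K"
proof -
  obtain f where f: "continuous_map (top_of_set I) K f" "inj_on f I" "f ` I = topspace K"
    using assms(3) by (auto simp: continuous_injective_image_def)
  have nb: "\<not> I \<subseteq> {x..y}" for x y
    using separable_bounded_image[OF f(1,3)] nonsep by blast
  consider (both) "\<And>x. \<not> I \<subseteq> {x..}" "\<And>x. \<not> I \<subseteq> {..x}" | (below) x where "I \<subseteq> {x..}" | (above) x where "I \<subseteq> {..x}"
    by blast
  then show ?thesis
  proof cases
    case both
    have "z \<in> I" for z
    proof -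
      obtain x where x: "x \<in> I" "\<not> z \<le> x" using both(1)[of z] by blast
      obtain y where y: "y \<in> I" "\<not> y \<le> z" using both(2)[of z] by blast
      have "{x..y} \<subseteq> I" using I x y by (auto simp: closed_subinterval_def)
      moreover have "z \<in> {x..y}" using x y by (simp add: not_le less_imp_le)
      ultimately show ?thesis by blast
    qed
    then have "range (\<lambda>x. x) = I" by auto
    then have "long_image TYPE(long_line) K" by (intro long_image_compose[OF f, of "\<lambda>x. x"]) auto
    then show ?thesis ..
  next
    case below
    have "\<not> I \<subseteq> {..y}" for y
    proof
      assume "I \<subseteq> {..y}"
      with below have "I \<subseteq> {x..y}" by auto
      with nb show False by blast
    qed
    then obtain m where m: "I = {m..}" using closed_subinterval_atLeast[OF I below] by blast
    obtain c where "m < c" using long_line_unbounded(1) by blast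
    then have c: "c \<in> {m..}" "c \<noteq> m" by auto
    have "long_image TYPE(long_ray) K"
    proof (rule ray_order.long_ray_iso[OF ray_order_atLeast c])
      fix g :: "long_ray \<Rightarrow> long_line"
      assume g: "range g = {m..}" "\<And>r s. g r \<le> g s \<longleftrightarrow> r \<le> s"
      have "continuous_on UNIV g"
      proof (rule continuous_on_order_embedding)
        have "m \<le> g r" for r using g(1) by blast
        then show "{g r..g s} \<subseteq> range g" for r s unfolding g(1) by (meson atLeast_iff atLeastAtMost_iff order_trans subsetI)
      qed (rule g(2))
      moreover have "inj g" by (rule injI) (metis g(2) order.antisym order.refl)
      ultimately show ?thesis using g(1) m by (intro long_image_compose[OF f]) auto
    qed
    then show ?thesis ..
  next
    case above
    have "\<not> I \<subseteq> {y..}" for y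
    proof
      assume "I \<subseteq> {y..}"
      with above have "I \<subseteq> {y..x}" by auto
      with nb show False by blast
    qed
    then obtain m where m: "I = {..m}" using closed_subinterval_atMost[OF I above] by blast
    obtain c where "c < m" using long_line_unbounded(2) by blast
    then have c: "c \<in> {..m}" "c \<noteq> m" by auto
    have "long_image TYPE(long_ray) K"
    proof (rule ray_order.long_ray_iso[OF ray_order_atMost c])
      fix g :: "long_ray \<Rightarrow> long_line"
      assume g: "range g = {..m}" "\<And>r s. g s \<le> g r \<longleftrightarrow> r \<le> s"
      have "continuous_on UNIV g"
      proof (rule continuous_on_order_reversing)
        have "g r \<le> m" for r using g(1) by blast
        then show "{g r..g s} \<subseteq> range g" for r s unfolding g(1) by (meson atMost_iff atLeastAtMost_iff order_trans subsetI)
      qed (rule g(2))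
      moreover have "inj g" by (rule injI) (metis g(2) order.antisym order.refl)
      ultimately show ?thesis using g(1) m by (intro long_image_compose[OF f]) auto
    qed
    then show ?thesis ..
  qed
qed

text \<open>The ray sits in the line as \<open>{0..}\<close>, where \<open>magnitude\<close> is a
  continuous bijection onto it; the line is a closed subinterval of itself.\<close>

lemma long_image_imp_closed_subinterval:
  assumes "long_image TYPE(long_ray) K \<or> long_image TYPE(long_line) K"
  shows "\<exists>I :: long_line set. closed_subinterval I \<and> continuous_injective_image (top_of_set I) K"
  using assms
proof
  assume "long_image TYPE(long_ray) K"
  then obtain f :: "long_ray \<Rightarrow> _" where f: "continuous_map euclidean K f" "inj f" "range f = topspace K"
    by (auto simp: long_image_def)
  have nonneg: "\<exists>r. x = pos_ray r" if "0 \<le> x" for x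
  proof (cases x rule: long_line_cases)
    case (2 r)
    then have "r = 0" using that by (simp add: pos_ray_0[symmetric] long_line_order del: pos_ray_0)
    then show ?thesis using 2 neg_ray_0 by blast
  qed blast
  have pos: "pos_ray r \<in> {0..}" for r
    by (simp add: zero_long_line_def long_line_order)
  have img: "magnitude ` {0..} = UNIV"
    using pos by (metis UNIV_eq_I image_eqI magnitude_rays(1))
  have ord: "magnitude x \<le> magnitude y \<longleftrightarrow> x \<le> y" if "x \<in> {0..}" "y \<in> {0..}" for x y
    using nonneg[of x] nonneg[of y] that by (auto simp: long_line_order)
  have "continuous_on {0..} magnitude"
    by (rule continuous_on_order_embedding[OF ord]) (simp_all add: img)
  then have "continuous_map (top_of_set {0..}) K (f \<circ> magnitude)"
    by (intro continuous_map_compose[OF _ f(1)]) simp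
  moreover have "inj_on magnitude {0..}"
    by (rule inj_onI) (metis ord order.antisym order.refl)
  then have "inj_on (f \<circ> magnitude) {0..}"
    by (rule comp_inj_on) (rule inj_on_subset[OF f(2) subset_UNIV])
  moreover have "(f \<circ> magnitude) ` {0..} = topspace K"
    unfolding image_comp[symmetric] img by (rule f(3))
  ultimately have "continuous_injective_image (top_of_set {0::long_line..}) K"
    unfolding continuous_injective_image_def by (intro exI[of _ "f \<circ> magnitude"]) simp
  moreover have "closed_subinterval {0::long_line..}"
    by (auto simp: closed_subinterval_def)
  ultimately show ?thesis by blast
next
  assume "long_image TYPE(long_line) K"
  then have "continuous_injective_image (top_of_set (UNIV :: long_line set)) K"
    by (simp add: long_image_def continuous_injective_image_def)
  moreover have "closed_subinterval (UNIV :: long_line set)"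
    by (simp add: closed_subinterval_def)
  ultimately show ?thesis by blast
qed

lemma long_image_iff_homeomorphic:
  assumes K: "compact_space K" "Hausdorff_space K"
  shows "long_image TYPE(long_ray) K \<or> long_image TYPE(long_line) K \<longleftrightarrow>
    K homeomorphic_space long_circle \<or>
    (\<exists>p. p \<noteq> 0 \<and> K homeomorphic_space long_lollipop p) \<or>
    K homeomorphic_space long_dumbbell \<or>
    K homeomorphic_space long_figure_eight \<or>
    K homeomorphic_space long_theta_curve" (is "?lhs \<longleftrightarrow> ?rhs")
proof
  assume ?lhs
  then show ?rhs
  proof
    assume "long_image TYPE(long_ray) K"
    then obtain p where p: "K homeomorphic_space identify alpha_long_ray {(None, Some p)}"
      using long_ray_image_homeomorphic[OF K] by blast
    then show ?rhs
      unfolding long_circle_def long_lollipop_def by (cases "p = 0") blast+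
  next
    assume "long_image TYPE(long_line) K"
    then show ?rhs using long_line_image_homeomorphic[OF K] by blast
  qed
next
  have ray: "long_image TYPE(long_ray) K" if "K homeomorphic_space identify alpha_long_ray {(None, Some p)}" for p
    by (rule long_image_homeomorphic_space[OF that identification.long_image_identify[OF identification_alpha]])
  have line: "long_image TYPE(long_line) K"
    if "K homeomorphic_space identify gamma_long_line {(Minf, Fin p), (Pinf, Fin q)}" for p q
    by (rule long_image_homeomorphic_space[OF that identification.long_image_identify[OF identification_gamma]])
  assume ?rhs
  then show ?lhs
    unfolding long_circle_def long_lollipop_def long_dumbbell_def long_figure_eight_def long_theta_curve_def
    using ray line by blast
qed

theorem theorem2p17:
  fixes K :: "'a topology"
  assumes "continuum_space K"
  shows "(separable_space K \<and> ac_space natLeq K \<longrightarrow> arc_space K) \<and>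
    (\<not> separable_space K \<longrightarrow>
      (ac_space natLeq K \<longleftrightarrow>
        (\<exists>I :: long_line set. closed_subinterval I \<and> continuous_injective_image (top_of_set I) K)) \<and>
      ((\<exists>I :: long_line set. closed_subinterval I \<and> continuous_injective_image (top_of_set I) K) \<longleftrightarrow>
        K homeomorphic_space long_circle \<or>
        (\<exists>p. p \<noteq> 0 \<and> K homeomorphic_space long_lollipop p) \<or>
        K homeomorphic_space long_dumbbell \<or>
        K homeomorphic_space long_figure_eight \<or>
        K homeomorphic_space long_theta_curve)) \<and>
    (\<forall>\<kappa> :: 'k rel. Card_order \<kappa> \<and> natLeq <o \<kappa> \<and> ac_space \<kappa> K \<longrightarrow> arc_space K)"
proof -
  have K: "compact_space K" "Hausdorff_space K" using assms by (simp_all add: continuum_space_def)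
  let ?long = "long_image TYPE(long_ray) K \<or> long_image TYPE(long_line) K"
  have sep: "arc_space K" if "separable_space K" "ac_space natLeq K"
    using separable_ac_space_imp_arc_space[OF K(2) that] .
  have ac: "?long" if "\<not> separable_space K" "ac_space natLeq K"
    by (rule ac_space_imp_long_image[OF K that(2,1)])
  have ac_iff: "ac_space natLeq K \<longleftrightarrow> ?long" if "\<not> separable_space K"
    using ac[OF that] long_image_imp_ac_space[OF K(2), where 'b = long_ray]
      long_image_imp_ac_space[OF K(2), where 'b = long_line] by blast
  have image_iff: "(\<exists>I :: long_line set. closed_subinterval I \<and> continuous_injective_image (top_of_set I) K) \<longleftrightarrow> ?long"
    if "\<not> separable_space K"
    using closed_subinterval_imp_long_image[OF that] long_image_imp_closed_subinterval by blast
  \<comment> \<open>\<kappa>-ac implies aleph_0-ac, so a nonseparable \<open>K\<close> would be a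
    long image; but long images are not \<kappa>-ac. Hence \<open>K\<close> is separable and the
    first part applies.\<close>
  have uncountable: "arc_space K" if \<kappa>: "Card_order \<kappa>" "natLeq <o \<kappa>" "ac_space \<kappa> K" for \<kappa> :: "'k rel"
  proof -
    have "ac_space natLeq K"
      using \<kappa>(3) ordLeq_transitive[OF _ ordLess_imp_ordLeq[OF \<kappa>(2)]] unfolding ac_space_def by blast
    moreover have "\<not> ?long" using long_image_imp_not_ac_space[OF K(2) _ \<kappa>(1,2), where 'b = long_ray]
        long_image_imp_not_ac_space[OF K(2) _ \<kappa>(1,2), where 'b = long_line] \<kappa>(3) by blast
    ultimately show ?thesis using sep ac by blast
  qed
  show ?thesis
    using sep ac_iff image_iff uncountable unfolding long_image_iff_homeomorphic[OF K, symmetric] by blast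
qed

end
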